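(* Let $n=2$, and let $\Omega$, $\Phi$, $\mathcal{A}$, $\mathcal{C}$ be as defined in the context. Then $\Phi(\Omega)=\mathcal{A}\setminus\mathcal{C}$.
   Context: $\mathbb{D}$ is the open unit disc, $\mathbb{D}_*=\mathbb{D}\setminus\{0\}$, $\mathbb{B}_2$ the open Euclidean unit ball in $\mathbb{C}^2$, $\mathbb{P}^1$ the complex projective line, $\mathcal{U}_2(\mathbb{C})$ the group of unitary $2\times2$ matrices. Extremal problems. For distinct points $p_1,\dots,p_N\in\mathbb{B}_2$ and $\lambda_1,\dots,\lambda_N\in\mathbb{D}$, the Pick problem $\mathbb{B}_2\to\mathbb{D}$, $p_j\mapsto\lambda_j$, is solvable if there is a holomorphic $F:\mathbb{B}_2\to\mathbb{D}$ with $F(p_j)=\lambda_j$ for all $j$; it is extremal if it is solvable and there is no such $F$ whose image is relatively compact in $\mathbb{D}$. An extremal $3$-point problem is non-degenerate if none of its three $2$-point subproblems is extremal, and degenerate otherwise. Let $\mathcal{D}_2=\{(z,w)\in\mathbb{B}_2\times\mathbb{B}_2: z\ne w,\ z\ne0,\ w\ne0\}$. For $(z,w)\in\mathcal{D}_2$ and $(\sigma,\tau)\in\mathbb{C}^2\setminus\{(0,0)\}$ there is exactly one $t=t_{z,w,(\sigma,\tau)}>0$ such that the problem $\mathbb{B}_2\to\mathbb{D}$, $0\mapsto0$, $z\mapsto t\sigma$, $w\mapsto t\tau$ is extremal. The extremal problem corresponding to $(z,w,[\sigma:\tau])\in\mathcal{D}_2\times\mathbb{P}^1$ is this problem with $t=t_{z,w,(\sigma,\tau)}$;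 its target points are determined by $(z,w,[\sigma:\tau])$ up to a common unimodular constant. $\mathcal{A}$ is the set of $(z,w,[\sigma:\tau])\in\mathcal{D}_2\times\mathbb{P}^1$ whose corresponding extremal problem is non-degenerate. $\mathcal{C}$ is the set of $(z,w,[\sigma:\tau])\in\mathcal{D}_2\times\mathbb{P}^1$ such that $0,z,w$ lie on a common complex line. Automorphisms. For $a\in\mathbb{D}$, $m_a(\lambda)=\frac{a-\lambda}{1-\overline{a}\lambda}$. For $w\in\mathbb{B}_2$, $\chi_w$ is the standard idempotent (involutive) automorphism of $\mathbb{B}_2$ interchanging $0$ and $w$: $\chi_w(z)=\frac{w-P_wz-\sqrt{1-\|w\|^2}\,(z-P_wz)}{1-\langle z,w\rangle}$, where $P_w$ is the orthogonal projection onto $\mathbb{C}w$ ($P_0=0$, so $\chi_0(z)=-z$). The map $\Phi$. Let $$\Omega:=\{(x,y,a,U,c)\in\mathbb{D}_*\times\mathbb{D}_*\times(0,1)\times\mathcal{U}_2(\mathbb{C})\times(-1,1):\ x\ne y\},$$ and for $(x,y,a,U,c)\in\Omega$ put $\gamma=\frac{2c}{1+c^2}$, $w=U(ac,\sqrt{1-a^2}\,c^2)$, $$\varphi_{a,U,c}(\lambda):=\chi_w\big(U(a\,m_c(\lambda),\ \sqrt{1-a^2}\,m_c(\lambda)^2)\big),\quad\lambda\in\mathbb{D},$$ $$\Phi(x,y,a,U,c):=\big(\varphi_{a,U,c}(x),\ \varphi_{a,U,c}(y),\ [x\,m_\gamma(x):y\,m_\gamma(y)]\big)\in\mathcal{D}_2\times\mathbb{P}^1.$$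 *)

theory Defs
  imports "HOL-Analysis.Analysis"
begin

abbreviation unit_disc :: "complex set" where
  "unit_disc \<equiv> ball 0 1"

abbreviation ball2 :: "(complex^2) set" where
  "ball2 \<equiv> ball 0 1"

definition cdot :: "complex^2 \<Rightarrow> complex^2 \<Rightarrow> complex" where
  "cdot z w = (\<Sum>i\<in>UNIV. z $ i * cnj (w $ i))"

text \<open>Holomorphy in several variables: complex Frechet differentiability, that is,
  real Frechet differentiability with a complex-linear derivative.\<close>

definition holomorphic2_on :: "(complex^2 \<Rightarrow> complex) \<Rightarrow> (complex^2) set \<Rightarrow> bool" where
  "holomorphic2_on F S \<longleftrightarrow>
     (\<forall>p\<in>S. \<exists>F'. (F has_derivative F') (at p within S) \<and> (\<forall>c v. F' (c *s v) = c * F' v))"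

text \<open>A Pick problem is given by the list of pairs (node, target).\<close>

definition pick_problem :: "((complex^2) \<times> complex) list \<Rightarrow> bool" where
  "pick_problem ps \<longleftrightarrow> distinct (map fst ps) \<and> (\<forall>(p, l)\<in>set ps. p \<in> ball2 \<and> l \<in> unit_disc)"

definition pick_solution :: "(complex^2 \<Rightarrow> complex) \<Rightarrow> ((complex^2) \<times> complex) list \<Rightarrow> bool" where
  "pick_solution F ps \<longleftrightarrow>
     holomorphic2_on F ball2 \<and> F ` ball2 \<subseteq> unit_disc \<and> (\<forall>(p, l)\<in>set ps. F p = l)"

definition pick_solvable :: "((complex^2) \<times> complex) list \<Rightarrow> bool" where
  "pick_solvable ps \<longleftrightarrow> pick_problem ps \<and> (\<exists>F. pick_solution F ps)"

definition relatively_compact_in :: "complex set \<Rightarrow> complex set \<Rightarrow> bool" where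
  "relatively_compact_in S T \<longleftrightarrow> compact (closure S) \<and> closure S \<subseteq> T"

definition pick_extremal :: "((complex^2) \<times> complex) list \<Rightarrow> bool" where
  "pick_extremal ps \<longleftrightarrow> pick_solvable ps \<and>
     \<not> (\<exists>F. pick_solution F ps \<and> relatively_compact_in (F ` ball2) unit_disc)"

definition nondegenerate_extremal3 ::
    "(complex^2) \<times> complex \<Rightarrow> (complex^2) \<times> complex \<Rightarrow> (complex^2) \<times> complex \<Rightarrow> bool" where
  "nondegenerate_extremal3 p q r \<longleftrightarrow> pick_extremal [p, q, r] \<and>
     \<not> pick_extremal [p, q] \<and> \<not> pick_extremal [p, r] \<and> \<not> pick_extremal [q, r]"

definition proj_rel :: "((complex \<times> complex) \<times> (complex \<times> complex)) set" where
  "proj_rel = {((a, b), (a', b')). (a, b) \<noteq> (0, 0) \<and> (a', b') \<noteq> (0, 0) \<and>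
                 (\<exists>k. k \<noteq> 0 \<and> a' = k * a \<and> b' = k * b)}"

definition P1 :: "(complex \<times> complex) set set" where
  "P1 = (UNIV - {(0, 0)}) // proj_rel"

definition proj_pt :: "complex \<Rightarrow> complex \<Rightarrow> (complex \<times> complex) set" where
  "proj_pt \<sigma> \<tau> = proj_rel `` {(\<sigma>, \<tau>)}"

lemma equiv_proj_rel: "equiv (UNIV - {(0, 0)}) proj_rel"
proof (rule equivI)
  show "proj_rel \<subseteq> (UNIV - {(0, 0)}) \<times> (UNIV - {(0, 0)})"
    by (auto simp: proj_rel_def)
  show "refl_on (UNIV - {(0, 0)}) proj_rel"
    by (auto simp: refl_on_def proj_rel_def intro!: exI[of _ 1])
  have iff: "(u, v) \<in> proj_rel \<longleftrightarrow> u \<noteq> (0, 0) \<and> v \<noteq> (0, 0) \<and>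
      (\<exists>k. k \<noteq> 0 \<and> fst v = k * fst u \<and> snd v = k * snd u)" for u v
    by (simp add: proj_rel_def case_prod_unfold prod_eq_iff)
  show "sym proj_rel"
  proof (rule symI)
    fix u v assume "(u, v) \<in> proj_rel"
    then obtain k where k: "u \<noteq> (0, 0)" "v \<noteq> (0, 0)" "k \<noteq> 0" "fst v = k * fst u" "snd v = k * snd u"
      unfolding iff by blast
    then have "inverse k \<noteq> 0 \<and> fst u = inverse k * fst v \<and> snd u = inverse k * snd v"
      by simp
    with k(1,2) show "(v, u) \<in> proj_rel" unfolding iff by blast
  qed
  show "trans proj_rel"
  proof (rule transI)
    fix u v w assume "(u, v) \<in> proj_rel" "(v, w) \<in> proj_rel"
    then obtain k l where k: "u \<noteq> (0, 0)" "w \<noteq> (0, 0)" "k \<noteq> 0" "l \<noteq> 0"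
      "fst v = k * fst u" "snd v = k * snd u" "fst w = l * fst v" "snd w = l * snd v"
      unfolding iff by blast
    then have "l * k \<noteq> 0 \<and> fst w = (l * k) * fst u \<and> snd w = (l * k) * snd u"
      by simp
    with k(1,2) show "(u, w) \<in> proj_rel" unfolding iff by blast
  qed
qed

definition D2 :: "((complex^2) \<times> (complex^2)) set" where
  "D2 = {(z, w). z \<in> ball2 \<and> w \<in> ball2 \<and> z \<noteq> w \<and> z \<noteq> 0 \<and> w \<noteq> 0}"

definition extremal_scale :: "complex^2 \<Rightarrow> complex^2 \<Rightarrow> complex \<Rightarrow> complex \<Rightarrow> real" where
  "extremal_scale z w \<sigma> \<tau> =
     (THE t. t > 0 \<and>
        pick_extremal [(0, 0), (z, complex_of_real t * \<sigma>), (w, complex_of_real t * \<tau>)])"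

lemma extremal_scale_unique:
  assumes "s > 0" "pick_extremal [(0, 0), (z, complex_of_real s * \<sigma>), (w, complex_of_real s * \<tau>)]"
    and "t > 0" "pick_extremal [(0, 0), (z, complex_of_real t * \<sigma>), (w, complex_of_real t * \<tau>)]"
  shows "s = t"
proof -
  have no_less: False
    if st: "0 < s" "s < t"
      and s: "pick_extremal [(0, 0), (z, complex_of_real s * \<sigma>), (w, complex_of_real s * \<tau>)]"
      and t: "pick_extremal [(0, 0), (z, complex_of_real t * \<sigma>), (w, complex_of_real t * \<tau>)]"
    for s t :: real
  proof -
    obtain F where F: "holomorphic2_on F ball2" "F ` ball2 \<subseteq> unit_disc"
      "F 0 = 0" "F z = of_real t * \<sigma>" "F w = of_real t * \<tau>"
      using t by (auto simp: pick_extremal_def pick_solvable_def pick_solution_def)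
    define k where "k = s / t"
    have k: "0 < k" "k < 1" "k * t = s" using st by (auto simp: k_def)
    define G where "G p = of_real k * F p" for p
    have "holomorphic2_on G ball2"
      unfolding holomorphic2_on_def
    proof
      fix p :: "complex^2" assume "p \<in> ball2"
      then obtain F' where "(F has_derivative F') (at p within ball2)"
          "\<forall>c v. F' (c *s v) = c * F' v"
        using F(1) unfolding holomorphic2_on_def by blast
      then show "\<exists>G'. (G has_derivative G') (at p within ball2) \<and>
          (\<forall>c v. G' (c *s v) = c * G' v)"
        unfolding G_def
        by (intro exI[of _ "\<lambda>v. of_real k * F' v"]) (auto intro!: has_derivative_mult_right)
    qed
    moreover have sub: "G ` ball2 \<subseteq> cball 0 k"
    proof
      fix y assume "y \<in> G ` ball2"
      then obtain p where "p \<in> ball2" "y = of_real k * F p" by (auto simp: G_def)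
      moreover from this F(2) have "F p \<in> unit_disc" by blast
      then have "norm (F p) < 1" by simp
      ultimately show "y \<in> cball 0 k"
        using k mult_left_le[of "norm (F p)" k] by (simp add: norm_mult)
    qed
    moreover have "G z = of_real s * \<sigma>" "G w = of_real s * \<tau>" "G 0 = 0"
      unfolding G_def F k(3)[symmetric] by simp_all
    moreover have disc: "cball 0 k \<subseteq> unit_disc" using k by auto
    ultimately have "pick_solution G [(0, 0), (z, of_real s * \<sigma>), (w, of_real s * \<tau>)]"
      by (auto simp: pick_solution_def)
    moreover have "closure (G ` ball2) \<subseteq> cball 0 k"
      using sub by (intro closure_minimal) auto
    then have "relatively_compact_in (G ` ball2) unit_disc"
      using disc bounded_subset[OF bounded_cball sub]
      unfolding relatively_compact_in_def compact_closure by blast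
    ultimately show False using s by (auto simp: pick_extremal_def)
  qed
  then show ?thesis using assms by (meson linorder_cases)
qed

text \<open>The membership condition does not depend on the representative of the projective point:
  another one changes the targets by a common unimodular factor.\<close>

definition \<A> :: "((complex^2) \<times> (complex^2) \<times> (complex \<times> complex) set) set" where
  "\<A> = {(z, w, proj_pt \<sigma> \<tau>) | z w \<sigma> \<tau>. (z, w) \<in> D2 \<and> (\<sigma>, \<tau>) \<noteq> (0, 0) \<and>
          nondegenerate_extremal3 (0, 0)
            (z, complex_of_real (extremal_scale z w \<sigma> \<tau>) * \<sigma>)
            (w, complex_of_real (extremal_scale z w \<sigma> \<tau>) * \<tau>)}"

definition complex_line :: "(complex^2) set \<Rightarrow> bool" where
  "complex_line L \<longleftrightarrow> (\<exists>p v. v \<noteq> 0 \<and> L = {p + \<zeta> *s v | \<zeta>. True})"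

definition \<C> :: "((complex^2) \<times> (complex^2) \<times> (complex \<times> complex) set) set" where
  "\<C> = {(z, w, l). (z, w) \<in> D2 \<and> l \<in> P1 \<and> (\<exists>L. complex_line L \<and> {0, z, w} \<subseteq> L)}"

definition mob :: "complex \<Rightarrow> complex \<Rightarrow> complex" where
  "mob a \<xi> = (a - \<xi>) / (1 - cnj a * \<xi>)"

text \<open>For \<open>w = 0\<close> this is \<open>0\<close>, since division by zero yields zero.\<close>

definition proj_onto :: "complex^2 \<Rightarrow> complex^2 \<Rightarrow> complex^2" where
  "proj_onto w z = (cdot z w / cdot w w) *s w"

definition chi_aut :: "complex^2 \<Rightarrow> complex^2 \<Rightarrow> complex^2" where
  "chi_aut w z = (1 / (1 - cdot z w)) *s
     (w - proj_onto w z - complex_of_real (sqrt (1 - (norm w)\<^sup>2)) *s (z - proj_onto w z))"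

definition conj_transpose :: "complex^2^2 \<Rightarrow> complex^2^2" where
  "conj_transpose U = (\<chi> i j. cnj (U $ j $ i))"

definition U2 :: "(complex^2^2) set" where
  "U2 = {U. conj_transpose U ** U = mat 1 \<and> U ** conj_transpose U = mat 1}"

definition curve :: "real \<Rightarrow> complex^2^2 \<Rightarrow> complex \<Rightarrow> complex^2" where
  "curve a U \<mu> = U *v vector [complex_of_real a * \<mu>, complex_of_real (sqrt (1 - a\<^sup>2)) * \<mu>\<^sup>2]"

definition phi :: "real \<Rightarrow> complex^2^2 \<Rightarrow> real \<Rightarrow> complex \<Rightarrow> complex^2" where
  "phi a U c \<xi> =
     chi_aut (curve a U (complex_of_real c)) (curve a U (mob (complex_of_real c) \<xi>))"

definition \<Omega> :: "(complex \<times> complex \<times> real \<times> (complex^2^2) \<times> real) set" where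
  "\<Omega> = {(x, y, a, U, c). x \<in> unit_disc - {0} \<and> y \<in> unit_disc - {0} \<and>
          a \<in> {0<..<1} \<and> U \<in> U2 \<and> c \<in> {-1<..<1} \<and> x \<noteq> y}"

definition \<Phi> :: "complex \<times> complex \<times> real \<times> (complex^2^2) \<times> real \<Rightarrow>
    (complex^2) \<times> (complex^2) \<times> (complex \<times> complex) set" where
  "\<Phi> = (\<lambda>(x, y, a, U, c).
     let \<gamma> = complex_of_real (2 * c / (1 + c\<^sup>2))
     in (phi a U c x, phi a U c y, proj_pt (x * mob \<gamma> x) (y * mob \<gamma> y)))"

end

theory Submission
  imports Defs "HOL-Complex_Analysis.Conformal_Mappings"
begin

text \<open>
  Put \<open>b = sqrt (1 - a\<^sup>2)\<close>. The function \<open>F(z\<^sub>1, z\<^sub>2) = (z\<^sub>1\<^sup>2 + 2 b z\<^sub>2) / (1 + b\<^sup>2)\<close> maps the ball into the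
  disc and satisfies \<open>F(a \<mu>, b \<mu>\<^sup>2) = \<mu>\<^sup>2\<close>. After composition with automorphisms it solves the problem
  attached to a point of \<open>\<Omega>\<close>, and that problem is extremal because its restriction to the curve is
  interpolated by a Blaschke product of degree two.

  Conversely, let \<open>z\<close>, \<open>w\<close> be linearly independent. Call targets tested if they pass the three two-point
  inequalities and the Pick condition at all \<open>(x, y)\<close> for which some disc through \<open>0\<close>, \<open>z\<close>, \<open>w\<close> has parameters
  \<open>0\<close>, \<open>x\<close>, \<open>y\<close>; let \<open>t\<close> be maximal such that \<open>t \<sigma>\<close>, \<open>t \<tau>\<close> are tested.
  If the two-point inequalities are strict there, compactness yields \<open>(x, y)\<close> at which the Pick determinant of
  the targets vanishes, hence is minimal subject to the Pick determinant of the nodes being nonnegative.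
  The Lagrange condition says that two self-reciprocal quadratic polynomials are proportional at two points of
  the disc, hence proportional, and this forces the disc through the nodes to be one of the curves.
  If some two-point inequality is an equality, a boundary limit (of Julia type) of the Pick conditions
  gives exactly what is needed to write down a solution in the ball, which excludes a non-degenerate extremal
  problem in this direction.
\<close>

unbundle no fps_syntax

text \<open>The test is phrased in Gram numbers, \<open>Z\<close>, \<open>W\<close>,
  \<open>c\<close> for the nodes and \<open>S\<close>, \<open>T\<close>, \<open>s\<close> for the
  targets. Automorphisms of ball and disc act on these by explicit factors, so exchanging nodes and
  moving the base point are substitutions. The main obstacle is that the parameters
  \<open>(x, y)\<close> fill an open set. Parameters at which the test fails for slightly larger
  scales may run to one common boundary point, where both determinants vanish; their ratio there is
  controlled by the strict two-point inequality for \<open>z\<close>, \<open>w\<close>. The two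
  critical quadratics are comparable because a singular Pick matrix is described by two numbers
  \<open>e\<close>, \<open>f\<close>, the same way for nodes and targets. For targets
  \<open>cmod2 e - cmod2 f\<close> is 1, for independent nodes it is larger; the gap becomes
  \<open>\<beta> < 1\<close>, that is, \<open>a > 0\<close>. The maximal scale is never identified
  with 1. If the two-point inequalities are strict there, the critical point by itself exhibits the
  triple as a value of \<open>\<Phi>\<close>. Otherwise the scale exceeds 1, and the solution
  constructed there, divided by the scale, is relatively compact, against extremality.\<close>

abbreviation cmod2 :: "complex \<Rightarrow> real" where
  "cmod2 x \<equiv> (cmod x)^2"

section \<open>Automorphisms and holomorphic functions\<close>

lemma cdot_2: "cdot z w = z$1 * cnj (w$1) + z$2 * cnj (w$2)"
  by (simp add: cdot_def sum_2)

lemma cdot_add_left: "cdot (u + v) w = cdot u w + cdot v w"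
  and cdot_add_right: "cdot u (v + w) = cdot u v + cdot u w"
  and cdot_diff_left: "cdot (u - v) w = cdot u w - cdot v w"
  and cdot_diff_right: "cdot u (v - w) = cdot u v - cdot u w"
  and cdot_scale_left: "cdot (k *s u) w = k * cdot u w"
  and cdot_scale_right: "cdot u (k *s w) = cnj k * cdot u w"
  by (simp_all add: cdot_2 algebra_simps)

lemmas cdot_linear = cdot_add_left cdot_add_right cdot_diff_left cdot_diff_right
  cdot_scale_left cdot_scale_right

lemma cnj_cdot: "cnj (cdot u v) = cdot v u"
  by (simp add: cdot_2 algebra_simps)

lemma cdot_zero [simp]: "cdot 0 v = 0" "cdot v 0 = 0"
  by (simp_all add: cdot_2)

lemma cdot_self: "cdot z z = complex_of_real ((norm z)^2)"
proof -
  have "(norm z)^2 = cmod2 (z$1) + cmod2 (z$2)"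
    by (simp add: norm_vec_def L2_set_def sum_2)
  then show ?thesis
    by (simp add: cdot_2 complex_norm_square[symmetric])
qed

text \<open>Lagrange's identity. The exact defect makes linear independence of \<open>z\<close> and
  \<open>w\<close> a strict inequality between Gram entries, the form in which the complement of
  \<open>\<C>\<close> is used.\<close>

lemma cauchy_schwarz_2:
  "(norm z)^2 * (norm w)^2 - cmod2 (cdot z w) = cmod2 (z$1 * w$2 - z$2 * w$1)"
proof -
  have "complex_of_real ((norm z)^2 * (norm w)^2 - cmod2 (cdot z w)) =
        complex_of_real (cmod2 (z$1 * w$2 - z$2 * w$1))"
    unfolding of_real_diff of_real_mult cdot_self[symmetric] complex_norm_square
    by (simp add: cdot_2 algebra_simps)
  then show ?thesis by (metis of_real_eq_iff)
qed

lemma cmod_cdot_le: "cmod (cdot z w) \<le> norm z * norm w"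
proof -
  have "cmod2 (cdot z w) \<le> (norm z * norm w)^2"
    using cauchy_schwarz_2[of z w] by (smt (verit) power_mult_distrib zero_le_power2)
  then show ?thesis by (rule power2_le_imp_le) simp
qed

lemma cmod_cdot_less_1:
  assumes "norm z < 1" "norm w < 1"
  shows "cmod (cdot z w) < 1"
proof -
  have "norm z * norm w < 1 * 1"
    using assms by (intro mult_strict_mono') auto
  then show ?thesis using cmod_cdot_le[of z w] by simp
qed

section \<open>Moebius maps of the disc\<close>

lemma one_minus_neq_0: "cmod u < 1 \<Longrightarrow> 1 - u \<noteq> 0"
  by auto

lemma one_minus_cnj_neq_0:
  assumes "cmod a < 1" "cmod x \<le> 1"
  shows "1 - cnj a * x \<noteq> 0" "1 - a * cnj x \<noteq> 0" "1 - a * x \<noteq> 0"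
proof -
  have "cmod a * cmod x < 1"
    using assms by (smt (verit) mult_left_le norm_ge_zero)
  then show "1 - cnj a * x \<noteq> 0" "1 - a * cnj x \<noteq> 0" "1 - a * x \<noteq> 0"
    by (metis complex_mod_cnj norm_mult one_minus_neq_0)+
qed

lemma of_real_cmod_sq: "(complex_of_real (cmod z))^2 = z * cnj z"
  using complex_norm_square[of z] by simp

lemma one_minus_mob_cnj_mob:
  assumes "cmod a < 1" "cmod x \<le> 1" "cmod y \<le> 1"
  shows "1 - mob a x * cnj (mob a y) =
    (1 - a * cnj a) * (1 - x * cnj y) / ((1 - cnj a * x) * (1 - a * cnj y))"
proof -
  have "1 - cnj a * x \<noteq> 0" "1 - a * cnj y \<noteq> 0"
    using assms one_minus_cnj_neq_0 by auto
  then show ?thesis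
    unfolding mob_def
    by (simp add: diff_divide_eq_iff eq_divide_eq) (simp add: algebra_simps)
qed

lemma cmod_mob_sq:
  assumes "cmod a < 1" "cmod x \<le> 1"
  shows "1 - cmod2 (mob a x) = (1 - cmod2 a) * (1 - cmod2 x) / cmod2 (1 - a * cnj x)"
proof -
  have "complex_of_real (1 - cmod2 (mob a x)) =
      complex_of_real ((1 - cmod2 a) * (1 - cmod2 x) / cmod2 (1 - a * cnj x))"
    using one_minus_mob_cnj_mob[OF assms assms(2)]
    by (simp add: of_real_cmod_sq mult.commute)
  then show ?thesis by (simp only: of_real_eq_iff)
qed

lemma cmod_mob_less_1:
  assumes "cmod a < 1" "cmod x < 1"
  shows "cmod (mob a x) < 1"
proof -
  have "0 < 1 - cmod2 (mob a x)"
    using assms one_minus_cnj_neq_0(2)[of a x]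
    by (simp add: cmod_mob_sq power_less_one_iff abs_square_less_1)
  then show ?thesis by (simp add: abs_square_less_1)
qed

lemma mob_mob:
  assumes "cmod a < 1" "cmod x \<le> 1"
  shows "mob a (mob a x) = x"
proof -
  have n: "1 - cnj a * x \<noteq> 0" "1 - cnj a * a \<noteq> 0"
    using assms one_minus_cnj_neq_0 by auto
  have "a - mob a x = x * (1 - cnj a * a) / (1 - cnj a * x)"
    using n by (simp add: mob_def field_simps)
  moreover have "1 - cnj a * mob a x = (1 - cnj a * a) / (1 - cnj a * x)"
    using n by (simp add: mob_def field_simps)
  ultimately show ?thesis
    using n unfolding mob_def[of a "mob a x"] by simp
qed

lemma mob_self [simp]: "mob a a = 0" and mob_0_right [simp]: "mob a 0 = a"
  and mob_0_left: "mob 0 x = - x"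
  by (simp_all add: mob_def)

lemma mob_holomorphic: "cmod a < 1 \<Longrightarrow> mob a holomorphic_on ball 0 1"
  unfolding mob_def using one_minus_cnj_neq_0(1)
  by (intro holomorphic_intros) (auto simp: less_imp_le)

text \<open>An automorphism preserves \<open>1 - cdot p q\<close> up to a factor in \<open>p\<close>
  alone and a factor in \<open>q\<close> alone, hence acts on Pick matrices by diagonal
  congruence.\<close>

lemma one_minus_cdot_chi_aut:
  assumes "norm w < 1" "norm p < 1" "norm q < 1"
  shows "1 - cdot (chi_aut w p) (chi_aut w q) =
    (1 - cdot w w) * (1 - cdot p q) / ((1 - cdot p w) * (1 - cdot w q))"
proof -
  have n: "1 - cdot p w \<noteq> 0" "1 - cdot w q \<noteq> 0"
    using assms cmod_cdot_less_1 one_minus_neq_0 by blast+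
  let ?s = "complex_of_real (sqrt (1 - (norm w)^2))"
  let ?N = "\<lambda>p. w - proj_onto w p - ?s *s (p - proj_onto w p)"
  have "(norm w)^2 \<le> 1" using assms(1) by (simp add: abs_square_le_1)
  then have "?s * ?s = complex_of_real (1 - (norm w)^2)"
    by (metis of_real_mult real_sqrt_mult_self abs_of_nonneg diff_ge_0_iff_ge)
  then have ss: "?s * ?s = 1 - cdot w w"
    by (simp add: cdot_self)
  have N: "cdot (?N p) (?N q) =
      cdot w w - cdot w q - cdot p w + (1 - cdot w w) * cdot p q + cdot p w * cdot w q"
  proof (cases "w = 0")
    case True
    then show ?thesis
      by (simp add: proj_onto_def cdot_2)
  next
    case False
    then have ww: "cdot w w \<noteq> 0" by (simp add: cdot_self)
    let ?Pp = "cdot p w / cdot w w" and ?Pq = "cdot w q / cdot w w"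
    have cq: "cnj (cdot q w / cdot w w) = ?Pq" by (simp add: cnj_cdot)
    \<comment> \<open>The terms linear in \<open>?s\<close> carry
      \<open>cdot p w - ?Pp * cdot w w\<close> or its counterpart for \<open>q\<close>, which vanish
      because the two parts of a point are orthogonal.\<close>
    have "cdot (?N p) (?N q) = cdot w w - cdot w w * ?Pq - ?Pp * cdot w w + ?Pp * ?Pq * cdot w w
        + (?s * ?s) * (cdot p q - ?Pp * cdot w q - ?Pq * cdot p w + ?Pp * ?Pq * cdot w w)
        - ?s * (cdot p w - ?Pp * cdot w w) * (1 - ?Pq)
        - ?s * (cdot w q - ?Pq * cdot w w) * (1 - ?Pp)"
      unfolding proj_onto_def cdot_linear cq by (simp add: algebra_simps)
    also have "\<dots> = cdot w w - cdot w q - cdot p w + (1 - cdot w w) * cdot p q + cdot p w * cdot w q"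
      unfolding ss using ww by (simp add: field_simps)
    finally show ?thesis .
  qed
  have "cdot (chi_aut w p) (chi_aut w q) = cdot (?N p) (?N q) / ((1 - cdot p w) * (1 - cdot w q))"
    unfolding chi_aut_def cdot_scale_left cdot_scale_right by (simp add: cnj_cdot)
  then show ?thesis
    unfolding N using n
    by (simp add: diff_divide_eq_iff eq_divide_eq) (simp add: algebra_simps)
qed

lemma norm_chi_aut_sq:
  assumes "norm w < 1" "norm p < 1"
  shows "1 - (norm (chi_aut w p))^2 =
    (1 - (norm w)^2) * (1 - (norm p)^2) / cmod2 (1 - cdot w p)"
proof -
  have "complex_of_real (1 - (norm (chi_aut w p))^2) =
      complex_of_real ((1 - (norm w)^2) * (1 - (norm p)^2) / cmod2 (1 - cdot w p))"
    using one_minus_cdot_chi_aut[OF assms assms(2)]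
    by (simp add: cdot_self of_real_cmod_sq cnj_cdot mult.commute)
  then show ?thesis by (simp only: of_real_eq_iff)
qed

lemma norm_chi_aut_less_1:
  assumes "norm w < 1" "norm p < 1"
  shows "norm (chi_aut w p) < 1"
proof -
  have "1 - cdot w p \<noteq> 0" using assms cmod_cdot_less_1 one_minus_neq_0 by blast
  then have "0 < 1 - (norm (chi_aut w p))^2"
    using assms by (simp add: norm_chi_aut_sq abs_square_less_1)
  then show ?thesis by (simp add: abs_square_less_1)
qed

text \<open>Split \<open>p\<close> into its part along \<open>w\<close> and an orthogonal part
  \<open>d\<close>. The first is moved by a Moebius involution, the second is multiplied by
  \<open>- ?s / (1 - cdot p w)\<close>; since \<open>?s * ?s = 1 - cdot w w\<close>, two
  applications multiply \<open>d\<close> by 1.\<close>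

lemma chi_aut_chi_aut:
  assumes "norm w < 1" "norm p < 1"
  shows "chi_aut w (chi_aut w p) = p"
proof (cases "w = 0")
  case True
  then show ?thesis by (simp add: chi_aut_def proj_onto_def)
next
  case False
  then have ww: "cdot w w \<noteq> 0" by (simp add: cdot_self)
  have n: "1 - cdot p w \<noteq> 0"
    using assms cmod_cdot_less_1 one_minus_neq_0 by blast
  let ?s = "complex_of_real (sqrt (1 - (norm w)^2))"
  have w1: "(norm w)^2 < 1" using assms(1) by (simp add: abs_square_less_1)
  then have "?s * ?s = complex_of_real (1 - (norm w)^2)"
    by (metis of_real_mult real_sqrt_mult_self abs_of_nonneg diff_ge_0_iff_ge less_imp_le)
  then have ss: "?s * ?s = 1 - cdot w w"
    by (simp add: cdot_self)
  have s0: "1 - cdot w w \<noteq> 0"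
    using assms(1) cmod_cdot_less_1 one_minus_neq_0 by blast
  define v where "v = chi_aut w p"
  define d where "d = p - proj_onto w p"
  have dw: "cdot d w = 0"
    using ww by (simp add: d_def proj_onto_def cdot_linear)
  have v: "v = (1 / (1 - cdot p w)) *s ((1 - cdot p w / cdot w w) *s w - ?s *s d)"
    unfolding v_def chi_aut_def d_def
    by (simp add: proj_onto_def vec_eq_iff algebra_simps)
  have vw: "cdot v w = (cdot w w - cdot p w) / (1 - cdot p w)"
    unfolding v cdot_linear dw using ww by (simp add: left_diff_distrib)
  have pd: "p = (cdot p w / cdot w w) *s w + d"
    by (simp add: d_def proj_onto_def)
  have vv: "1 - cdot v w = (1 - cdot w w) / (1 - cdot p w)"
    unfolding vw using n by (simp add: field_simps)
  have v2: "v - proj_onto w v = (- ?s / (1 - cdot p w)) *s d"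
    unfolding proj_onto_def vw unfolding v using ww n by (simp add: vec_eq_iff field_simps)
  have "chi_aut w v = ((1 - cdot p w) / (1 - cdot w w)) *s
      ((1 - cdot v w / cdot w w) *s w + ((?s * ?s) / (1 - cdot p w)) *s d)"
    unfolding chi_aut_def v2 vv
    by (simp add: proj_onto_def vec_eq_iff algebra_simps)
  also have "\<dots> = (cdot p w / cdot w w) *s w + d"
  proof -
    have 1: "((1 - cdot p w) / (1 - cdot w w)) * ((?s * ?s) / (1 - cdot p w)) = 1"
      unfolding ss using n s0 by simp
    have 2: "((1 - cdot p w) / (1 - cdot w w)) * (1 - cdot v w / cdot w w) = cdot p w / cdot w w"
      unfolding vw using n s0 ww by (simp add: divide_simps) (simp add: algebra_simps)
    show ?thesis
      unfolding vector_add_ldistrib vector_smult_assoc 1 2 by simp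
  qed
  finally show ?thesis using pd v_def by metis
qed

lemma chi_aut_self [simp]: "chi_aut w w = 0"
  by (cases "w = 0") (simp_all add: chi_aut_def proj_onto_def cdot_self)

lemma chi_aut_0 [simp]: "chi_aut w 0 = w"
  by (simp add: chi_aut_def proj_onto_def)

section \<open>Closure properties of holomorphy in two variables\<close>

lemma holomorphic2_const [intro]: "holomorphic2_on (\<lambda>p. k) S"
  unfolding holomorphic2_on_def
  by (intro ballI exI[of _ "\<lambda>_. 0"]) auto

lemma holomorphic2_nth [intro]: "holomorphic2_on (\<lambda>p. p $ i) S"
  unfolding holomorphic2_on_def
  by (intro ballI exI[of _ "\<lambda>p. p $ i"]) (auto intro!: bounded_linear_imp_has_derivative bounded_linear_vec_nth)

lemma holomorphic2_add [intro]:
  assumes "holomorphic2_on F S" "holomorphic2_on G S"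
  shows "holomorphic2_on (\<lambda>p. F p + G p) S"
  unfolding holomorphic2_on_def
proof
  fix p assume "p \<in> S"
  then obtain F' G' where "(F has_derivative F') (at p within S)" "\<And>c v. F' (c *s v) = c * F' v"
    "(G has_derivative G') (at p within S)" "\<And>c v. G' (c *s v) = c * G' v"
    using assms unfolding holomorphic2_on_def by metis
  then show "\<exists>H'. ((\<lambda>p. F p + G p) has_derivative H') (at p within S) \<and> (\<forall>c v. H' (c *s v) = c * H' v)"
    by (intro exI[of _ "\<lambda>v. F' v + G' v"]) (auto intro!: has_derivative_add simp: algebra_simps)
qed

lemma holomorphic2_mult [intro]:
  assumes "holomorphic2_on F S" "holomorphic2_on G S"
  shows "holomorphic2_on (\<lambda>p. F p * G p) S"
  unfolding holomorphic2_on_def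
proof
  fix p assume "p \<in> S"
  then obtain F' G' where "(F has_derivative F') (at p within S)" "\<And>c v. F' (c *s v) = c * F' v"
    "(G has_derivative G') (at p within S)" "\<And>c v. G' (c *s v) = c * G' v"
    using assms unfolding holomorphic2_on_def by metis
  then show "\<exists>H'. ((\<lambda>p. F p * G p) has_derivative H') (at p within S) \<and> (\<forall>c v. H' (c *s v) = c * H' v)"
    by (intro exI[of _ "\<lambda>v. F p * G' v + F' v * G p"]) (auto intro!: has_derivative_mult simp: algebra_simps)
qed

lemma holomorphic2_diff [intro]:
  assumes "holomorphic2_on F S" "holomorphic2_on G S"
  shows "holomorphic2_on (\<lambda>p. F p - G p) S"
  using holomorphic2_add[OF assms(1) holomorphic2_mult[OF holomorphic2_const[of "-1"] assms(2)]] by simp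

lemma holomorphic2_inverse [intro]:
  assumes "holomorphic2_on F S" "\<And>p. p \<in> S \<Longrightarrow> F p \<noteq> 0"
  shows "holomorphic2_on (\<lambda>p. inverse (F p)) S"
  unfolding holomorphic2_on_def
proof
  fix p assume p: "p \<in> S"
  then obtain F' where "(F has_derivative F') (at p within S)" "\<And>c v. F' (c *s v) = c * F' v"
    using assms unfolding holomorphic2_on_def by metis
  then show "\<exists>H'. ((\<lambda>p. inverse (F p)) has_derivative H') (at p within S) \<and> (\<forall>c v. H' (c *s v) = c * H' v)"
    using assms(2)[OF p]
    by (intro exI[of _ "\<lambda>v. - (inverse (F p) * F' v * inverse (F p))"] conjI has_derivative_inverse)
       auto
qed

lemma holomorphic2_divide [intro]:
  assumes "holomorphic2_on F S" "holomorphic2_on G S" "\<And>p. p \<in> S \<Longrightarrow> G p \<noteq> 0"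
  shows "holomorphic2_on (\<lambda>p. F p / G p) S"
  unfolding divide_inverse using assms by (intro holomorphic2_mult holomorphic2_inverse)

lemma holomorphic2_cdot [intro]: "holomorphic2_on (\<lambda>p. cdot p v) S"
  unfolding cdot_2 by (intro holomorphic2_add holomorphic2_mult holomorphic2_nth holomorphic2_const)

lemma holomorphic2_mob [intro]:
  assumes "holomorphic2_on F S" "F ` S \<subseteq> ball 0 1" "cmod a < 1"
  shows "holomorphic2_on (\<lambda>p. mob a (F p)) S"
  unfolding mob_def using assms one_minus_cnj_neq_0(1)[of a]
  by (intro holomorphic2_divide holomorphic2_diff holomorphic2_mult holomorphic2_const)
     (auto simp: image_subset_iff less_imp_le)

lemma has_derivative_vec:
  fixes g :: "'a::real_normed_vector \<Rightarrow> 'b::euclidean_space ^ 'n"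
  assumes "\<And>i. ((\<lambda>p. g p $ i) has_derivative g' i) (at p within S)"
  shows "(g has_derivative (\<lambda>v. \<chi> i. g' i v)) (at p within S)"
  unfolding has_derivative_componentwise_within[of g]
proof
  fix b :: "'b ^ 'n" assume "b \<in> Basis"
  then obtain i u where "b = axis i u" by (auto simp: Basis_vec_def)
  then show "((\<lambda>x. g x \<bullet> b) has_derivative (\<lambda>x. (\<chi> i. g' i x) \<bullet> b)) (at p within S)"
    using assms[of i] by (simp add: inner_axis has_derivative_inner_left)
qed

lemma holomorphic2_compose:
  assumes F: "holomorphic2_on F ball2" and g: "\<And>i. holomorphic2_on (\<lambda>p. g p $ i) S" and "g ` S \<subseteq> ball2"
  shows "holomorphic2_on (\<lambda>p. F (g p)) S"
  unfolding holomorphic2_on_def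
proof
  fix p assume p: "p \<in> S"
  then obtain g' where g': "\<And>i. ((\<lambda>p. g p $ i) has_derivative g' i) (at p within S)"
      "\<And>i c v. g' i (c *s v) = c * g' i v"
  proof -
    have "\<forall>i. \<exists>F'. ((\<lambda>p. g p $ i) has_derivative F') (at p within S) \<and> (\<forall>c v. F' (c *s v) = c * F' v)"
      using g p unfolding holomorphic2_on_def by blast
    from choice[OF this] show ?thesis using that by blast
  qed
  have 1: "(g has_derivative (\<lambda>v. \<chi> i. g' i v)) (at p within S)"
    using g'(1) by (rule has_derivative_vec)
  have "g p \<in> ball2" using p assms(3) by blast
  then obtain F' where F': "(F has_derivative F') (at (g p) within ball2)" "\<And>c v. F' (c *s v) = c * F' v"
    using F unfolding holomorphic2_on_def by metis
  have "((\<lambda>p. F (g p)) has_derivative (\<lambda>v. F' (\<chi> i. g' i v))) (at p within S)"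
    by (rule has_derivative_in_compose[OF 1 has_derivative_subset[OF F'(1) assms(3)]])
  moreover have "F' (\<chi> i. g' i (c *s v)) = c * F' (\<chi> i. g' i v)" for c v
  proof -
    have "(\<chi> i. g' i (c *s v)) = c *s (\<chi> i. g' i v)" by (simp add: vec_eq_iff g'(2))
    then show ?thesis by (simp add: F'(2))
  qed
  ultimately show "\<exists>H'. ((\<lambda>p. F (g p)) has_derivative H') (at p within S) \<and> (\<forall>c v. H' (c *s v) = c * H' v)"
    by blast
qed

text \<open>Complex linearity of the derivative of \<open>F\<close> turns the derivative along the
  disc into multiplication by a number. This is what lets the one-variable Schwarz lemma act on
  functions of the ball.\<close>

lemma holomorphic_on_disc:
  assumes F: "holomorphic2_on F ball2" and g: "\<And>i. (\<lambda>t. g t $ i) holomorphic_on ball 0 1"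
    and gb: "g ` ball 0 1 \<subseteq> ball2"
  shows "(\<lambda>t. F (g t)) holomorphic_on ball 0 1"
  unfolding holomorphic_on_open[OF open_ball]
proof
  fix t :: complex assume t: "t \<in> ball 0 1"
  have "\<forall>i. \<exists>d. ((\<lambda>t. g t $ i) has_field_derivative d) (at t)"
    using g t unfolding holomorphic_on_open[OF open_ball] by blast
  then obtain d where d: "\<And>i. ((\<lambda>t. g t $ i) has_field_derivative d i) (at t)" by metis
  have 1: "(g has_derivative (\<lambda>v. \<chi> i. d i * v)) (at t)"
    using d by (intro has_derivative_vec) (simp add: has_field_derivative_def)
  have gt: "g t \<in> ball2" using t gb by blast
  then obtain F' where F': "(F has_derivative F') (at (g t) within ball2)" "\<And>c v. F' (c *s v) = c * F' v"
    using F unfolding holomorphic2_on_def by metis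
  have "(F has_derivative F') (at (g t))"
    using F'(1) at_within_open[OF gt open_ball] by simp
  then have "((\<lambda>t. F (g t)) has_derivative (\<lambda>v. F' (\<chi> i. d i * v))) (at t)"
    by (rule has_derivative_compose[OF 1])
  moreover have "(\<lambda>v. F' (\<chi> i. d i * v)) = (*) (F' (\<chi> i. d i))"
  proof
    fix v
    have "(\<chi> i. d i * v) = v *s (\<chi> i. d i)" by (simp add: vec_eq_iff)
    then show "F' (\<chi> i. d i * v) = F' (\<chi> i. d i) * v" by (simp add: F'(2))
  qed
  ultimately show "\<exists>f'. ((\<lambda>t. F (g t)) has_field_derivative f') (at t)"
    unfolding has_field_derivative_def by metis
qed

lemma chi_aut_nth:
  "chi_aut w p $ i = (w $ i - cdot p w / cdot w w * w $ i -
     complex_of_real (sqrt (1 - (norm w)^2)) * (p $ i - cdot p w / cdot w w * w $ i)) / (1 - cdot p w)"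
  by (simp add: chi_aut_def proj_onto_def diff_divide_distrib right_diff_distrib mult_ac)

lemma holomorphic2_chi_aut:
  assumes "norm w < 1"
  shows "holomorphic2_on (\<lambda>p. chi_aut w p $ i) ball2"
proof -
  have "1 - cdot p w \<noteq> 0" if "p \<in> ball2" for p
    using that assms cmod_cdot_less_1 one_minus_neq_0 by auto
  then show ?thesis
    unfolding chi_aut_nth divide_inverse[of _ "cdot w w"]
    by (intro holomorphic2_divide holomorphic2_diff holomorphic2_mult holomorphic2_nth
        holomorphic2_const holomorphic2_cdot) auto
qed

text \<open>Change of base point on both sides, at \<open>w\<close> in the ball and at
  \<open>a\<close> in the disc; solutions are transported this way.\<close>

lemma holomorphic2_mob_chi_aut:
  assumes F: "holomorphic2_on F ball2" "F ` ball2 \<subseteq> unit_disc" and w: "norm w < 1" and a: "cmod a < 1"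
  shows "holomorphic2_on (\<lambda>p. mob a (F (chi_aut w p))) ball2" "(\<lambda>p. mob a (F (chi_aut w p))) ` ball2 \<subseteq> unit_disc"
proof -
  have ci: "chi_aut w ` ball2 \<subseteq> ball2" using norm_chi_aut_less_1[OF w] by auto
  then have i: "(\<lambda>p. F (chi_aut w p)) ` ball2 \<subseteq> unit_disc" using F(2) by blast
  show "holomorphic2_on (\<lambda>p. mob a (F (chi_aut w p))) ball2"
    by (rule holomorphic2_mob[OF holomorphic2_compose[OF F(1) holomorphic2_chi_aut[OF w] ci] i a])
  show "(\<lambda>p. mob a (F (chi_aut w p))) ` ball2 \<subseteq> unit_disc"
    using i cmod_mob_less_1[OF a] by (auto simp: image_subset_iff)
qed

section \<open>Three-point Pick determinants\<close>

text \<open>For nodes \<open>0\<close>, \<open>x\<close>, \<open>y\<close> in the disc and values \<open>0\<close>, \<open>z\<close>, \<open>w\<close> with \<open>Z = \<bar>z\<bar>\<^sup>2\<close>, \<open>W = \<bar>w\<bar>\<^sup>2\<close>, \<open>c = \<langle>z, w\<rangle>\<close>, this is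
  the determinant of the \<open>3 \<times> 3\<close> Pick matrix with denominators cleared.\<close>

definition pick_det :: "real \<Rightarrow> real \<Rightarrow> complex \<Rightarrow> complex \<Rightarrow> complex \<Rightarrow> real" where
  "pick_det Z W c x y =
     (cmod2 x - Z) * (cmod2 y - W) * cmod2 (1 - x * cnj y)
     - cmod2 (x * cnj y - c) * (1 - cmod2 x) * (1 - cmod2 y)"

lemma pick_det_swap: "pick_det W Z (cnj c) y x = pick_det Z W c x y"
proof -
  have "cmod (1 - y * cnj x) = cmod (1 - x * cnj y)" "cmod (y * cnj x - cnj c) = cmod (x * cnj y - c)"
    using complex_mod_cnj[of "1 - x * cnj y"] complex_mod_cnj[of "x * cnj y - c"]
    by (simp_all add: mult.commute del: complex_mod_cnj)
  then show ?thesis by (simp add: pick_det_def mult_ac)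
qed

lemma mult_cnj_less_1:
  assumes "cmod x < 1" "cmod y < 1"
  shows "cmod (x * cnj y) < 1"
  using mult_strict_mono'[OF assms] by (simp add: norm_mult)

lemma cmod_one_minus_sq:
  "cmod2 (1 - x * cnj y) = (1 - cmod2 x) * (1 - cmod2 y) + cmod2 (x - y)"
  unfolding cmod_power2 by (simp add: power2_eq_square algebra_simps)

text \<open>With \<open>r = sqrt (Z * W)\<close>, \<open>cmod c < r\<close> gives
  \<open>1 - r < cmod (1 - c)\<close>, and \<open>2 * r <= Z + W\<close> gives
  \<open>(1 - Z) * (1 - W) <= (1 - r)^2\<close>. For Gram data this says that the two nodes have
  positive pseudohyperbolic distance.\<close>

lemma gram_gap:
  assumes "0 < Z" "Z < 1" "0 < W" "W < 1" "cmod2 c < Z * W"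
  shows "(1 - Z) * (1 - W) < cmod2 (1 - c)"
proof -
  define r where "r = sqrt (Z * W)"
  have r: "r^2 = Z * W" "0 \<le> r" using assms by (auto simp: r_def)
  have "r^2 < 1" using r(1) assms mult_strict_mono'[of Z 1 W 1] by simp
  then have r1: "r < 1" using r(2) by (simp add: abs_square_less_1)
  have "cmod c < r" using assms(5) r by (metis power2_less_imp_less)
  then have "1 - r < cmod (1 - c)" using norm_triangle_ineq2[of 1 c] by simp
  then have 1: "(1 - r)^2 < cmod2 (1 - c)" using r1 by (intro power_strict_mono) auto
  have "0 \<le> (Z - W)^2" by simp
  then have "4 * r^2 \<le> (Z + W)^2" unfolding r(1) by (simp add: power2_eq_square algebra_simps)
  then have "2 * r \<le> Z + W" using assms by (auto intro: power2_le_imp_le simp: power_mult_distrib)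
  then have "(1 - Z) * (1 - W) \<le> (1 - r)^2"
    using r(1) by (simp add: power2_eq_square algebra_simps)
  with 1 show ?thesis by linarith
qed

text \<open>Linear independence pushes admissible parameters into the interior of every two-point
  constraint. Geometrically, equality at \<open>x\<close>, \<open>y\<close> would make the
  interpolating disc a geodesic, hence part of a complex line through 0, and the nodes would be
  collinear.\<close>

lemma pick_det_nonneg_strict:
  assumes ZW: "0 < Z" "Z < 1" "0 < W" "W < 1" "cmod2 c < Z * W"
    and xy: "cmod x < 1" "cmod y < 1" "Z \<le> cmod2 x" "W \<le> cmod2 y"
    and A: "0 \<le> pick_det Z W c x y"
  shows "Z < cmod2 x" "W < cmod2 y" "x \<noteq> y"
    "(1 - cmod2 x) * (1 - cmod2 y) * cmod2 (1 - c)
      < (1 - Z) * (1 - W) * cmod2 (1 - x * cnj y)"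
proof -
  define X Y \<xi> where "X = cmod2 x" and "Y = cmod2 y" and "\<xi> = x * cnj y"
  have X1: "X < 1" "Y < 1" using xy by (auto simp: X_def Y_def abs_square_less_1)
  have ZX: "Z \<le> X" "W \<le> Y" using xy by (auto simp: X_def Y_def)
  have \<xi>2: "cmod2 \<xi> = X * Y" by (simp add: \<xi>_def X_def Y_def norm_mult power_mult_distrib)
  have \<xi>1: "cmod \<xi> < 1" using mult_cnj_less_1[OF xy(1,2)] by (simp add: \<xi>_def)
  then have n\<xi>: "1 - \<xi> \<noteq> 0" by auto
  have \<xi>c: "\<xi> \<noteq> c"
  proof
    assume "\<xi> = c"
    then have "X * Y < Z * W" using \<xi>2 ZW by simp
    moreover have "Z * W \<le> X * Y" using ZX ZW by (intro mult_mono) auto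
    ultimately show False by simp
  qed
  have A': "cmod2 (\<xi> - c) * (1 - X) * (1 - Y) \<le> (X - Z) * (Y - W) * cmod2 (1 - \<xi>)"
    using A by (simp add: pick_det_def X_def Y_def \<xi>_def)
  have pos: "0 < cmod2 (\<xi> - c) * (1 - X) * (1 - Y)"
    using \<xi>c X1 by simp
  have "X \<noteq> Z" "Y \<noteq> W" using A' pos by auto
  then have s: "Z < X" "W < Y" using ZX by auto
  then show "Z < cmod2 x" "W < cmod2 y" by (auto simp: X_def Y_def)
  \<comment> \<open>The entries of the Schur complement of the first row of ones in the Pick matrix,
    so nonnegativity of the determinant reads \<open>cmod2 u <= m * n\<close>.\<close>
  define m n u where "m = (X - Z) / (1 - X)" and "n = (Y - W) / (1 - Y)" and "u = (\<xi> - c) / (1 - \<xi>)"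
  have mn: "0 < m" "0 < n" using s X1 by (auto simp: m_def n_def)
  have Zm: "1 - Z = (1 + m) * (1 - X)" "1 - W = (1 + n) * (1 - Y)"
    using X1 by (simp_all add: m_def n_def divide_simps)
  have cu: "1 - c = (1 + u) * (1 - \<xi>)" using n\<xi> by (simp add: u_def divide_simps)
  have umn: "cmod2 u \<le> m * n"
    using A' X1 n\<xi> by (simp add: u_def m_def n_def norm_divide power_divide divide_simps mult_ac)
  have key: "cmod2 (1 + u) < (1 + m) * (1 + n)"
  proof (rule ccontr)
    \<comment> \<open>The negation makes \<open>m + n - 2 * Re u\<close> plus
      \<open>m * n - cmod2 u\<close> at most 0. Both summands are nonnegative, so both vanish and
      \<open>u = m = n\<close>. Then one common factor \<open>k\<close> relates all Gram data to the
      parameters, and the Gram determinant is nonpositive.\<close>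
    assume "\<not> ?thesis"
    then have 1: "m + n - 2 * Re u + (m * n - cmod2 u) \<le> 0"
      unfolding cmod_power2 by (simp add: power2_eq_square algebra_simps)
    have 2: "2 * Re u \<le> m + n"
    proof -
      have "0 \<le> (m - n)^2" by simp
      then have "(2 * cmod u)^2 \<le> (m + n)^2"
        using umn by (simp add: power2_eq_square algebra_simps)
      then have "2 * cmod u \<le> m + n" using mn by (auto intro: power2_le_imp_le)
      then show ?thesis using complex_Re_le_cmod[of u] by linarith
    qed
    have e: "m + n = 2 * Re u" "cmod2 u = m * n" using 1 2 umn by linarith+
    have "(m - n)^2 + 4 * (Im u)^2 = (m + n)^2 - 4 * cmod2 u + 4 * (Im u)^2"
      unfolding e(2) by (simp add: power2_eq_square algebra_simps)
    also have "\<dots> = 0" unfolding e(1) cmod_power2 by (simp add: power2_eq_square)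
    finally have "m = n" "Im u = 0" by (simp_all add: sum_power2_eq_zero_iff add_nonneg_eq_0_iff)
    then have um: "u = complex_of_real m" using e(1) by (simp add: complex_eq_iff)
    define k where "k = 1 + m"
    have c: "c = 1 - complex_of_real k * (1 - \<xi>)" using cu um by (simp add: k_def algebra_simps)
    have Z: "Z = 1 - k * (1 - X)" "W = 1 - k * (1 - Y)"
      using Zm \<open>m = n\<close> by (auto simp: k_def algebra_simps)
    have "cmod2 c = (1 - k)^2 + 2 * (1 - k) * k * Re \<xi> + k^2 * (X * Y)"
      unfolding c \<xi>2[symmetric] cmod_power2 by (simp add: power2_eq_square algebra_simps)
    then have "Z * W - cmod2 c = - (k * (k - 1) * (X + Y - 2 * Re \<xi>))"
      unfolding Z by (simp add: power2_eq_square algebra_simps)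
    moreover have "X + Y - 2 * Re \<xi> = cmod2 (x - y)"
      unfolding X_def Y_def \<xi>_def cmod_power2 by (simp add: power2_eq_square algebra_simps)
    ultimately have "Z * W - cmod2 c \<le> 0" using mn by (simp add: k_def)
    then show False using ZW by simp
  qed
  have "(1 - X) * (1 - Y) * cmod2 (1 - c) = ((1 - X) * (1 - Y) * cmod2 (1 - \<xi>)) * cmod2 (1 + u)"
    unfolding cu by (simp add: norm_mult power_mult_distrib)
  also have "\<dots> < ((1 - X) * (1 - Y) * cmod2 (1 - \<xi>)) * ((1 + m) * (1 + n))"
    using key X1 n\<xi> by (intro mult_strict_left_mono) auto
  also have "\<dots> = (1 - Z) * (1 - W) * cmod2 (1 - \<xi>)" unfolding Zm by simp
  finally have *: "(1 - X) * (1 - Y) * cmod2 (1 - c) < (1 - Z) * (1 - W) * cmod2 (1 - \<xi>)" .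
  then show "(1 - cmod2 x) * (1 - cmod2 y) * cmod2 (1 - c)
      < (1 - Z) * (1 - W) * cmod2 (1 - x * cnj y)" by (simp add: X_def Y_def \<xi>_def)
  show "x \<noteq> y"
  proof
    assume "x = y"
    then have "cmod2 (1 - \<xi>) = (1 - X) * (1 - Y)"
      unfolding \<xi>_def cmod_one_minus_sq X_def Y_def by simp
    then have "((1 - X) * (1 - Y)) * cmod2 (1 - c) < ((1 - X) * (1 - Y)) * ((1 - Z) * (1 - W))"
      using * by (simp add: mult_ac)
    then have "cmod2 (1 - c) < (1 - Z) * (1 - W)"
      using X1 by (subst (asm) mult_less_cancel_left_pos) auto
    then show False using gram_gap[OF ZW] by simp
  qed
qed

text \<open>The target data vary with \<open>n\<close> because they belong to scales converging to a
  limit scale. The closed bidisc supplies a limit point; a boundary limit would need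
  \<open>x' * cnj y' = 1\<close>, where the third inequality of \<open>nd\<close> gives a
  contradiction.\<close>

lemma pick_det_limit:
  fixes x y s :: "nat \<Rightarrow> complex" and S T :: "nat \<Rightarrow> real"
  assumes ZW: "0 < Z" "Z < 1" "0 < W" "W < 1" "cmod2 c < Z * W"
    and lim: "S \<longlonglongrightarrow> S'" "T \<longlonglongrightarrow> T'" "s \<longlonglongrightarrow> s'"
    and nd: "S' < Z" "T' < W" "(1 - Z) * (1 - W) * cmod2 (1 - s') < (1 - S') * (1 - T') * cmod2 (1 - c)"
    and D: "\<And>n. cmod (x n) < 1" "\<And>n. cmod (y n) < 1" "\<And>n. Z < cmod2 (x n)" "\<And>n. W < cmod2 (y n)"
    and A: "\<And>n. 0 \<le> pick_det Z W c (x n) (y n)" "\<And>n. pick_det (S n) (T n) (s n) (x n) (y n) \<le> 0"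
  obtains x' y' where "cmod x' < 1" "cmod y' < 1" "Z < cmod2 x'" "W < cmod2 y'"
    "0 \<le> pick_det Z W c x' y'" "pick_det S' T' s' x' y' \<le> 0"
proof -
  have "compact (cball (0::complex) 1 \<times> cball (0::complex) 1)" by (intro compact_Times compact_cball)
  moreover have "(x n, y n) \<in> cball 0 1 \<times> cball 0 1" for n using D(1,2)[of n] by (auto simp: less_imp_le)
  ultimately obtain l r where lr: "l \<in> cball (0::complex) 1 \<times> cball (0::complex) 1" "strict_mono (r :: nat \<Rightarrow> nat)"
    "((\<lambda>n. (x n, y n)) \<circ> r) \<longlonglongrightarrow> l"
    unfolding compact_def by (elim allE[of _ "\<lambda>n. (x n, y n)"]) auto
  obtain x' y' where l: "l = (x', y')" by fastforce
  have xl: "(\<lambda>n. x (r n)) \<longlonglongrightarrow> x'" and yl: "(\<lambda>n. y (r n)) \<longlonglongrightarrow> y'"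
    using tendsto_fst[OF lr(3)] tendsto_snd[OF lr(3)] by (simp_all add: l o_def)
  have Sl: "(\<lambda>n. S (r n)) \<longlonglongrightarrow> S'" and Tl: "(\<lambda>n. T (r n)) \<longlonglongrightarrow> T'" and sl: "(\<lambda>n. s (r n)) \<longlonglongrightarrow> s'"
    using lim lr(2) by (auto intro: LIMSEQ_subseq_LIMSEQ[unfolded o_def])
  have le: "cmod x' \<le> 1" "cmod y' \<le> 1" using lr(1) l by auto
  have ZX: "Z \<le> cmod2 x'" "W \<le> cmod2 y'"
    using LIMSEQ_le_const[OF tendsto_power[OF tendsto_norm[OF xl]]]
      LIMSEQ_le_const[OF tendsto_power[OF tendsto_norm[OF yl]]] D(3,4) less_imp_le by blast+
  have A1: "0 \<le> pick_det Z W c x' y'"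
  proof (rule LIMSEQ_le_const)
    show "(\<lambda>n. pick_det Z W c (x (r n)) (y (r n))) \<longlonglongrightarrow> pick_det Z W c x' y'"
      unfolding pick_det_def by (intro tendsto_intros xl yl)
  qed (use A in auto)
  have A2: "pick_det S' T' s' x' y' \<le> 0"
  proof (rule LIMSEQ_le_const2)
    show "(\<lambda>n. pick_det (S (r n)) (T (r n)) (s (r n)) (x (r n)) (y (r n))) \<longlonglongrightarrow> pick_det S' T' s' x' y'"
      unfolding pick_det_def by (intro tendsto_intros xl yl Sl Tl sl)
  qed (use A in auto)
  define X Y \<xi> where "X = cmod2 x'" and "Y = cmod2 y'" and "\<xi> = x' * cnj y'"
  have XS: "S' < X" "T' < Y" using ZX nd by (auto simp: X_def Y_def)
  have "cmod x' < 1 \<and> cmod y' < 1"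
  proof (rule ccontr)
    assume "\<not> ?thesis"
    then have "cmod x' = 1 \<or> cmod y' = 1" using le by auto
    then have "X = 1 \<or> Y = 1" by (auto simp: X_def Y_def)
    then have "(X - S') * (Y - T') * cmod2 (1 - \<xi>) \<le> 0"
      using A2 by (auto simp: pick_det_def X_def Y_def \<xi>_def)
    then have "\<xi> = 1"
      using XS by (auto simp: mult_le_0_iff)
    then have "cmod x' * cmod y' = 1" unfolding \<xi>_def by (metis complex_mod_cnj norm_mult norm_one)
    then have "cmod x' = 1" "cmod y' = 1" using le
      using mult_left_le[of "cmod y'" "cmod x'"] mult_left_le[of "cmod x'" "cmod y'"]
      by (auto simp: mult.commute)
    then have XY: "X = 1" "Y = 1" by (auto simp: X_def Y_def)
    \<comment> \<open>At a common boundary point both determinants vanish to the same order; only their ratio survives.\<close>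
    have *: "(cmod2 (x n) - S n) * (cmod2 (y n) - T n) * cmod2 (x n * cnj (y n) - c) \<le>
        (cmod2 (x n) - Z) * (cmod2 (y n) - W) * cmod2 (x n * cnj (y n) - s n)" for n
    proof -
      define u v where "u = cmod2 (1 - x n * cnj (y n))" and "v = (1 - cmod2 (x n)) * (1 - cmod2 (y n))"
      define a b a' b' where "a = (cmod2 (x n) - Z) * (cmod2 (y n) - W)" and "b = cmod2 (x n * cnj (y n) - c)"
        and "a' = (cmod2 (x n) - S n) * (cmod2 (y n) - T n)" and "b' = cmod2 (x n * cnj (y n) - s n)"
      have uv: "0 < u" "0 < v"
        using D(1,2)[of n] mult_cnj_less_1[of "x n" "y n"]
        by (auto simp: u_def v_def abs_square_less_1 intro!: mult_pos_pos)
      have 1: "b * v \<le> a * u" using A(1)[of n] by (simp add: pick_det_def u_def v_def a_def b_def mult_ac)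
      have 2: "a' * u \<le> b' * v" using A(2)[of n] by (simp add: pick_det_def u_def v_def a'_def b'_def mult_ac)
      have "(a' * b) * (u * v) = (a' * u) * (b * v)" by simp
      also have "\<dots> \<le> (b' * v) * (b * v)" using 2 uv by (intro mult_right_mono) (auto simp: b_def)
      also have "\<dots> \<le> (b' * v) * (a * u)" using 1 uv by (intro mult_left_mono) (auto simp: b'_def)
      also have "\<dots> = (a * b') * (u * v)" by simp
      finally have "a' * b \<le> a * b'" using uv by simp
      then show ?thesis by (simp add: a_def b_def a'_def b'_def)
    qed
    have "(X - S') * (Y - T') * cmod2 (\<xi> - c) \<le> (X - Z) * (Y - W) * cmod2 (\<xi> - s')"
    proof (rule LIMSEQ_le)
      show "(\<lambda>n. (cmod2 (x (r n)) - S (r n)) * (cmod2 (y (r n)) - T (r n)) * cmod2 (x (r n) * cnj (y (r n)) - c))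
         \<longlonglongrightarrow> (X - S') * (Y - T') * cmod2 (\<xi> - c)"
        unfolding X_def Y_def \<xi>_def by (intro tendsto_intros xl yl Sl Tl sl)
      show "(\<lambda>n. (cmod2 (x (r n)) - Z) * (cmod2 (y (r n)) - W) * cmod2 (x (r n) * cnj (y (r n)) - s (r n)))
         \<longlonglongrightarrow> (X - Z) * (Y - W) * cmod2 (\<xi> - s')"
        unfolding X_def Y_def \<xi>_def by (intro tendsto_intros xl yl Sl Tl sl)
    qed (use * in auto)
    then show False using nd(3) \<open>\<xi> = 1\<close> XY by simp
  qed
  then show thesis
    using that A1 A2 pick_det_nonneg_strict(1,2)[OF ZW _ _ ZX A1] by blast
qed

text \<open>The Wirtinger derivative \<open>\<partial>/\<partial>x\<close> of \<open>pick_det\<close>; by symmetry it also yields \<open>\<partial>/\<partial>y\<close>.\<close>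

definition pick_grad :: "real \<Rightarrow> real \<Rightarrow> complex \<Rightarrow> complex \<Rightarrow> complex \<Rightarrow> complex" where
  "pick_grad Z W c x y =
     cnj x * of_real ((cmod2 y - W) * cmod2 (1 - x * cnj y))
     - of_real ((cmod2 x - Z) * (cmod2 y - W)) * cnj y * (1 - cnj x * y)
     - cnj y * (cnj x * y - cnj c) * of_real ((1 - cmod2 x) * (1 - cmod2 y))
     + of_real (cmod2 (x * cnj y - c) * (1 - cmod2 y)) * cnj x"

lemma pick_det_line_derivative:
  "((\<lambda>t. pick_det Z W c (x + of_real t * u) (y + of_real t * v)) has_real_derivative
      2 * Re (pick_grad Z W c x y * u + pick_grad W Z (cnj c) y x * v)) (at 0)"
proof -
  let ?x = "\<lambda>t. x + complex_of_real t * u" and ?y = "\<lambda>t. y + complex_of_real t * v"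
  define dX dY dQ dR where "dX = 2 * Re (cnj x * u)" and "dY = 2 * Re (cnj y * v)"
    and "dQ = - 2 * Re ((1 - cnj x * y) * (u * cnj y + x * cnj v))"
    and "dR = 2 * Re ((cnj x * y - cnj c) * (u * cnj y + x * cnj v))"
  have 1: "((\<lambda>t. cmod2 (?x t)) has_real_derivative dX) (at 0)"
    "((\<lambda>t. cmod2 (?y t)) has_real_derivative dY) (at 0)"
    unfolding cmod_power2 dX_def dY_def by (auto intro!: derivative_eq_intros simp: algebra_simps)
  have 2: "((\<lambda>t. cmod2 (1 - ?x t * cnj (?y t))) has_real_derivative dQ) (at 0)"
    "((\<lambda>t. cmod2 (?x t * cnj (?y t) - c)) has_real_derivative dR) (at 0)"
    unfolding cmod_power2 dQ_def dR_def by (auto intro!: derivative_eq_intros simp: algebra_simps)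
  have s: "cmod (1 - y * cnj x) = cmod (1 - x * cnj y)" "cmod (y * cnj x - cnj c) = cmod (x * cnj y - c)"
    using complex_mod_cnj[of "1 - x * cnj y"] complex_mod_cnj[of "x * cnj y - c"]
    by (simp_all add: mult.commute del: complex_mod_cnj)
  let ?D = "dX * (cmod2 y - W) * cmod2 (1 - x * cnj y) + (cmod2 x - Z) * dY * cmod2 (1 - x * cnj y)
     + (cmod2 x - Z) * (cmod2 y - W) * dQ
     - (dR * (1 - cmod2 x) * (1 - cmod2 y) - cmod2 (x * cnj y - c) * dX * (1 - cmod2 y)
        - cmod2 (x * cnj y - c) * (1 - cmod2 x) * dY)"
  have "((\<lambda>t. pick_det Z W c (?x t) (?y t)) has_real_derivative ?D) (at 0)"
    unfolding pick_det_def by (rule derivative_eq_intros 1 2 refl)+ (simp add: algebra_simps)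
  also have "?D = 2 * Re (pick_grad Z W c x y * u + pick_grad W Z (cnj c) y x * v)"
  proof -
    define X Y Q R where "X = cmod2 x" and "Y = cmod2 y" and "Q = cmod2 (1 - x * cnj y)"
      and "R = cmod2 (x * cnj y - c)"
    show ?thesis
      unfolding pick_grad_def s dX_def dY_def dQ_def dR_def
      unfolding X_def[symmetric] Y_def[symmetric] Q_def[symmetric] R_def[symmetric]
      by (simp add: algebra_simps)
  qed
  finally show ?thesis .
qed

text \<open>First-order condition under an inequality constraint. The conditions on
  \<open>cmod x\<close>, \<open>cmod y\<close>, \<open>Z\<close> and \<open>W\<close> are open and
  cost no multiplier; that the remaining constraint is an inequality gives the multiplier its
  sign.\<close>

lemma pick_det_lagrange:
  assumes xy: "cmod x < 1" "cmod y < 1" "Z < cmod2 x" "W < cmod2 y"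
    and f: "0 \<le> pick_det Z W c x y" and g: "pick_det S T s x y = 0"
    and min: "\<And>x y. cmod x < 1 \<Longrightarrow> cmod y < 1 \<Longrightarrow> Z < cmod2 x \<Longrightarrow> W < cmod2 y \<Longrightarrow>
      0 \<le> pick_det Z W c x y \<Longrightarrow> 0 \<le> pick_det S T s x y"
    and nz: "(pick_grad S T s x y, pick_grad T S (cnj s) y x) \<noteq> 0"
  shows "pick_det Z W c x y = 0"
    and "(pick_grad Z W c x y, pick_grad W Z (cnj c) y x) \<noteq> 0 \<Longrightarrow>
      \<exists>\<kappa>>0. pick_grad S T s x y = of_real \<kappa> * pick_grad Z W c x y \<and>
         pick_grad T S (cnj s) y x = of_real \<kappa> * pick_grad W Z (cnj c) y x"
proof -
  define a where "a = (pick_grad Z W c x y, pick_grad W Z (cnj c) y x)"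
  define b where "b = (pick_grad S T s x y, pick_grad T S (cnj s) y x)"
  let ?x = "\<lambda>u t. x + complex_of_real t * u"
  have inner: "(p :: complex \<times> complex) \<bullet> (cnj u, cnj v) = Re (fst p * u + snd p * v)" for p u v
    by (cases p) (simp add: inner_complex_def)
  \<comment> \<open>No direction may decrease the objective to first order while staying feasible;
    feasibility comes either from slack in the constraint or from its first-order increase.\<close>
  have no: False if db: "b \<bullet> d < 0" and da: "0 < pick_det Z W c x y \<or> 0 < a \<bullet> d" for d
  proof -
    define u v where "u = cnj (fst d)" and "v = cnj (snd d)"
    have d: "d = (cnj u, cnj v)" by (simp add: u_def v_def)
    define F where "F t = pick_det Z W c (?x u t) (y + of_real t * v)" for t
    define G where "G t = pick_det S T s (?x u t) (y + of_real t * v)" for t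
    have F': "(F has_real_derivative 2 * (a \<bullet> d)) (at 0)"
      using pick_det_line_derivative[of Z W c x u y v] unfolding F_def d inner a_def by simp
    have G': "(G has_real_derivative 2 * (b \<bullet> d)) (at 0)"
      using pick_det_line_derivative[of S T s x u y v] unfolding G_def d inner b_def by simp
    have G0: "G 0 = 0" by (simp add: G_def g)
    have F0: "F 0 = pick_det Z W c x y" by (simp add: F_def)
    obtain e1 where e1: "e1 > 0" "\<And>h. 0 < h \<Longrightarrow> h < e1 \<Longrightarrow> G h < 0"
      using DERIV_neg_dec_right[OF G'] db G0 by auto
    have ev1: "\<forall>\<^sub>F t in at_right 0. G t < 0"
      unfolding eventually_at_right_field using e1 by auto
    have ev2: "\<forall>\<^sub>F t in at_right 0. 0 \<le> F t"
      using da
    proof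
      assume "0 < a \<bullet> d"
      then obtain e2 where "e2 > 0" "\<And>h. 0 < h \<Longrightarrow> h < e2 \<Longrightarrow> F 0 < F h"
        using DERIV_pos_inc_right[OF F'] by auto
      then show ?thesis
        unfolding eventually_at_right_field using f F0 by (intro exI[of _ e2]) force
    next
      assume "0 < pick_det Z W c x y"
      moreover have "(F \<longlongrightarrow> F 0) (at_right 0)"
        using DERIV_isCont[OF F'] by (simp add: isCont_def filterlim_at_split)
      ultimately have "\<forall>\<^sub>F t in at_right 0. 0 < F t" using F0 by (auto intro: order_tendstoD)
      then show ?thesis by (rule eventually_mono) simp
    qed
    have lx: "((\<lambda>t. cmod (?x u t)) \<longlongrightarrow> cmod (?x u 0)) (at_right 0)"
      and ly: "((\<lambda>t. cmod (?x v t - x + y)) \<longlongrightarrow> cmod (?x v 0 - x + y)) (at_right 0)"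
      by (intro tendsto_intros)+
    have ev3: "\<forall>\<^sub>F t in at_right 0. cmod (?x u t) < 1"
      using lx xy(1) by (intro order_tendstoD(2)[OF lx]) simp
    have ev4: "\<forall>\<^sub>F t in at_right 0. cmod (?x v t - x + y) < 1"
      using xy(2) by (intro order_tendstoD(2)[OF ly]) simp
    have ev5: "\<forall>\<^sub>F t in at_right 0. Z < cmod2 (?x u t)"
      using xy(3) by (intro order_tendstoD(1)[OF tendsto_power[OF lx]]) simp
    have ev6: "\<forall>\<^sub>F t in at_right 0. W < cmod2 (?x v t - x + y)"
      using xy(4) by (intro order_tendstoD(1)[OF tendsto_power[OF ly]]) simp
    have "\<forall>\<^sub>F t :: real in at_right 0. False"
      using ev1 ev2 ev3 ev4 ev5 ev6
    proof eventually_elim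
      case (elim t)
      have "?x v t - x + y = y + of_real t * v" by simp
      with elim min[of "?x u t" "y + of_real t * v"] show False
        by (simp add: F_def G_def add.commute[of _ y])
    qed
    then show False by (simp add: eventually_False)
  qed
  have b0: "b \<noteq> 0" using nz by (simp add: b_def)
  show f0: "pick_det Z W c x y = 0"
  proof (rule ccontr)
    assume "pick_det Z W c x y \<noteq> 0"
    then show False using no[of "- b"] f b0 by auto
  qed
  assume "(pick_grad Z W c x y, pick_grad W Z (cnj c) y x) \<noteq> 0"
  then have a0: "a \<noteq> 0" by (simp add: a_def)
  \<comment> \<open>The bisector of \<open>a\<close> and \<open>- b\<close>: unless the two
    gradients point the same way, it increases the constraint and decreases the objective.\<close>
  define d where "d = a /\<^sub>R norm a - b /\<^sub>R norm b"
  have "a \<bullet> b = norm a * norm b"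
  proof (rule ccontr)
    assume "a \<bullet> b \<noteq> norm a * norm b"
    then have lt: "a \<bullet> b < norm a * norm b" using norm_cauchy_schwarz[of a b] by simp
    have "a \<bullet> d = norm a - (a \<bullet> b) / norm b"
      using a0 b0 by (simp add: d_def inner_diff_right dot_square_norm power2_eq_square divide_inverse)
    moreover have "(a \<bullet> b) / norm b < norm a" using lt b0 by (simp add: pos_divide_less_eq)
    ultimately have 1: "0 < a \<bullet> d" by simp
    have "b \<bullet> d = (a \<bullet> b) / norm a - norm b"
      using a0 b0 by (simp add: d_def inner_diff_right dot_square_norm power2_eq_square divide_inverse inner_commute)
    moreover have "(a \<bullet> b) / norm a < norm b" using lt a0 by (simp add: pos_divide_less_eq mult.commute)
    ultimately have 2: "b \<bullet> d < 0" by simp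
    show False using no[OF 2] 1 by blast
  qed
  then have "inverse (norm a) *\<^sub>R (norm a *\<^sub>R b) = inverse (norm a) *\<^sub>R (norm b *\<^sub>R a)"
    by (simp add: norm_cauchy_schwarz_eq)
  then have "b = (norm b / norm a) *\<^sub>R a"
    using a0 by (simp add: divide_inverse_commute)
  then show "\<exists>\<kappa>>0. pick_grad S T s x y = of_real \<kappa> * pick_grad Z W c x y \<and>
         pick_grad T S (cnj s) y x = of_real \<kappa> * pick_grad W Z (cnj c) y x"
    using a0 b0 by (intro exI[of _ "norm b / norm a"]) (auto simp: a_def b_def scaleR_conv_of_real)
qed

text \<open>By Vieta the product of two distinct zeros would be \<open>p / cnj p\<close>, of modulus
  1 unless \<open>p = 0\<close>; two points of the open disc cannot achieve this.\<close>

lemma self_reciprocal_quadratic_eq_0: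
  fixes p x y :: complex and s :: real
  assumes "cmod x < 1" "cmod y < 1" "x \<noteq> y"
    and "p + of_real s * x + cnj p * x^2 = 0" "p + of_real s * y + cnj p * y^2 = 0"
  shows "p = 0" "s = 0"
proof -
  have "(x - y) * (of_real s + cnj p * (x + y)) = 0"
    using assms(4,5) by algebra
  then have s: "of_real s + cnj p * (x + y) = 0" using assms(3) by simp
  then have "p = cnj p * (x * y)" using assms(4) by algebra
  then have "cmod p = cmod p * cmod (x * y)" by (metis complex_mod_cnj norm_mult)
  moreover have "cmod (x * y) < 1" using mult_strict_mono'[OF assms(1,2)] by (simp add: norm_mult)
  ultimately show "p = 0" by auto
  then show "s = 0" using s by simp
qed

text \<open>What remains of the gradient of \<open>pick_det\<close> at a singular Pick matrix once
  nonvanishing factors are split off. The outer coefficients are conjugate and the middle one is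
  real, so it is self-reciprocal.\<close>

definition grad_quad :: "complex \<Rightarrow> complex \<Rightarrow> complex \<Rightarrow> complex" where
  "grad_quad e f t = e * cnj f + of_real (cmod2 e + cmod2 f + 1) * t + cnj e * f * t^2"

text \<open>The factors in front of \<open>grad_quad\<close> depend on the factorisation only
  through \<open>cmod2 (h1 * h2)\<close>. Hence proportional gradients for nodes and targets yield
  proportional quadratics. Multiplying by \<open>x\<close> allows the substitution
  \<open>x = h1 * (e + f * x)\<close>.\<close>

lemma pick_grad_factor:
  assumes Z: "cmod2 x - Z = (1 - cmod2 x) * cmod2 h1"
    and W: "cmod2 y - W = (1 - cmod2 y) * cmod2 h2"
    and c: "x * cnj y - c = (1 - x * cnj y) * (h1 * cnj h2)"
    and x: "x = h1 * (e + f * x)" and y: "y = h2 * (e + f * y)"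
  shows "x * pick_grad Z W c x y =
    of_real ((1 - cmod2 y) * cmod2 (h1 * h2)) * (1 - cnj x * y) * (cnj x - cnj y) * grad_quad e f x"
proof -
  define Y where "Y = 1 - y * cnj y"
  define X where "X = 1 - x * cnj x"
  have cc: "cnj x * y - cnj c = (1 - cnj x * y) * (cnj h1 * h2)"
    using arg_cong[OF c, of cnj] by (simp add: mult_ac)
  have e1: "of_real ((cmod2 y - W) * cmod2 (1 - x * cnj y)) =
      Y * (h2 * cnj h2) * ((1 - x * cnj y) * (1 - cnj x * y))"
    unfolding W by (simp add: of_real_cmod_sq Y_def mult_ac)
  have e2: "of_real ((cmod2 x - Z) * (cmod2 y - W)) = X * (h1 * cnj h1) * (Y * (h2 * cnj h2))"
    unfolding Z W by (simp add: of_real_cmod_sq X_def Y_def mult_ac)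
  have e3: "of_real ((1 - cmod2 x) * (1 - cmod2 y)) = X * Y"
    by (simp add: of_real_cmod_sq X_def Y_def mult_ac)
  have e4: "of_real (cmod2 (x * cnj y - c) * (1 - cmod2 y)) =
      ((1 - x * cnj y) * (1 - cnj x * y)) * (h1 * cnj h1 * h2 * cnj h2) * Y"
    unfolding c by (simp add: of_real_cmod_sq Y_def mult_ac)
  have "x * pick_grad Z W c x y = Y * (1 - cnj x * y) *
      ((h2 * cnj h2) * (x * cnj x) * (1 - x * cnj y) - (x * cnj y) * (cnj h1 * h2) * X
        + (h1 * cnj h1 * h2 * cnj h2) * (x * cnj x - x * cnj y))"
    unfolding pick_grad_def e1 e2 e3 e4 cc unfolding X_def by (simp add: algebra_simps)
  also have "(h2 * cnj h2) * (x * cnj x) = (h1 * cnj h1 * h2 * cnj h2) * ((e + f * x) * cnj (e + f * x))"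
  proof -
    have "x * cnj x = (h1 * (e + f * x)) * cnj (h1 * (e + f * x))" using x by simp
    then show ?thesis by simp
  qed
  also have "(x * cnj y) * (cnj h1 * h2) = (h1 * cnj h1 * h2 * cnj h2) * ((e + f * x) * cnj (e + f * y))"
  proof -
    have "x * cnj y = (h1 * (e + f * x)) * cnj (h2 * (e + f * y))" using x y by simp
    then show ?thesis by simp
  qed
  also have "Y * (1 - cnj x * y) *
      ((h1 * cnj h1 * h2 * cnj h2) * ((e + f * x) * cnj (e + f * x)) * (1 - x * cnj y) -
       (h1 * cnj h1 * h2 * cnj h2) * ((e + f * x) * cnj (e + f * y)) * X +
       (h1 * cnj h1 * h2 * cnj h2) * (x * cnj x - x * cnj y)) =
     Y * (h1 * cnj h1 * h2 * cnj h2) * (1 - cnj x * y) * (cnj x - cnj y) * 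
      (e * cnj f + (e * cnj e + f * cnj f + 1) * x + cnj e * f * x^2)"
    unfolding X_def by (simp add: algebra_simps power2_eq_square)
  finally show ?thesis
    by (simp add: grad_quad_def of_real_cmod_sq Y_def mult_ac)
qed

text \<open>A singular Pick matrix with first row of ones has the form \<open>1 + h\<^sub>i cnj h\<^sub>j\<close> with \<open>h\<^sub>0 = 0\<close>; the numbers
  \<open>e\<close>, \<open>f\<close> interpolate \<open>x\<^sub>i / h\<^sub>i\<close> by an affine function.\<close>

lemma pick_det_zero_rank_one:
  assumes "cmod x < 1" "cmod y < 1" "x \<noteq> 0" "y \<noteq> 0" "x \<noteq> y"
    and Z: "Z < cmod2 x" and W: "W < cmod2 y" and 0: "pick_det Z W c x y = 0"
  obtains h1 h2 e f where "h1 \<noteq> 0" "h2 \<noteq> 0"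
    "cmod2 x - Z = (1 - cmod2 x) * cmod2 h1"
    "cmod2 y - W = (1 - cmod2 y) * cmod2 h2"
    "x * cnj y - c = (1 - x * cnj y) * (h1 * cnj h2)"
    "x = h1 * (e + f * x)" "y = h2 * (e + f * y)"
proof -
  have X1: "cmod2 x < 1" "cmod2 y < 1" using assms by (auto simp: abs_square_less_1)
  have n: "1 - x * cnj y \<noteq> 0" using mult_cnj_less_1[OF assms(1,2)] by auto
  define m where "m = (cmod2 x - Z) / (1 - cmod2 x)"
  have m: "m > 0" using Z X1 by (simp add: m_def)
  define u where "u = (x * cnj y - c) / (1 - x * cnj y)"
  \<comment> \<open>Only products of one \<open>h\<close> with a conjugate \<open>h\<close> matter,
    so \<open>h1\<close> may be positive. The off-diagonal entry then fixes \<open>h2\<close>, and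
    the vanishing determinant supplies the other diagonal equation.\<close>
  define h1 where "h1 = complex_of_real (sqrt m)"
  have h1: "h1 \<noteq> 0" "cmod2 h1 = m" "cnj h1 = h1" using m by (auto simp: h1_def)
  define h2 where "h2 = cnj u / h1"
  have a: "cmod2 x - Z = (1 - cmod2 x) * cmod2 h1" using X1 by (simp add: h1 m_def)
  have b: "x * cnj y - c = (1 - x * cnj y) * (h1 * cnj h2)"
    using n h1 by (simp add: h2_def u_def)
  have "cmod2 (x * cnj y - c) * (1 - cmod2 x) * (1 - cmod2 y) =
      (cmod2 x - Z) * (cmod2 y - W) * cmod2 (1 - x * cnj y)"
    using 0 by (simp add: pick_det_def)
  then have "(cmod2 (1 - x * cnj y) * cmod2 h1 * (1 - cmod2 x)) * (cmod2 h2 * (1 - cmod2 y)) =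
      (cmod2 (1 - x * cnj y) * cmod2 h1 * (1 - cmod2 x)) * (cmod2 y - W)"
    unfolding a b by (simp add: norm_mult power_mult_distrib mult_ac)
  then have d: "cmod2 y - W = (1 - cmod2 y) * cmod2 h2"
    using n h1 X1 m by (simp add: mult_ac)
  have h2: "h2 \<noteq> 0" using d W by auto
  define f where "f = (x / h1 - y / h2) / (x - y)"
  define e where "e = x / h1 - f * x"
  have "f * (x - y) = x / h1 - y / h2" using assms(5) by (simp add: f_def)
  then have "e + f * y = y / h2" by (simp add: e_def algebra_simps)
  then have y: "y = h2 * (e + f * y)" using h2 by simp
  have x: "x = h1 * (e + f * x)" using h1 by (simp add: e_def)
  show thesis using that[OF h1(1) h2 a d b x y] .
qed

lemma of_real_rank_one:
  assumes "cmod2 x - Z = (1 - cmod2 x) * cmod2 h"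
  shows "x * cnj x - of_real Z = (1 - x * cnj x) * (h * cnj h)"
  using arg_cong[OF assms, of complex_of_real] by (simp add: of_real_cmod_sq)

text \<open>The sign of \<open>cmod2 e - cmod2 f - 1\<close> tells the two kinds of data apart: it
  is 0 for scalar targets, whose Gram matrix is singular, and positive for linearly independent
  nodes.\<close>

lemma gram_det_affine:
  assumes Z: "cmod2 x - Z = (1 - cmod2 x) * cmod2 h1"
    and W: "cmod2 y - W = (1 - cmod2 y) * cmod2 h2"
    and c: "x * cnj y - c = (1 - x * cnj y) * (h1 * cnj h2)"
    and x: "x = h1 * (e + f * x)" and y: "y = h2 * (e + f * y)"
  shows "Z * W - cmod2 c = cmod2 (h1 * h2) * cmod2 (x - y) * (cmod2 e - cmod2 f - 1)"
proof -
  define H1 H2 where "H1 = e + f * x" and "H2 = e + f * y"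
  have gen: "k = h * cnj h' * (H * cnj H' - 1 + a * cnj b)"
    if "a * cnj b - k = (1 - a * cnj b) * (h * cnj h')" "a = h * H" "b = h' * H'" for k h h' H H' a b
  proof -
    have "k = a * cnj b - (1 - a * cnj b) * (h * cnj h')" using that(1) by (simp add: algebra_simps)
    also have "a * cnj b - (1 - a * cnj b) * (h * cnj h') = (h * H) * cnj (h' * H') - (1 - a * cnj b) * (h * cnj h')"
      unfolding that(2,3)[symmetric] ..
    finally show ?thesis by (simp add: algebra_simps)
  qed
  have Z': "of_real Z = h1 * cnj h1 * (H1 * cnj H1 - 1 + x * cnj x)"
    and W': "of_real W = h2 * cnj h2 * (H2 * cnj H2 - 1 + y * cnj y)"
    and c': "c = h1 * cnj h2 * (H1 * cnj H2 - 1 + x * cnj y)"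
    unfolding H1_def H2_def
    by (rule gen[OF of_real_rank_one[OF Z] x x] gen[OF of_real_rank_one[OF W] y y] gen[OF c x y])+
  have "of_real (Z * W - cmod2 c) = of_real Z * of_real W - c * cnj c"
    by (simp add: of_real_cmod_sq)
  also have "\<dots> = (h1 * cnj h1) * (h2 * cnj h2) * ((H1 * cnj H1 - 1 + x * cnj x) * (H2 * cnj H2 - 1 + y * cnj y)
      - (H1 * cnj H2 - 1 + x * cnj y) * (H2 * cnj H1 - 1 + y * cnj x))"
    unfolding Z' W' unfolding c' by (simp add: algebra_simps)
  also have "(H1 * cnj H1 - 1 + x * cnj x) * (H2 * cnj H2 - 1 + y * cnj y)
      - (H1 * cnj H2 - 1 + x * cnj y) * (H2 * cnj H1 - 1 + y * cnj x) =
      (x - y) * cnj (x - y) * (e * cnj e - f * cnj f - 1)"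
    unfolding H1_def H2_def by (simp add: algebra_simps)
  also have "(h1 * cnj h1) * (h2 * cnj h2) * ((x - y) * cnj (x - y) * (e * cnj e - f * cnj f - 1)) =
     of_real (cmod2 (h1 * h2) * cmod2 (x - y) * (cmod2 e - cmod2 f - 1))"
    by (simp add: of_real_cmod_sq mult_ac)
  finally show ?thesis by (simp only: of_real_eq_iff)
qed

text \<open>Since \<open>\<kappa>\<close> is real, the difference of the two quadratics is again
  self-reciprocal, and it vanishes at two points of the disc.\<close>

lemma grad_quad_proportional:
  assumes q: "grad_quad e f x = of_real \<kappa> * grad_quad e' f' x" "grad_quad e f y = of_real \<kappa> * grad_quad e' f' y"
    and xy: "cmod x < 1" "cmod y < 1" "x \<noteq> y"
  shows "e * cnj f = of_real \<kappa> * (e' * cnj f')"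
    "cmod2 e + cmod2 f + 1 = \<kappa> * (cmod2 e' + cmod2 f' + 1)"
proof -
  define p where "p = e * cnj f - of_real \<kappa> * (e' * cnj f')"
  define s where "s = cmod2 e + cmod2 f + 1 - \<kappa> * (cmod2 e' + cmod2 f' + 1)"
  have "p + of_real s * t + cnj p * t^2 = grad_quad e f t - of_real \<kappa> * grad_quad e' f' t" for t
    by (simp add: p_def s_def grad_quad_def algebra_simps)
  then have "p + of_real s * x + cnj p * x^2 = 0" "p + of_real s * y + cnj p * y^2 = 0"
    using q by simp_all
  from self_reciprocal_quadratic_eq_0[OF xy this] have "p = 0" "s = 0" .
  then show "e * cnj f = of_real \<kappa> * (e' * cnj f')"
    "cmod2 e + cmod2 f + 1 = \<kappa> * (cmod2 e' + cmod2 f' + 1)"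
    by (simp_all add: p_def s_def)
qed

lemma grad_quad_not_both_0:
  assumes "cmod x < 1" "cmod y < 1" "x \<noteq> y"
  shows "grad_quad e f x \<noteq> 0 \<or> grad_quad e f y \<noteq> 0"
proof (rule ccontr)
  assume "\<not> ?thesis"
  then have "cmod2 e + cmod2 f + 1 = 0"
    using grad_quad_proportional(2)[of e f x 0 0 0 y] assms by simp
  then show False by (smt (verit) zero_le_power2)
qed

text \<open>The unimodular \<open>\<nu>\<close> rotates the disc so that \<open>f / e\<close> and
  \<open>f' / e'\<close> both become nonpositive reals, possible because \<open>k(2)\<close> makes
  one a positive multiple of the other. Then \<open>c\<close> and \<open>\<beta>\<close> are chosen
  so that the affine functions with these coefficients are, up to a constant, the denominators of
  \<open>defect\<close>.\<close>

lemma curve_parameters: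
  fixes e f e' f' :: complex
  assumes k: "0 < \<kappa>" "e * cnj f = of_real \<kappa> * (e' * cnj f')"
      "cmod2 e + cmod2 f + 1 = \<kappa> * (cmod2 e' + cmod2 f' + 1)"
    and ef: "cmod2 e - cmod2 f = 1" "1 < cmod2 e' - cmod2 f'"
  obtains \<nu> c \<beta> where "cmod \<nu> = 1" "0 \<le> c" "c < 1" "0 < \<beta>" "\<beta> < 1"
    "f = - (e * of_real (2 * c / (1 + c^2)) * \<nu>)"
    "f' = - (e' * of_real (c * (1 + \<beta>) / (1 + \<beta> * c^2)) * \<nu>)"
    "cmod2 e' * (\<beta> * (1 - c^2)^2) = (1 + \<beta> * c^2)^2"
proof -
  define E where "E = cmod2 e'"
  have E1: "1 < E" using ef(2) unfolding E_def by (smt (verit) zero_le_power2)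
  have "0 < cmod2 e" using ef(1) by (smt (verit) zero_le_power2)
  moreover have "0 < cmod2 e'" using E1 unfolding E_def by linarith
  ultimately have e0: "e \<noteq> 0" "e' \<noteq> 0" by auto
  have fe': "f' / e' = of_real (cmod2 e / (\<kappa> * E)) * (f / e)"
  proof -
    have "cnj e * f = of_real \<kappa> * (cnj e' * f')" using arg_cong[OF k(2), of cnj] by simp
    moreover have "f' / e' = cnj e' * f' / of_real E" "f / e = cnj e * f / of_real (cmod2 e)"
      using e0 by (simp_all add: E_def of_real_cmod_sq)
    ultimately show ?thesis using k(1) e0 E1 by simp
  qed
  show thesis
  proof (cases "f = 0")
    case True
    then have "f' = 0" using fe' e0 by auto
    \<comment> \<open>With \<open>f = 0\<close> one takes \<open>c = 0\<close>; any phase serves,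
      and the normalisation forces \<open>\<beta> = 1 / E\<close>.\<close>
    have "cmod2 e' * ((1 / E) * (1 - 0^2)^2) = (1 + (1 / E) * 0^2)^2"
      using e0 by (simp add: E_def)
    then show thesis
      using that[of 1 0 "1 / E"] True \<open>f' = 0\<close> E1 e0 by simp
  next
    case False
    define g where "g = cmod f / cmod e"
    have g0: "0 < g" using False e0 by (simp add: g_def)
    have f2: "cmod2 f = g^2 * cmod2 e" using e0 by (simp add: g_def power_divide)
    then have eg: "cmod2 e * (1 - g^2) = 1" using ef(1) by (simp add: algebra_simps)
    have g21: "g^2 < 1"
    proof (rule ccontr)
      assume "\<not> ?thesis"
      then have "cmod2 e * (1 - g^2) \<le> 0" by (simp add: mult_nonneg_nonpos)
      then show False using eg by simp
    qed
    define q where "q = sqrt (1 - g^2)"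
    have q: "q^2 = 1 - g^2" "0 < q" "q < 1" using g21 g0 by (auto simp: q_def)
    \<comment> \<open>The root in (0, 1) of \<open>g = 2 * c / (1 + c^2)\<close>, by the half-angle
      substitution.\<close>
    define c where "c = g / (1 + q)"
    have c0: "0 < c" using g0 q by (simp add: c_def)
    have c2: "c^2 = (1 - q) / (1 + q)"
    proof -
      have "c^2 = g^2 / (1 + q)^2" by (simp add: c_def power_divide)
      also have "g^2 = (1 - q) * (1 + q)" using q(1) by (simp add: power2_eq_square algebra_simps)
      finally show ?thesis using q by (simp add: power2_eq_square)
    qed
    have "c^2 < 1" unfolding c2 using q by simp
    then have c1: "c < 1" using c0 by (simp add: abs_square_less_1)
    have c21: "1 + c^2 = 2 / (1 + q)" unfolding c2 using q by (simp add: divide_simps)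
    have gc: "g = 2 * c / (1 + c^2)" unfolding c21 using q by (simp add: c_def)
    define \<nu> where "\<nu> = - (f / e) / of_real g"
    have \<nu>1: "cmod \<nu> = 1" using g0 False e0 by (simp add: \<nu>_def norm_divide norm_mult g_def)
    have fe: "f = - (e * of_real g * \<nu>)" using g0 e0 by (simp add: \<nu>_def)
    define r where "r = cmod2 e / (\<kappa> * E) * g"
    have r0: "0 < r" using g0 e0 k(1) E1 by (simp add: r_def)
    have "f' / e' = - (of_real r * \<nu>)" using fe' g0 by (simp add: r_def \<nu>_def)
    then have f'e': "f' = - (e' * of_real r * \<nu>)" using e0 by (simp add: field_simps)
    have f'2: "cmod2 f' = r^2 * E"
      unfolding f'e' using r0 \<nu>1 by (simp add: norm_mult power_mult_distrib E_def)
    have \<kappa>: "\<kappa> * (E * r) = cmod2 e * g" using k(1) E1 by (simp add: r_def)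
    have sum: "2 * cmod2 e = \<kappa> * (E + r^2 * E + 1)"
      using k(3) ef(1) f'2 by (simp add: E_def)
    have "\<kappa> * (2 * (E * r)) = \<kappa> * (g * (E + r^2 * E + 1))"
      using \<kappa> sum by algebra
    then have "2 * (E * r) = g * (E + r^2 * E + 1)" using k(1) by simp
    moreover have cpos: "0 < 1 + c^2" by (simp add: add_pos_nonneg)
    ultimately have "E * r * (1 + c^2) = c * (E + r^2 * E + 1)"
      unfolding gc by (simp add: field_simps)
    \<comment> \<open>The one relation between \<open>r\<close>, \<open>c\<close> and
      \<open>E\<close> left after eliminating \<open>\<kappa>\<close>. Its positive right side
      forces \<open>c < r\<close>, hence \<open>\<beta> > 0\<close>.\<close>
    then have rc: "E * ((r - c) * (1 - r * c)) = c"
      by (simp add: power2_eq_square algebra_simps)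
    have Er: "1 < E * (1 - r^2)" using ef(2) f'2 by (simp add: E_def algebra_simps)
    have "0 < 1 - r^2" using Er E1 by (smt (verit) mult_nonneg_nonpos)
    then have r1: "r < 1" using r0 by (simp add: abs_square_less_1)
    have rc1: "0 < 1 - r * c" using r1 c1 r0 c0 mult_strict_mono'[of r 1 c 1] by simp
    have rgc: "c < r"
    proof (rule ccontr)
      assume "\<not> ?thesis"
      then have "E * ((r - c) * (1 - r * c)) \<le> 0" using rc1 E1 by (simp add: mult_nonneg_nonpos mult_nonpos_nonneg)
      then show False using rc c0 by simp
    qed
    \<comment> \<open>Solved from \<open>r = c * (1 + \<beta>) / (1 + \<beta> * c^2)\<close>. The
      gap in \<open>ef(2)\<close>, in the form \<open>1 < E * (1 - r^2)\<close>, gives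
      \<open>\<beta> < 1\<close>.\<close>
    define \<beta> where "\<beta> = (r - c) / (c * (1 - r * c))"
    have b0: "0 < \<beta>" using rgc c0 rc1 by (simp add: \<beta>_def)
    have "E * ((r - c) * (1 - r * c)) < c * (E * (1 - r^2))" using rc Er c0 by simp
    then have "E * ((r - c) * (1 - r * c)) < E * (c * (1 - r^2))" by (simp add: mult_ac)
    then have "(r - c) * (1 - r * c) < c * (1 - r^2)" using E1 by simp
    then have "(r - c) < c * (1 - r * c)" by (simp add: power2_eq_square algebra_simps)
    then have b1: "\<beta> < 1" using c0 rc1 by (simp add: \<beta>_def)
    have be: "\<beta> * (c * (1 - r * c)) = r - c" using c0 rc1 by (simp add: \<beta>_def)
    have bp: "0 < 1 + \<beta> * c^2" using b0 by (simp add: add_pos_nonneg)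
    have rr: "r * (1 + \<beta> * c^2) = c * (1 + \<beta>)" using be by algebra
    then have r: "r = c * (1 + \<beta>) / (1 + \<beta> * c^2)" using bp by (simp add: field_simps)
    have 1: "(r - c) * (1 + \<beta> * c^2) = c * \<beta> * (1 - c^2)"
      using rr by algebra
    have 2: "(1 - r * c) * (1 + \<beta> * c^2) = 1 - c^2"
    proof -
      have "(1 - r * c) * (1 + \<beta> * c^2) = 1 + \<beta> * c^2 - c * (r * (1 + \<beta> * c^2))" by (simp add: algebra_simps)
      then show ?thesis unfolding rr by (simp add: power2_eq_square algebra_simps)
    qed
    have "c * (1 + \<beta> * c^2)^2 = (E * ((r - c) * (1 - r * c))) * (1 + \<beta> * c^2)^2" by (simp only: rc)
    also have "\<dots> = E * (((r - c) * (1 + \<beta> * c^2)) * ((1 - r * c) * (1 + \<beta> * c^2)))"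
      by (simp add: power2_eq_square)
    also have "\<dots> = c * (E * (\<beta> * (1 - c^2)^2))" unfolding 1 2 by (simp add: power2_eq_square)
    finally have "E * (\<beta> * (1 - c^2)^2) = (1 + \<beta> * c^2)^2" using c0 by simp
    then show thesis
      using that[of \<nu> c \<beta>] \<nu>1 c0 c1 b0 b1 fe f'e' unfolding gc r E_def by simp
  qed
qed

section \<open>The curves through the nodes\<close>

lemma cdot_conj_transpose: "cdot (A *v p) q = cdot p (conj_transpose A *v q)"
  by (simp add: cdot_2 conj_transpose_def matrix_vector_mult_def sum_2 algebra_simps)

lemma conj_transpose_mult: "conj_transpose (A ** B) = conj_transpose B ** conj_transpose A"
  by (simp add: conj_transpose_def matrix_matrix_mult_def vec_eq_iff sum_2 algebra_simps)

lemma cdot_unitary: "U \<in> U2 \<Longrightarrow> cdot (U *v p) (U *v q) = cdot p q"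
  unfolding cdot_conj_transpose by (simp add: U2_def matrix_vector_mul_assoc)

lemma norm_eq_cdot: "(norm z)^2 = Re (cdot z z)"
  by (simp add: cdot_self)

lemma norm_unitary: "U \<in> U2 \<Longrightarrow> norm (U *v p) = norm p"
  by (rule power2_eq_imp_eq) (simp_all add: norm_eq_cdot cdot_unitary)

lemma conj_transpose_U2: "U \<in> U2 \<Longrightarrow> conj_transpose U \<in> U2"
proof -
  have "conj_transpose (conj_transpose U) = U" by (simp add: conj_transpose_def vec_eq_iff)
  then show "U \<in> U2 \<Longrightarrow> conj_transpose U \<in> U2" by (simp add: U2_def)
qed

lemma mat_1_U2: "mat 1 \<in> U2"
proof -
  have "conj_transpose (mat 1) = mat 1" by (simp add: conj_transpose_def mat_def vec_eq_iff)
  then show ?thesis by (simp add: U2_def)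
qed

text \<open>\<open>U\<close> carries one basis to the other; equality of the two Gram matrices is
  exactly what makes it preserve the Hermitian product.\<close>

lemma gram_determines_unitary:
  assumes "cdot z z = cdot z' z'" "cdot w w = cdot w' w'" "cdot z w = cdot z' w'"
    and "z' $ 1 * w' $ 2 - z' $ 2 * w' $ 1 \<noteq> 0"
  obtains U where "U \<in> U2" "z = U *v z'" "w = U *v w'"
proof -
  define M :: "complex^2 \<Rightarrow> complex^2 \<Rightarrow> complex^2^2" where
    "M u v = (\<chi> i j. if j = 1 then u $ i else v $ i)" for u v
  have M1: "M u v *v axis 1 1 = u" and M2: "M u v *v axis 2 1 = v" for u v
    by (simp_all add: M_def matrix_vector_mult_def vec_eq_iff sum_2 axis_def)
  have Gr: "conj_transpose (M u v) ** M u v =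
      (\<chi> i j. if i = 1 then (if j = 1 then cdot u u else cdot v u) else (if j = 1 then cdot u v else cdot v v))" for u v
    by (simp add: M_def conj_transpose_def matrix_matrix_mult_def vec_eq_iff sum_2 cdot_2 mult.commute)
  have wz: "cdot w z = cdot w' z'" using assms(3) cnj_cdot by metis
  have G: "conj_transpose (M z w) ** M z w = conj_transpose (M z' w') ** M z' w'"
    unfolding Gr assms(1-3) wz ..
  have "det (M z' w') \<noteq> 0" using assms(4) by (simp add: det_2 M_def mult.commute)
  then obtain B where B: "M z' w' ** B = mat 1" "B ** M z' w' = mat 1"
    using invertible_det_nz[of "M z' w'"] unfolding invertible_def by blast
  define U where "U = M z w ** B"
  have "conj_transpose U ** U = conj_transpose B ** (conj_transpose (M z w) ** M z w) ** B"
    by (simp add: U_def conj_transpose_mult matrix_mul_assoc)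
  also have "\<dots> = conj_transpose (M z' w' ** B) ** (M z' w' ** B)"
    unfolding G by (simp add: conj_transpose_mult matrix_mul_assoc)
  also have "\<dots> = mat 1" unfolding B using mat_1_U2 by (simp add: U2_def)
  finally have U: "conj_transpose U ** U = mat 1" .
  then have "U \<in> U2" using matrix_left_right_inverse by (auto simp: U2_def)
  moreover have "U *v (M z' w' *v t) = M z w *v t" for t
    by (simp add: U_def matrix_vector_mul_assoc matrix_mul_assoc[symmetric] B)
  then have "z = U *v z'" "w = U *v w'" by (metis M1, metis M2)
  ultimately show thesis using that by blast
qed

text \<open>With \<open>t = \<mu> * cnj \<nu>\<close> and \<open>b^2 = 1 - a^2\<close> the left side
  is \<open>1 - a^2 * t - b^2 * t^2\<close>, which has the root 1 because
  \<open>a^2 + b^2 = 1\<close>.\<close>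

lemma one_minus_cdot_curve:
  assumes "U \<in> U2" "0 < a" "a < 1"
  shows "1 - cdot (curve a U \<mu>) (curve a U \<nu>) =
    (1 - \<mu> * cnj \<nu>) * (1 + of_real (1 - a^2) * (\<mu> * cnj \<nu>))"
proof -
  define b where "b = complex_of_real (sqrt (1 - a^2))"
  have cb: "cnj b = b" by (simp add: b_def)
  have "a^2 \<le> 1" using assms by (simp add: abs_square_le_1)
  then have "b * b = of_real (1 - a^2)"
    unfolding b_def by (metis of_real_mult real_sqrt_mult_self abs_of_nonneg diff_ge_0_iff_ge)
  moreover have "cdot (curve a U \<mu>) (curve a U \<nu>) =
      of_real a * of_real a * (\<mu> * cnj \<nu>) + (b * b) * (\<mu> * cnj \<nu>)^2"
    unfolding curve_def cdot_unitary[OF assms(1)] b_def[symmetric]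
    by (simp add: cdot_2 power_mult_distrib cb mult_ac)
  ultimately show ?thesis
    by (simp add: power2_eq_square) (simp add: algebra_simps)
qed

lemma norm_curve_sq:
  assumes "U \<in> U2" "0 < a" "a < 1"
  shows "1 - (norm (curve a U \<mu>))^2 = (1 - cmod2 \<mu>) * (1 + (1 - a^2) * cmod2 \<mu>)"
proof -
  have "complex_of_real (1 - (norm (curve a U \<mu>))^2) =
     complex_of_real ((1 - cmod2 \<mu>) * (1 + (1 - a^2) * cmod2 \<mu>))"
    using one_minus_cdot_curve[OF assms, of \<mu> \<mu>]
    by (simp add: cdot_self of_real_cmod_sq)
  then show ?thesis by (simp only: of_real_eq_iff)
qed

lemma norm_curve_less_1:
  assumes "U \<in> U2" "0 < a" "a < 1" "cmod \<mu> < 1"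
  shows "norm (curve a U \<mu>) < 1"
proof -
  have "a^2 < 1" using assms by (simp add: abs_square_less_1)
  then have "0 < (1 - cmod2 \<mu>) * (1 + (1 - a^2) * cmod2 \<mu>)"
    using assms(4) by (intro mult_pos_pos add_pos_nonneg mult_nonneg_nonneg) (simp_all add: abs_square_less_1 abs_square_le_1)
  then have "(norm (curve a U \<mu>))^2 < 1" unfolding norm_curve_sq[OF assms(1-3), symmetric] by simp
  then show ?thesis by (simp add: abs_square_less_1)
qed

text \<open>The function \<open>h\<close> with \<open>1 - \<langle>\<phi> x, \<phi> y\<rangle> = (1 - x cnj y) (1 + h x cnj (h y))\<close> for \<open>\<beta> = 1 - a\<^sup>2\<close>; the value
  \<open>\<beta> = 1\<close> gives the corresponding function for the targets.\<close>

definition defect :: "real \<Rightarrow> real \<Rightarrow> complex \<Rightarrow> complex" where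
  "defect \<beta> c x = of_real (sqrt \<beta> * (1 - c^2)) * x / (of_real (1 + \<beta> * c^2) - of_real (c * (1 + \<beta>)) * x)"

text \<open>\<open>1 + \<beta> * c^2\<close> exceeds \<open>|c| * (1 + \<beta>)\<close> by
  \<open>(1 - |c|) * (1 - \<beta> * |c|)\<close>, which is positive.\<close>

lemma defect_denom:
  fixes \<beta> c :: real
  assumes "0 \<le> \<beta>" "\<beta> \<le> 1" "\<bar>c\<bar> < 1" "cmod x < 1"
  shows "of_real (1 + \<beta> * c^2) - of_real (c * (1 + \<beta>)) * x \<noteq> 0"
proof
  assume "of_real (1 + \<beta> * c^2) - of_real (c * (1 + \<beta>)) * x = 0"
  then have "complex_of_real (1 + \<beta> * c^2) = of_real (c * (1 + \<beta>)) * x" by simp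
  then have "cmod (of_real (1 + \<beta> * c^2)) = cmod (of_real (c * (1 + \<beta>)) * x)" by (rule arg_cong)
  then have "\<bar>1 + \<beta> * c^2\<bar> = \<bar>c * (1 + \<beta>)\<bar> * cmod x" by (simp only: norm_mult norm_of_real)
  moreover have "0 \<le> 1 + \<beta> * c^2" using assms by simp
  ultimately have e: "1 + \<beta> * c^2 = \<bar>c\<bar> * (1 + \<beta>) * cmod x" using assms by (simp add: abs_mult)
  have "\<bar>c\<bar> * (1 + \<beta>) * cmod x \<le> \<bar>c\<bar> * (1 + \<beta>)" using assms by (simp add: mult_left_le)
  moreover have "0 < (1 - \<bar>c\<bar>) * (1 - \<beta> * \<bar>c\<bar>)"
  proof -
    have "\<beta> * \<bar>c\<bar> \<le> \<bar>c\<bar>" using assms by (simp add: mult_left_le_one_le)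
    then show ?thesis using assms by (intro mult_pos_pos) auto
  qed
  moreover have "(1 - \<bar>c\<bar>) * (1 - \<beta> * \<bar>c\<bar>) = 1 + \<beta> * c^2 - \<bar>c\<bar> * (1 + \<beta>)"
    by (simp add: algebra_simps power2_eq_square)
  ultimately show False using e by linarith
qed

text \<open>The left side is what \<open>one_minus_cdot_chi_aut\<close> produces from
  \<open>one_minus_cdot_curve\<close>. The factors without \<open>\<beta>\<close> recombine to
  \<open>1 - x * cnj y\<close> by invariance under the Moebius map; the others give the rank-one
  term. The value \<open>\<beta> = 1\<close> is included for the targets.\<close>

lemma defect_identity:
  fixes \<beta> c :: real and x y :: complex
  assumes "0 \<le> \<beta>" "\<beta> \<le> 1" "\<bar>c\<bar> < 1" "cmod x < 1" "cmod y < 1"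
  defines "\<mu> \<equiv> mob (of_real c) x" and "\<nu> \<equiv> mob (of_real c) y"
  shows "((1 - of_real c * of_real c) * (1 + of_real \<beta> * (of_real c * of_real c))) * ((1 - \<mu> * cnj \<nu>) * (1 + of_real \<beta> * (\<mu> * cnj \<nu>))) /
     (((1 - \<mu> * of_real c) * (1 + of_real \<beta> * (\<mu> * of_real c))) *
      ((1 - of_real c * cnj \<nu>) * (1 + of_real \<beta> * (of_real c * cnj \<nu>)))) =
     (1 - x * cnj y) * (1 + defect \<beta> c x * cnj (defect \<beta> c y))"
proof -
  define C B where "C = complex_of_real c" and "B = complex_of_real \<beta>"
  have cC: "cnj C = C" by (simp add: C_def)
  have C1: "cmod C < 1" using assms by (simp add: C_def)
  have \<mu>1: "cmod \<mu> < 1" "cmod \<nu> < 1"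
    using cmod_mob_less_1[of C] C1 assms unfolding \<mu>_def \<nu>_def C_def by auto
  have n1: "1 - C * x \<noteq> 0" "1 - C * cnj y \<noteq> 0"
    using one_minus_cnj_neq_0[OF C1] assms(4,5) by (auto simp: less_imp_le)
  have n2: "1 - C * \<mu> \<noteq> 0" "1 - C * cnj \<nu> \<noteq> 0"
    using one_minus_cnj_neq_0[OF C1] \<mu>1 by (auto simp: less_imp_le)
  define q where "q t = 1 + B * (C * C) - C * (1 + B) * t" for t
  have q: "q x \<noteq> 0" "q (cnj y) \<noteq> 0"
    using defect_denom[OF assms(1-3), of x] defect_denom[OF assms(1-3), of "cnj y"] assms(4,5)
    by (auto simp: q_def B_def C_def power2_eq_square mult_ac)
  have m: "\<mu> = (C - x) / (1 - C * x)" "cnj \<nu> = (C - cnj y) / (1 - C * cnj y)"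
    unfolding \<mu>_def \<nu>_def mob_def C_def[symmetric] cC by (simp_all add: cC)
  have A: "(1 - C * C) * (1 - \<mu> * cnj \<nu>) / ((1 - C * \<mu>) * (1 - C * cnj \<nu>)) = 1 - x * cnj y"
    using one_minus_mob_cnj_mob[of C \<mu> \<nu>] C1 \<mu>1 mob_mob[OF C1] assms(4,5)
    by (simp add: cC \<mu>_def \<nu>_def C_def[symmetric] less_imp_le)
  have e1: "1 + B * (\<mu> * C) = q x / (1 - C * x)" "1 + B * (C * cnj \<nu>) = q (cnj y) / (1 - C * cnj y)"
    unfolding m q_def using n1 by (simp_all add: field_simps)
  have e2: "1 + B * (\<mu> * cnj \<nu>) = ((1 - C * x) * (1 - C * cnj y) + B * (C - x) * (C - cnj y)) / ((1 - C * x) * (1 - C * cnj y))"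
    unfolding m using n1 by (simp add: add_divide_distrib mult_ac)
  have bb: "complex_of_real (sqrt \<beta>) * complex_of_real (sqrt \<beta>) = B"
    using assms(1) by (metis B_def of_real_mult real_sqrt_mult_self abs_of_nonneg)
  have D: "1 + defect \<beta> c x * cnj (defect \<beta> c y) = (1 + B * (C * C)) * (1 + B * (\<mu> * cnj \<nu>)) / ((1 + B * (\<mu> * C)) * (1 + B * (C * cnj \<nu>)))"
  proof -
    have d: "defect \<beta> c x = of_real (sqrt \<beta>) * (1 - C * C) * x / q x"
      "cnj (defect \<beta> c y) = of_real (sqrt \<beta>) * (1 - C * C) * cnj y / q (cnj y)"
      by (simp_all add: defect_def q_def B_def C_def power2_eq_square)
    have "1 + defect \<beta> c x * cnj (defect \<beta> c y) =
       (q x * q (cnj y) + (of_real (sqrt \<beta>) * of_real (sqrt \<beta>)) * (1 - C * C)^2 * (x * cnj y)) / (q x * q (cnj y))"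
      unfolding d using q by (simp add: add_divide_distrib power2_eq_square mult_ac)
    also have "q x * q (cnj y) + (of_real (sqrt \<beta>) * of_real (sqrt \<beta>)) * (1 - C * C)^2 * (x * cnj y) =
       (1 + B * (C * C)) * ((1 - C * x) * (1 - C * cnj y) + B * (C - x) * (C - cnj y))"
      unfolding bb q_def by (simp add: algebra_simps power2_eq_square)
    finally show ?thesis unfolding e1 e2 using n1 by simp
  qed
  show ?thesis
    unfolding D A[symmetric] C_def[symmetric] B_def[symmetric] by (simp add: mult_ac)
qed

lemma phi_cdot:
  assumes "U \<in> U2" "0 < a" "a < 1" "\<bar>c\<bar> < 1" "cmod x < 1" "cmod y < 1"
  shows "1 - cdot (phi a U c x) (phi a U c y) =
    (1 - x * cnj y) * (1 + defect (1 - a^2) c x * cnj (defect (1 - a^2) c y))"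
proof -
  have C1: "cmod (complex_of_real c) < 1" using assms by simp
  have a2: "0 \<le> 1 - a^2" "1 - a^2 \<le> 1" using assms by (auto simp: abs_square_le_1)
  have n: "norm (curve a U (of_real c)) < 1" "norm (curve a U (mob (of_real c) x)) < 1"
    "norm (curve a U (mob (of_real c) y)) < 1"
    using norm_curve_less_1[OF assms(1-3)] C1 cmod_mob_less_1[OF C1] assms(5,6) by auto
  show ?thesis
    unfolding phi_def one_minus_cdot_chi_aut[OF n] one_minus_cdot_curve[OF assms(1-3)]
    using defect_identity[OF a2 assms(4-6)] by simp
qed

text \<open>This is the origin of \<open>\<gamma>\<close>: it is the image of \<open>- c\<close>
  under the Moebius map at \<open>c\<close>, so both sides are Blaschke products of degree two with
  zeros 0 and \<open>\<gamma>\<close>.\<close>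

lemma target_identity:
  fixes c :: real
  assumes "\<bar>c\<bar> < 1" "cmod x < 1"
  shows "x * mob (of_real (2 * c / (1 + c^2))) x = mob (of_real (c^2)) ((mob (of_real c) x)^2)"
proof -
  define C where "C = complex_of_real c"
  have C1: "cmod C < 1" using assms by (simp add: C_def)
  have "1 + c^2 > 0" by (simp add: add_pos_nonneg)
  then have c2: "1 + C * C \<noteq> 0"
    by (metis C_def of_real_1 of_real_add of_real_eq_0_iff of_real_mult order_less_irrefl power2_eq_square)
  have n1: "1 - C * x \<noteq> 0" using one_minus_cnj_neq_0(3)[OF C1] assms by (auto simp: less_imp_le)
  have n2: "1 + C * C - 2 * C * x \<noteq> 0"
    using defect_denom[of 1 c x] assms by (simp add: C_def power2_eq_square mult_ac)
  have n3: "1 - C * C \<noteq> 0" using one_minus_cnj_neq_0(3)[OF C1, of C] C1 by (auto simp: less_imp_le)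
  have g: "complex_of_real (2 * c / (1 + c^2)) = 2 * C / (1 + C * C)" by (simp add: C_def power2_eq_square)
  have cg: "cnj (2 * C / (1 + C * C)) = 2 * C / (1 + C * C)" by (simp add: C_def)
  have "x * mob (of_real (2 * c / (1 + c^2))) x = x * ((2 * C - (1 + C * C) * x) / (1 + C * C)) / ((1 + C * C - 2 * C * x) / (1 + C * C))"
  proof -
    have "2 * C / (1 + C * C) - x = (2 * C - (1 + C * C) * x) / (1 + C * C)"
      "1 - 2 * C / (1 + C * C) * x = (1 + C * C - 2 * C * x) / (1 + C * C)"
      using c2 by (simp_all add: diff_divide_distrib)
    then show ?thesis unfolding g mob_def cg by (simp only: times_divide_eq_right)
  qed
  also have "\<dots> = x * (2 * C - (1 + C * C) * x) / (1 + C * C - 2 * C * x)"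
    using c2 by simp
  finally have L: "x * mob (of_real (2 * c / (1 + c^2))) x = x * (2 * C - (1 + C * C) * x) / (1 + C * C - 2 * C * x)" .
  have m: "mob (of_real c) x = (C - x) / (1 - C * x)" by (simp add: mob_def C_def)
  have num: "C * C - (mob (of_real c) x)^2 = (1 - C * C) * (x * (2 * C - (1 + C * C) * x)) / (1 - C * x)^2"
    unfolding m power_divide using n1 by (simp add: eq_divide_eq diff_divide_eq_iff) (simp add: algebra_simps power2_eq_square)
  have den: "1 - C * C * (mob (of_real c) x)^2 = (1 - C * C) * (1 + C * C - 2 * C * x) / (1 - C * x)^2"
    unfolding m power_divide using n1 by (simp add: eq_divide_eq diff_divide_eq_iff) (simp add: algebra_simps power2_eq_square)
  have "mob (of_real (c^2)) ((mob (of_real c) x)^2) = (C * C - (mob (of_real c) x)^2) / (1 - C * C * (mob (of_real c) x)^2)"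
    by (simp add: mob_def[of "(complex_of_real c)^2"] C_def power2_eq_square[symmetric])
  also have "\<dots> = x * (2 * C - (1 + C * C) * x) / (1 + C * C - 2 * C * x)"
    unfolding num den using n1 n3 by simp
  finally show ?thesis using L by simp
qed

text \<open>The factorisation \<open>1 - t^2 = (1 - t) * (1 + t)\<close> is the case
  \<open>\<beta> = 1\<close> of the one on the curve, so \<open>defect_identity\<close> applies
  again.\<close>

lemma target_gram:
  fixes c :: real
  assumes "\<bar>c\<bar> < 1" "cmod x < 1" "cmod y < 1"
  defines "B \<equiv> \<lambda>x. x * mob (of_real (2 * c / (1 + c^2))) x"
  shows "1 - B x * cnj (B y) = (1 - x * cnj y) * (1 + defect 1 c x * cnj (defect 1 c y))"
proof -
  have C1: "cmod (complex_of_real c) < 1" using assms by simp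
  have c21: "cmod (complex_of_real (c^2)) < 1" using assms by (simp add: abs_square_less_1 norm_power)
  define \<mu> \<nu> where "\<mu> = mob (of_real c) x" and "\<nu> = mob (of_real c) y"
  have \<mu>1: "cmod \<mu> < 1" "cmod \<nu> < 1"
    using cmod_mob_less_1[OF C1] assms unfolding \<mu>_def \<nu>_def by auto
  then have \<mu>2: "cmod (\<mu>^2) \<le> 1" "cmod (\<nu>^2) \<le> 1" by (auto simp: norm_power abs_square_le_1)
  have "1 - B x * cnj (B y) = 1 - mob (of_real (c^2)) (\<mu>^2) * cnj (mob (of_real (c^2)) (\<nu>^2))"
    unfolding B_def target_identity[OF assms(1,2)] target_identity[OF assms(1,3)] \<mu>_def \<nu>_def ..
  also have "\<dots> = (1 - of_real (c^2) * cnj (of_real (c^2))) * (1 - \<mu>^2 * cnj (\<nu>^2)) /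
      ((1 - cnj (of_real (c^2)) * \<mu>^2) * (1 - of_real (c^2) * cnj (\<nu>^2)))"
    by (rule one_minus_mob_cnj_mob[OF c21 \<mu>2])
  also have "\<dots> = ((1 - of_real c * of_real c) * (1 + of_real c * of_real c)) * ((1 - \<mu> * cnj \<nu>) * (1 + \<mu> * cnj \<nu>)) /
     (((1 - \<mu> * of_real c) * (1 + \<mu> * of_real c)) * ((1 - of_real c * cnj \<nu>) * (1 + of_real c * cnj \<nu>)))"
    by (rule arg_cong2[of _ _ _ _ "(/)"]) (simp_all add: algebra_simps power2_eq_square)
  also have "\<dots> = (1 - x * cnj y) * (1 + defect 1 c x * cnj (defect 1 c y))"
    using defect_identity[of 1 c x y] assms(1-3) unfolding \<mu>_def \<nu>_def by simp
  finally show ?thesis .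
qed

section \<open>Critical points come from curves\<close>

lemma proj_pt_scale:
  assumes "(\<sigma>, \<tau>) \<noteq> (0, 0)" "k \<noteq> 0" "\<sigma>' = k * \<sigma>" "\<tau>' = k * \<tau>"
  shows "proj_pt \<sigma>' \<tau>' = proj_pt \<sigma> \<tau>"
proof -
  have "((\<sigma>, \<tau>), (\<sigma>', \<tau>')) \<in> proj_rel"
    using assms by (auto simp: proj_rel_def)
  then show ?thesis
    unfolding proj_pt_def by (metis equiv_class_eq equiv_proj_rel)
qed

lemma same_gram_proportional:
  fixes \<sigma> \<tau> \<sigma>' \<tau>' :: complex
  assumes "(\<sigma>, \<tau>) \<noteq> (0, 0)" "\<sigma> * cnj \<sigma> = \<sigma>' * cnj \<sigma>'" "\<tau> * cnj \<tau> = \<tau>' * cnj \<tau>'" "\<sigma> * cnj \<tau> = \<sigma>' * cnj \<tau>'"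
  obtains k where "k \<noteq> 0" "\<sigma>' = k * \<sigma>" "\<tau>' = k * \<tau>"
proof (cases "\<sigma> = 0")
  case True
  then have "\<sigma>' = 0" "\<tau> \<noteq> 0" "\<tau>' \<noteq> 0" using assms by auto
  then show thesis using that[of "\<tau>' / \<tau>"] True by simp
next
  case False
  then have s': "\<sigma>' \<noteq> 0" using assms(2) by auto
  have "cnj \<sigma> * \<tau> = cnj \<sigma>' * \<tau>'" using arg_cong[OF assms(4), of cnj] by simp
  then have "(\<sigma>' * cnj \<sigma>') * \<tau>' * \<sigma> = (\<sigma> * cnj \<sigma>) * \<tau> * \<sigma>'" by (simp add: mult_ac)
  then have "\<tau>' * \<sigma> = \<tau> * \<sigma>'" unfolding assms(2) using s' by simp
  then show thesis using that[of "\<sigma>' / \<sigma>"] False s' by (simp add: field_simps)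
qed

lemma mult_cnj_unimodular: "cmod \<nu> = 1 \<Longrightarrow> (\<nu> * x) * cnj (\<nu> * y) = x * cnj y"
proof -
  assume "cmod \<nu> = 1"
  then have "\<nu> * cnj \<nu> = 1" using of_real_cmod_sq[of \<nu>] by simp
  moreover have "(\<nu> * x) * cnj (\<nu> * y) = (\<nu> * cnj \<nu>) * (x * cnj y)" by (simp add: mult_ac)
  ultimately show ?thesis by simp
qed

text \<open>The affine relation determines \<open>h\<close>, and hypothesis \<open>e\<close> matches
  its constants with those of \<open>defect\<close>. The remaining unimodular factor is the same at
  all nodes and cancels from products \<open>h1 * cnj h2\<close>.\<close>

lemma rank_one_is_defect:
  fixes \<beta> c :: real and e h x \<nu> :: complex
  assumes \<beta>: "0 < \<beta>" "\<beta> \<le> 1" and c: "0 \<le> c" "c < 1" and x: "cmod x < 1" and \<nu>: "cmod \<nu> = 1"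
    and e: "cmod2 e * (\<beta> * (1 - c^2)^2) = (1 + \<beta> * c^2)^2"
    and h: "x = h * (e + f * x)" and f: "f = - (e * of_real (c * (1 + \<beta>) / (1 + \<beta> * c^2)) * \<nu>)"
  shows "defect \<beta> c (\<nu> * x) = (\<nu> * e / of_real (cmod e)) * h"
proof -
  have c2: "c^2 < 1" using c by (simp add: abs_square_less_1)
  have bp: "0 < 1 + \<beta> * c^2" using \<beta> by (simp add: add_pos_nonneg)
  have e0: "e \<noteq> 0" using e bp by auto
  have "(cmod e * (sqrt \<beta> * (1 - c^2)))^2 = (1 + \<beta> * c^2)^2"
    using e \<beta> by (simp add: power_mult_distrib)
  then have ce: "cmod e * (sqrt \<beta> * (1 - c^2)) = 1 + \<beta> * c^2"
    using bp c2 \<beta> by (auto intro: power2_eq_imp_eq)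
  define E where "E = complex_of_real (cmod e)"
  define k where "k = complex_of_real (sqrt \<beta> * (1 - c^2))"
  define q where "q = complex_of_real (1 + \<beta> * c^2)"
  define b where "b = complex_of_real (c * (1 + \<beta>))"
  have Ek: "E * k = q" unfolding E_def k_def q_def of_real_mult[symmetric] ce ..
  have E0: "E \<noteq> 0" using e0 by (simp add: E_def)
  have q0: "q \<noteq> 0" using bp unfolding q_def of_real_eq_0_iff by linarith
  have f': "f = - (e * (b / q) * \<nu>)" unfolding f b_def q_def by simp
  have "cmod (\<nu> * x) < 1" using x \<nu> by (simp add: norm_mult)
  then have d0: "q - b * (\<nu> * x) \<noteq> 0"
    using defect_denom[of \<beta> c "\<nu> * x"] \<beta> c unfolding q_def b_def by simp
  have "q * x = h * (e * (q - b * (\<nu> * x)))"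
  proof -
    have "q * x = h * (q * (e + f * x))" using h by (metis mult.left_commute)
    also have "q * (e + f * x) = e * (q - b * (\<nu> * x))"
      unfolding f' using q0 by (simp add: algebra_simps)
    finally show ?thesis .
  qed
  moreover have "k * (E * x) = (E * k) * x" by (simp add: mult_ac)
  ultimately have "k * (E * x) = h * (e * (q - b * (\<nu> * x)))" unfolding Ek by simp
  then have "k * (\<nu> * x) / (q - b * (\<nu> * x)) = (\<nu> * e / E) * h"
    using d0 E0 by (simp add: divide_eq_eq eq_divide_eq mult_ac)
  then show ?thesis by (simp add: defect_def k_def q_def b_def E_def)
qed

lemma cdot_vec_noncollinear:
  assumes "cmod2 (cdot z w) < (norm z)^2 * (norm w)^2"
  shows "z $ 1 * w $ 2 - z $ 2 * w $ 1 \<noteq> 0"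
  using cauchy_schwarz_2[of z w] assms by auto

lemma critical_point_in_image:
  fixes z w :: "complex^2" and \<sigma> \<tau> x y :: complex
  assumes z1: "norm z < 1" "norm w < 1" and nc: "cmod2 (cdot z w) < (norm z)^2 * (norm w)^2"
    and st: "(\<sigma>, \<tau>) \<noteq> (0, 0)"
    and xy: "cmod x < 1" "cmod y < 1" "(norm z)^2 < cmod2 x" "(norm w)^2 < cmod2 y"
    and sx: "cmod2 \<sigma> < cmod2 x" "cmod2 \<tau> < cmod2 y"
    and f: "0 \<le> pick_det ((norm z)^2) ((norm w)^2) (cdot z w) x y"
    and g: "pick_det (cmod2 \<sigma>) (cmod2 \<tau>) (\<sigma> * cnj \<tau>) x y = 0"
    and min: "\<And>x y. cmod x < 1 \<Longrightarrow> cmod y < 1 \<Longrightarrow> (norm z)^2 < cmod2 x \<Longrightarrow> (norm w)^2 < cmod2 y \<Longrightarrow>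
      0 \<le> pick_det ((norm z)^2) ((norm w)^2) (cdot z w) x y \<Longrightarrow>
      0 \<le> pick_det (cmod2 \<sigma>) (cmod2 \<tau>) (\<sigma> * cnj \<tau>) x y"
  shows "(z, w, proj_pt \<sigma> \<tau>) \<in> \<Phi> ` \<Omega>"
proof -
  define Z W c S T s where "Z = (norm z)^2" and "W = (norm w)^2" and "c = cdot z w"
    and "S = cmod2 \<sigma>" and "T = cmod2 \<tau>" and "s = \<sigma> * cnj \<tau>"
  note defs = Z_def W_def c_def S_def T_def s_def
  have "z \<noteq> 0" "w \<noteq> 0" using nc by (auto simp: cdot_2)
  then have ZW: "0 < Z" "Z < 1" "0 < W" "W < 1" "cmod2 c < Z * W"
    using z1 nc by (auto simp: defs abs_square_less_1)
  have f: "0 \<le> pick_det Z W c x y" and g: "pick_det S T s x y = 0"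
    using f g by (simp_all add: defs)
  have ZX: "Z < cmod2 x" "W < cmod2 y" "S < cmod2 x" "T < cmod2 y"
    using xy sx by (simp_all add: defs)
  have x0: "x \<noteq> 0" "y \<noteq> 0" using ZX ZW by auto
  have xney: "x \<noteq> y"
    using pick_det_nonneg_strict(3)[OF ZW xy(1,2) _ _ f] ZX by auto
  obtain g1 g2 e f' where G: "g1 \<noteq> 0" "g2 \<noteq> 0"
    "cmod2 x - S = (1 - cmod2 x) * cmod2 g1"
    "cmod2 y - T = (1 - cmod2 y) * cmod2 g2"
    "x * cnj y - s = (1 - x * cnj y) * (g1 * cnj g2)"
    "x = g1 * (e + f' * x)" "y = g2 * (e + f' * y)"
    using pick_det_zero_rank_one[OF xy(1,2) x0 xney ZX(3,4) g] by blast
  have s': "y * cnj x - cnj s = (1 - y * cnj x) * (g2 * cnj g1)"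
    using arg_cong[OF G(5), of cnj] by (simp add: mult_ac)
  have gx: "x * pick_grad S T s x y =
    of_real ((1 - cmod2 y) * cmod2 (g1 * g2)) * (1 - cnj x * y) * (cnj x - cnj y) * grad_quad e f' x"
    by (rule pick_grad_factor[OF G(3,4,5,6,7)])
  have gy: "y * pick_grad T S (cnj s) y x =
    of_real ((1 - cmod2 x) * cmod2 (g2 * g1)) * (1 - cnj y * x) * (cnj y - cnj x) * grad_quad e f' y"
    by (rule pick_grad_factor[OF G(4,3) s' G(7,6)])
  have X1: "cmod2 x < 1" "cmod2 y < 1" using xy by (auto simp: abs_square_less_1)
  have n: "1 - cnj x * y \<noteq> 0" "1 - cnj y * x \<noteq> 0"
    using one_minus_cnj_neq_0(1) xy by (auto simp: less_imp_le)
  have cx: "cnj x - cnj y \<noteq> 0" "cnj y - cnj x \<noteq> 0" using xney by auto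
  define A1 where "A1 = complex_of_real (1 - cmod2 y) * (1 - cnj x * y) * (cnj x - cnj y)"
  define A2 where "A2 = complex_of_real (1 - cmod2 x) * (1 - cnj y * x) * (cnj y - cnj x)"
  have A0: "A1 \<noteq> 0" "A2 \<noteq> 0" using X1 n cx unfolding A1_def A2_def mult_eq_0_iff of_real_eq_0_iff by auto
  have gx': "x * pick_grad S T s x y = of_real (cmod2 (g1 * g2)) * A1 * grad_quad e f' x"
    and gy': "y * pick_grad T S (cnj s) y x = of_real (cmod2 (g1 * g2)) * A2 * grad_quad e f' y"
    unfolding gx gy A1_def A2_def by (simp_all add: mult_ac)
  \<comment> \<open>A nonzero gradient of the target determinant forces the node constraint to be
    active at the minimum.\<close>
  have nz: "(pick_grad S T s x y, pick_grad T S (cnj s) y x) \<noteq> 0"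
  proof
    assume "(pick_grad S T s x y, pick_grad T S (cnj s) y x) = 0"
    then have "grad_quad e f' x = 0" "grad_quad e f' y = 0"
      using gx' gy' A0 G(1,2) by (auto simp: zero_prod_def)
    then show False using grad_quad_not_both_0[OF xy(1,2) xney] by blast
  qed
  have min': "0 \<le> pick_det S T s x y" if "cmod x < 1" "cmod y < 1" "Z < cmod2 x" "W < cmod2 y"
      "0 \<le> pick_det Z W c x y" for x y
    using min that by (simp add: defs)
  have f0: "pick_det Z W c x y = 0"
    by (rule pick_det_lagrange(1)[OF xy(1,2) ZX(1,2) f g _ nz]) (rule min')
  obtain h1 h2 e' f'' where H: "h1 \<noteq> 0" "h2 \<noteq> 0"
    "cmod2 x - Z = (1 - cmod2 x) * cmod2 h1"
    "cmod2 y - W = (1 - cmod2 y) * cmod2 h2"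
    "x * cnj y - c = (1 - x * cnj y) * (h1 * cnj h2)"
    "x = h1 * (e' + f'' * x)" "y = h2 * (e' + f'' * y)"
    using pick_det_zero_rank_one[OF xy(1,2) x0 xney ZX(1,2) f0] by blast
  have c': "y * cnj x - cnj c = (1 - y * cnj x) * (h2 * cnj h1)"
    using arg_cong[OF H(5), of cnj] by (simp add: mult_ac)
  have hx: "x * pick_grad Z W c x y = of_real (cmod2 (h1 * h2)) * A1 * grad_quad e' f'' x"
    and hy: "y * pick_grad W Z (cnj c) y x = of_real (cmod2 (h1 * h2)) * A2 * grad_quad e' f'' y"
    unfolding pick_grad_factor[OF H(3,4,5,6,7)] pick_grad_factor[OF H(4,3) c' H(7,6)] A1_def A2_def
    by (simp_all add: mult_ac)
  have nz': "(pick_grad Z W c x y, pick_grad W Z (cnj c) y x) \<noteq> 0"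
  proof
    assume "(pick_grad Z W c x y, pick_grad W Z (cnj c) y x) = 0"
    then have "grad_quad e' f'' x = 0" "grad_quad e' f'' y = 0"
      using hx hy A0 H(1,2) by (auto simp: zero_prod_def)
    then show False using grad_quad_not_both_0[OF xy(1,2) xney] by blast
  qed
  obtain \<kappa> where \<kappa>: "\<kappa> > 0" "pick_grad S T s x y = of_real \<kappa> * pick_grad Z W c x y"
    "pick_grad T S (cnj s) y x = of_real \<kappa> * pick_grad W Z (cnj c) y x"
  proof -
    have "\<exists>\<kappa>>0. pick_grad S T s x y = of_real \<kappa> * pick_grad Z W c x y \<and>
         pick_grad T S (cnj s) y x = of_real \<kappa> * pick_grad W Z (cnj c) y x"
      by (rule pick_det_lagrange(2)[OF xy(1,2) ZX(1,2) f g _ nz nz']) (rule min')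
    then show thesis using that by blast
  qed
  \<comment> \<open>\<open>A1\<close> and \<open>A2\<close> are common to both gradients, so only
    the ratio of \<open>cmod2 (h1 * h2)\<close> to \<open>cmod2 (g1 * g2)\<close> has to be
    absorbed.\<close>
  define \<kappa>' where "\<kappa>' = \<kappa> * cmod2 (h1 * h2) / cmod2 (g1 * g2)"
  have gg: "cmod2 (g1 * g2) > 0" "cmod2 (h1 * h2) > 0" using G H by auto
  have \<kappa>'0: "\<kappa>' > 0" using \<kappa>(1) gg by (simp add: \<kappa>'_def)
  have \<kappa>'g: "of_real \<kappa>' * complex_of_real (cmod2 (g1 * g2)) = of_real \<kappa> * of_real (cmod2 (h1 * h2))"
    unfolding of_real_mult[symmetric] \<kappa>'_def using gg by simp
  have q: "k = of_real \<kappa>' * k'"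
    if "of_real (cmod2 (g1 * g2)) * A * k = of_real \<kappa> * (of_real (cmod2 (h1 * h2)) * A * k')" "A \<noteq> 0" for A k k' :: complex
  proof -
    have "of_real (cmod2 (g1 * g2)) * A * k = (of_real \<kappa> * of_real (cmod2 (h1 * h2))) * A * k'"
      unfolding that(1) by (simp only: mult_ac)
    also have "\<dots> = of_real (cmod2 (g1 * g2)) * A * (of_real \<kappa>' * k')"
      unfolding \<kappa>'g[symmetric] by (simp only: mult_ac)
    finally show ?thesis using that(2) gg by (metis mult_left_cancel mult_eq_0_iff of_real_eq_0_iff order_less_irrefl)
  qed
  have q1: "grad_quad e f' x = of_real \<kappa>' * grad_quad e' f'' x"
    by (rule q[OF _ A0(1)]) (unfold gx'[symmetric] hx[symmetric] \<kappa>(2), simp)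
  have q2: "grad_quad e f' y = of_real \<kappa>' * grad_quad e' f'' y"
    by (rule q[OF _ A0(2)]) (unfold gy'[symmetric] hy[symmetric] \<kappa>(3), simp)
  note qprop = grad_quad_proportional[OF q1 q2 xy(1,2) xney]
  have xy2: "cmod2 (x - y) > 0" using xney by simp
  have "S * T - cmod2 s = 0" by (simp add: defs norm_mult power_mult_distrib)
  then have ee: "cmod2 e - cmod2 f' = 1"
    using gram_det_affine[OF G(3-7)] gg xy2 by simp
  have "0 < cmod2 (h1 * h2) * cmod2 (x - y) * (cmod2 e' - cmod2 f'' - 1)"
    using gram_det_affine[OF H(3-7)] ZW by simp
  from zero_less_mult_pos[OF this mult_pos_pos[OF gg(2) xy2]]
  have ee': "1 < cmod2 e' - cmod2 f''" by simp
  obtain \<nu> k \<beta> where P: "cmod \<nu> = 1" "0 \<le> k" "k < 1" "0 < \<beta>" "\<beta> < 1"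
    "f' = - (e * of_real (2 * k / (1 + k^2)) * \<nu>)"
    "f'' = - (e' * of_real (k * (1 + \<beta>) / (1 + \<beta> * k^2)) * \<nu>)"
    "cmod2 e' * (\<beta> * (1 - k^2)^2) = (1 + \<beta> * k^2)^2"
    using curve_parameters[OF \<kappa>'0 qprop ee ee'] by blast
  have k1: "\<bar>k\<bar> < 1" using P by simp
  \<comment> \<open>The normalisation of \<open>e\<close> for \<open>\<beta> = 1\<close>, equivalent
    to \<open>ee\<close>. Nodes and targets share \<open>k\<close> and \<open>\<nu>\<close>, which
    is why one parameter governs both the curve and \<open>\<gamma>\<close>.\<close>
  have P8': "cmod2 e * (1 * (1 - k^2)^2) = (1 + 1 * k^2)^2"
  proof -
    have kp: "1 + k^2 > 0" by (simp add: add_pos_nonneg)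
    have "cmod2 f' = cmod2 e * (2 * k / (1 + k^2))^2"
      unfolding P(6) norm_minus_cancel norm_mult norm_of_real P(1) by (simp only: power_mult_distrib power2_abs mult_1_right)
    then have "cmod2 e * (1 - (2 * k / (1 + k^2))^2) = 1" using ee by (simp add: algebra_simps)
    then have "cmod2 e * ((1 + k^2)^2 - (2 * k)^2) = (1 + k^2)^2"
      using kp by (simp add: power_divide field_simps)
    moreover have "(1 + k^2)^2 - (2 * k)^2 = (1 - k^2)^2" by (simp add: power2_eq_square algebra_simps)
    ultimately show ?thesis by simp
  qed
  define X Y where "X = \<nu> * x" and "Y = \<nu> * y"
  have XY: "cmod X < 1" "cmod Y < 1" "X \<noteq> 0" "Y \<noteq> 0" "X \<noteq> Y"
    using xy P(1) x0 xney by (auto simp: X_def Y_def norm_mult)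
  define a where "a = sqrt (1 - \<beta>)"
  have a: "0 < a" "a < 1" "1 - a^2 = \<beta>" using P by (auto simp: a_def)
  have uni: "cmod (\<nu> * e / of_real (cmod e)) = 1" "cmod (\<nu> * e' / of_real (cmod e')) = 1"
  proof -
    have nn: "0 \<le> cmod2 f'" "0 \<le> cmod2 f''" by simp_all
    have "0 < cmod2 e" using nn ee by linarith
    then have "e \<noteq> 0" by auto
    then show "cmod (\<nu> * e / of_real (cmod e)) = 1" using P(1) by (simp add: norm_mult norm_divide)
    have "0 < cmod2 e'" using nn ee' by linarith
    then have "e' \<noteq> 0" by auto
    then show "cmod (\<nu> * e' / of_real (cmod e')) = 1" using P(1) by (simp add: norm_mult norm_divide)
  qed
  have dh: "defect \<beta> k X = (\<nu> * e' / of_real (cmod e')) * h1" "defect \<beta> k Y = (\<nu> * e' / of_real (cmod e')) * h2"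
    unfolding X_def Y_def
    using rank_one_is_defect[OF P(4) _ P(2,3) _ P(1) P(8) _ P(7)] P(5) xy(1,2) H(6,7) by auto
  have P6': "f' = - (e * of_real (k * (1 + 1) / (1 + 1 * k^2)) * \<nu>)" using P(6) by (simp add: mult.commute)
  have dg: "defect 1 k X = (\<nu> * e / of_real (cmod e)) * g1" "defect 1 k Y = (\<nu> * e / of_real (cmod e)) * g2"
    unfolding X_def Y_def
    using rank_one_is_defect[OF _ _ P(2,3) _ P(1) P8' _ P6'] xy(1,2) G(6,7) by auto
  have cp: "X * cnj X = x * cnj x" "Y * cnj Y = y * cnj y" "X * cnj Y = x * cnj y"
    unfolding X_def Y_def by (simp_all only: mult_cnj_unimodular[OF P(1)])
  have r1: "1 - k = (1 - t) * (1 + u)" if "t - k = (1 - t) * u" for k t u :: complex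
    using that by (simp add: algebra_simps)
  have Zc: "1 - cdot z z = (1 - x * cnj x) * (1 + h1 * cnj h1)"
    "1 - cdot w w = (1 - y * cnj y) * (1 + h2 * cnj h2)"
    "1 - cdot z w = (1 - x * cnj y) * (1 + h1 * cnj h2)"
    using r1[OF of_real_rank_one[OF H(3)]] r1[OF of_real_rank_one[OF H(4)]] r1[OF H(5)]
    by (simp_all add: Z_def W_def c_def cdot_self)
  \<comment> \<open>The points on the curve with identity matrix have the Gram entries of
    \<open>z\<close>, \<open>w\<close>; the unitary matrix matching the two pairs becomes the
    component \<open>U\<close>.\<close>
  define p q where "p = phi a (mat 1) k X" and "q = phi a (mat 1) k Y"
  note pc = phi_cdot[OF mat_1_U2 a(1,2) k1, unfolded a(3)]
  have pp: "1 - cdot p p = 1 - cdot z z" "1 - cdot q q = 1 - cdot w w" "1 - cdot p q = 1 - cdot z w"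
    unfolding p_def q_def pc[OF XY(1) XY(1)] pc[OF XY(2) XY(2)] pc[OF XY(1) XY(2)] dh
      mult_cnj_unimodular[OF uni(2)] cp Zc by simp_all
  then have pp': "cdot z z = cdot p p" "cdot w w = cdot q q" "cdot z w = cdot p q" by simp_all
  have "cmod2 (cdot p q) < (norm p)^2 * (norm q)^2"
    using nc unfolding norm_eq_cdot pp' .
  from gram_determines_unitary[OF pp' cdot_vec_noncollinear[OF this]]
  obtain U where U: "U \<in> U2" "z = U *v p" "w = U *v q" by blast
  have phiU: "phi a U k t = U *v phi a (mat 1) k t" for t
  proof -
    have cU: "curve a U \<mu> = U *v curve a (mat 1) \<mu>" for \<mu> by (simp add: curve_def)
    have "U *v (r *s v) = r *s (U *v v)" for r v by (simp add: vec.scale)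
    then show ?thesis
      unfolding phi_def cU chi_aut_def proj_onto_def cdot_unitary[OF U(1)] norm_unitary[OF U(1)]
      by (simp add: vec.diff vec.scale)
  qed
  define B where "B t = t * mob (of_real (2 * k / (1 + k^2))) t" for t
  have tg: "1 - B X * cnj (B X) = (1 - x * cnj x) * (1 + g1 * cnj g1)"
    "1 - B Y * cnj (B Y) = (1 - y * cnj y) * (1 + g2 * cnj g2)"
    "1 - B X * cnj (B Y) = (1 - x * cnj y) * (1 + g1 * cnj g2)"
    unfolding B_def target_gram[OF k1 XY(1,1)] target_gram[OF k1 XY(2,2)] target_gram[OF k1 XY(1,2)] dg
      mult_cnj_unimodular[OF uni(1)] cp by simp_all
  have "1 - \<sigma> * cnj \<sigma> = (1 - x * cnj x) * (1 + g1 * cnj g1)"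
    "1 - \<tau> * cnj \<tau> = (1 - y * cnj y) * (1 + g2 * cnj g2)"
    "1 - \<sigma> * cnj \<tau> = (1 - x * cnj y) * (1 + g1 * cnj g2)"
    using r1[OF of_real_rank_one[OF G(3)]] r1[OF of_real_rank_one[OF G(4)]] r1[OF G(5)]
    by (simp_all add: S_def T_def s_def of_real_cmod_sq)
  then have "\<sigma> * cnj \<sigma> = B X * cnj (B X)" "\<tau> * cnj \<tau> = B Y * cnj (B Y)" "\<sigma> * cnj \<tau> = B X * cnj (B Y)"
    unfolding tg[symmetric] by simp_all
  from same_gram_proportional[OF st this] obtain r where "r \<noteq> 0" "B X = r * \<sigma>" "B Y = r * \<tau>" by blast
  then have "proj_pt (B X) (B Y) = proj_pt \<sigma> \<tau>" using proj_pt_scale[OF st] by blast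
  then have "\<Phi> (X, Y, a, U, k) = (z, w, proj_pt \<sigma> \<tau>)"
    using U(2,3) phiU unfolding \<Phi>_def Let_def p_def q_def B_def by simp
  moreover have "(X, Y, a, U, k) \<in> \<Omega>"
    using XY a U(1) P(2,3) by (simp add: \<Omega>_def)
  ultimately show ?thesis by (metis imageI)
qed

section \<open>Two-point problems and Blaschke products\<close>

lemma relatively_compact_in_disc_iff:
  "relatively_compact_in S unit_disc \<longleftrightarrow> (\<exists>k<1. S \<subseteq> cball 0 k)"
proof
  assume S: "relatively_compact_in S unit_disc"
  show "\<exists>k<1. S \<subseteq> cball 0 k"
  proof (cases "S = {}")
    case True
    then show ?thesis by (intro exI[of _ 0]) auto
  next
    case False
    then have "closure S \<noteq> {}" using closure_subset by blast
    moreover have "continuous_on (closure S) cmod" by (intro continuous_intros)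
    ultimately obtain u where u: "u \<in> closure S" "\<And>v. v \<in> closure S \<Longrightarrow> cmod v \<le> cmod u"
      using S continuous_attains_sup[of "closure S" cmod] unfolding relatively_compact_in_def by blast
    have "cmod u < 1" using u(1) S by (auto simp: relatively_compact_in_def)
    moreover have "S \<subseteq> cball 0 (cmod u)" using u(2) closure_subset by fastforce
    ultimately show ?thesis by blast
  qed
next
  assume "\<exists>k<1. S \<subseteq> cball 0 k"
  then obtain k where k: "k < 1" "S \<subseteq> cball 0 k" by blast
  have "closure S \<subseteq> cball 0 k" using k by (intro closure_minimal) auto
  moreover have "cball 0 k \<subseteq> unit_disc" using k by auto
  ultimately show "relatively_compact_in S unit_disc"
    using bounded_subset[OF bounded_cball k(2)]
    unfolding relatively_compact_in_def compact_closure by blast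
qed

text \<open>Equality makes \<open>f\<close> a rotation, which is onto. Surjectivity is the form
  needed later, because it contradicts a bound \<open>k < 1\<close> on the values of a
  function.\<close>

lemma Schwarz_equality_surj:
  assumes "f holomorphic_on ball 0 1" "f 0 = 0" "\<And>t. cmod t < 1 \<Longrightarrow> cmod (f t) < 1"
    and "cmod t < 1" "t \<noteq> 0" "cmod (f t) = cmod t" "cmod v < 1"
  obtains s where "cmod s < 1" "f s = v"
proof -
  obtain \<alpha> where \<alpha>: "\<And>z. cmod z < 1 \<Longrightarrow> f z = \<alpha> * z" "cmod \<alpha> = 1"
    using Schwarz_Lemma(3)[OF assms(1-4)] assms(4-6) by blast
  have "\<alpha> \<noteq> 0" using \<alpha>(2) by auto
  then show thesis
    using that[of "v / \<alpha>"] \<alpha> assms(7) by (simp add: norm_divide)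
qed

lemma two_point_strict:
  assumes F: "holomorphic2_on F ball2" "F ` ball2 \<subseteq> cball 0 k" "k < 1"
    and p: "norm p < 1" "norm q < 1" "p \<noteq> q"
  shows "cmod (mob (F p) (F q)) < norm (chi_aut p q)"
proof -
  have Fk: "cmod (F u) \<le> k" if "norm u < 1" for u using F(2) that by (auto simp: image_subset_iff)
  then have F1: "cmod (F u) < 1" if "norm u < 1" for u using F(3) that by fastforce
  define v where "v = chi_aut p q"
  define r where "r = norm v"
  have v0: "v \<noteq> 0"
  proof
    assume "v = 0"
    then have "q = chi_aut p 0" using chi_aut_chi_aut[OF p(1,2)] by (simp add: v_def)
    then show False using p(3) by simp
  qed
  have r: "0 < r" "r < 1" using v0 norm_chi_aut_less_1[OF p(1,2)] by (auto simp: r_def v_def)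
  \<comment> \<open>The geodesic disc through the two nodes, with \<open>D 0 = p\<close> and
    \<open>D r = q\<close>.\<close>
  define D where "D t = chi_aut p ((t / of_real r) *s v)" for t
  have nt: "norm ((t / complex_of_real r) *s v) = cmod t" for t
  proof -
    have "(norm ((t / complex_of_real r) *s v))^2 = cmod2 t"
    proof -
      have "complex_of_real ((norm ((t / complex_of_real r) *s v))^2) = of_real (cmod2 t)"
        unfolding cdot_self[symmetric] cdot_linear using r
        by (simp add: cdot_self r_def of_real_cmod_sq mult.commute) (simp add: power2_eq_square)
      then show ?thesis by (simp only: of_real_eq_iff)
    qed
    then show ?thesis by (simp add: power2_eq_iff_nonneg)
  qed
  have D1: "norm (D t) < 1" if "cmod t < 1" for t
    unfolding D_def using norm_chi_aut_less_1 p(1) nt that by metis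
  have Dh: "(\<lambda>t. D t $ i) holomorphic_on ball 0 1" for i
  proof -
    have "1 - cdot ((t / complex_of_real r) *s v) p \<noteq> 0" if "t \<in> ball 0 1" for t
      using cmod_cdot_less_1[of "(t / complex_of_real r) *s v" p] nt[of t] that p(1) one_minus_neq_0 by auto
    then show ?thesis
      unfolding D_def chi_aut_nth unfolding cdot_linear divide_inverse
      by (simp add: ac_simps) (intro holomorphic_intros; simp add: ac_simps)
  qed
  define g where "g t = mob (F p) (F (D t))" for t
  have gh: "g holomorphic_on ball 0 1"
  proof -
    have "(\<lambda>t. F (D t)) holomorphic_on ball 0 1"
      by (rule holomorphic_on_disc[OF F(1) Dh]) (auto intro: D1)
    moreover have "(\<lambda>t. F (D t)) ` ball 0 1 \<subseteq> ball 0 1" using F1 D1 by auto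
    ultimately have "(mob (F p) \<circ> (\<lambda>t. F (D t))) holomorphic_on ball 0 1"
      using mob_holomorphic[OF F1[OF p(1)]] holomorphic_on_compose_gen by blast
    then show ?thesis by (simp add: g_def[abs_def] o_def)
  qed
  have D0: "D 0 = p" by (simp add: D_def)
  have g0: "g 0 = 0" by (simp add: g_def D0)
  have g1: "cmod (g t) < 1" if "cmod t < 1" for t
    unfolding g_def using cmod_mob_less_1 F1 D1 p(1) that by blast
  have Dr: "D (of_real r) = q"
    unfolding D_def using r chi_aut_chi_aut[OF p(1,2)] by (simp add: v_def)
  have rr: "cmod (of_real r) < 1" using r by simp
  have le: "cmod (g (of_real r)) \<le> r"
    using Schwarz_Lemma(1)[OF gh g0 g1 rr] r by simp
  have "cmod (g (of_real r)) \<noteq> r"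
  proof
    assume eq: "cmod (g (of_real r)) = r"
    \<comment> \<open>A point of the disc that \<open>F\<close> cannot attain; surjectivity of
      \<open>g\<close> would make it a value.\<close>
    obtain u :: real where u: "max 0 k < u" "u < 1" using F(3) dense[of "max 0 k" 1] by auto
    have u1: "cmod (of_real u) < 1" using u by simp
    obtain s where s: "cmod s < 1" "g s = mob (F p) (of_real u)"
      using Schwarz_equality_surj[OF gh g0 g1 rr _ _ cmod_mob_less_1[OF F1[OF p(1)] u1]] eq r by auto
    have "F (D s) = of_real u"
      using arg_cong[OF s(2), of "mob (F p)"] mob_mob[OF F1[OF p(1)]] F1[OF D1[OF s(1)]] u1
      unfolding g_def by (simp add: less_imp_le)
    then show False using Fk[OF D1[OF s(1)]] u by simp
  qed
  then have "cmod (g (of_real r)) < r" using le by simp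
  then show ?thesis unfolding g_def Dr by (simp add: r_def v_def)
qed

text \<open>After moving \<open>p\<close> to 0, a multiple of the linear functional in the direction
  \<open>v\<close> interpolates, and the strict inequality keeps its modulus at most
  \<open>k < 1\<close>.\<close>

lemma two_point_solution:
  assumes p: "norm p < 1" "norm q < 1" and l: "cmod \<eta> < 1" "cmod \<mu> < 1"
    and lt: "cmod (mob \<eta> \<mu>) < norm (chi_aut p q)"
  shows "\<not> pick_extremal [(p, \<eta>), (q, \<mu>)]"
proof -
  define v where "v = chi_aut p q"
  define \<kappa> where "\<kappa> = mob \<eta> \<mu> / cdot v v"
  have v0: "v \<noteq> 0" using lt by (auto simp: v_def)
  define k where "k = cmod (mob \<eta> \<mu>) / norm v"
  have k1: "k < 1" "0 \<le> k" using lt v0 by (simp_all add: k_def v_def)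
  have b: "cmod (\<kappa> * cdot (chi_aut p u) v) \<le> k" if "norm u < 1" for u
  proof -
    have "cmod (cdot (chi_aut p u) v) \<le> 1 * norm v"
      using cmod_cdot_le[of "chi_aut p u" v] norm_chi_aut_less_1[OF p(1) that]
      by (meson less_imp_le mult_right_mono norm_ge_zero order_trans)
    then have "cmod (\<kappa> * cdot (chi_aut p u) v) \<le> cmod \<kappa> * norm v"
      unfolding norm_mult by (intro mult_left_mono) auto
    also have "\<dots> = k"
      using v0 by (simp add: \<kappa>_def k_def norm_divide cdot_self norm_mult power2_eq_square)
    finally show ?thesis .
  qed
  define L where "L v' = \<kappa> * cdot v' v" for v'
  define F where "F u = mob \<eta> (L (chi_aut p u))" for u
  have L1: "cmod (L u) < 1" if "norm u < 1" for u
    using b[OF norm_chi_aut_less_1[OF p(1) that]] chi_aut_chi_aut[OF p(1) that] k1 by (simp add: L_def)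
  have "holomorphic2_on L ball2"
    unfolding L_def by (intro holomorphic2_mult holomorphic2_const holomorphic2_cdot)
  moreover have "L ` ball2 \<subseteq> unit_disc" using L1 by auto
  ultimately have hF: "holomorphic2_on F ball2" and F1: "F ` ball2 \<subseteq> unit_disc"
    using holomorphic2_mob_chi_aut[OF _ _ p(1) l(1)] by (simp_all add: F_def[abs_def])
  have Fp: "F p = \<eta>" by (simp add: F_def L_def)
  have "cdot v v \<noteq> 0" using v0 by (simp add: cdot_self)
  then have Fq: "F q = \<mu>" using mob_mob[OF l(1)] l(2) by (simp add: F_def L_def \<kappa>_def v_def[symmetric] less_imp_le)
  have sol: "pick_solution F [(p, \<eta>), (q, \<mu>)]"
    using hF F1 Fp Fq by (auto simp: pick_solution_def)
  have "relatively_compact_in (F ` ball2) unit_disc"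
  proof -
    have c: "cball 0 k \<subseteq> ball (0::complex) 1" using k1 by auto
    then have "compact (mob \<eta> ` cball 0 k)"
      using holomorphic_on_imp_continuous_on[OF mob_holomorphic[OF l(1)]]
      by (intro compact_continuous_image) (auto intro: continuous_on_subset)
    moreover have sub: "F ` ball2 \<subseteq> mob \<eta> ` cball 0 k"
      unfolding F_def L_def using b by auto
    moreover have "mob \<eta> ` cball 0 k \<subseteq> unit_disc"
      using c cmod_mob_less_1[OF l(1)] by auto
    moreover have "closure (F ` ball2) \<subseteq> mob \<eta> ` cball 0 k"
      using calculation by (intro closure_minimal compact_imp_closed)
    moreover have "compact (closure (F ` ball2))"
      using calculation by (metis bounded_subset compact_closure compact_imp_bounded)
    ultimately show ?thesis unfolding relatively_compact_in_def by blast
  qed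
  then show ?thesis using sol by (auto simp: pick_extremal_def)
qed

lemma not_extremal_two_point_strict:
  assumes "pick_solvable [(p, \<eta>), (q, \<mu>)]" "\<not> pick_extremal [(p, \<eta>), (q, \<mu>)]"
  shows "cmod (mob \<eta> \<mu>) < norm (chi_aut p q)"
proof -
  obtain F where F: "pick_solution F [(p, \<eta>), (q, \<mu>)]" "relatively_compact_in (F ` ball2) unit_disc"
    using assms by (auto simp: pick_extremal_def)
  then obtain k where k: "k < 1" "F ` ball2 \<subseteq> cball 0 k"
    using relatively_compact_in_disc_iff by blast
  have "holomorphic2_on F ball2" "F p = \<eta>" "F q = \<mu>" using F(1) by (auto simp: pick_solution_def)
  moreover have "norm p < 1" "norm q < 1" "p \<noteq> q"
    using assms(1) by (auto simp: pick_solvable_def pick_problem_def)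
  ultimately show ?thesis using two_point_strict k by blast
qed

text \<open>Compared through \<open>1 - cmod2\<close>, where the unimodular factor relating the two
  sides does not appear.\<close>

lemma cmod_mob_mob:
  assumes "cmod \<gamma> < 1" "cmod x < 1" "cmod y < 1"
  shows "cmod (mob (mob \<gamma> y) (mob \<gamma> x)) = cmod (mob y x)"
proof -
  have m: "cmod (mob \<gamma> x) < 1" "cmod (mob \<gamma> y) < 1" using cmod_mob_less_1 assms by auto
  have n: "1 - cnj \<gamma> * x \<noteq> 0" "1 - cnj \<gamma> * y \<noteq> 0" "1 - \<gamma> * cnj x \<noteq> 0" "1 - \<gamma> * cnj y \<noteq> 0"
    using one_minus_cnj_neq_0[OF assms(1)] assms by (auto simp: less_imp_le)
  have e: "cmod (1 - cnj \<gamma> * y) = cmod (1 - \<gamma> * cnj y)"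
    using complex_mod_cnj[of "1 - \<gamma> * cnj y"] by simp
  have g: "cmod (1 - \<gamma> * cnj \<gamma>) = 1 - cmod2 \<gamma>"
  proof -
    have "1 - \<gamma> * cnj \<gamma> = of_real (1 - cmod2 \<gamma>)" by (simp add: of_real_cmod_sq)
    then have "cmod (1 - \<gamma> * cnj \<gamma>) = \<bar>1 - cmod2 \<gamma>\<bar>" by (simp only: norm_of_real)
    then show ?thesis using assms(1) by (simp add: abs_square_le_1 less_imp_le)
  qed
  have gp: "1 - cmod2 \<gamma> > 0" using assms(1) by (simp add: abs_square_less_1)
  have alg: "g * q / B^2 * (g * p / A^2) / (g^2 * N^2 / (B^2 * A^2)) = q * p / N^2"
    if "g \<noteq> 0" "A \<noteq> 0" "B \<noteq> 0" for g p q A B N :: real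
    using that by (simp add: power2_eq_square)
  have "1 - cmod2 (mob (mob \<gamma> y) (mob \<gamma> x)) = 1 - cmod2 (mob y x)"
    unfolding cmod_mob_sq[OF m(2) less_imp_le[OF m(1)]]
      cmod_mob_sq[OF assms(3) less_imp_le[OF assms(2)]]
      cmod_mob_sq[OF assms(1) less_imp_le[OF assms(2)]]
      cmod_mob_sq[OF assms(1) less_imp_le[OF assms(3)]]
      one_minus_mob_cnj_mob[OF assms(1) less_imp_le[OF assms(3)] less_imp_le[OF assms(2)]]
      norm_divide norm_mult power_divide power_mult_distrib e g
    by (rule alg) (use n gp in auto)
  then show ?thesis by (simp add: power2_eq_iff_nonneg)
qed

text \<open>One Schur step: dividing by the variable leaves equality in Schwarz-Pick at
  \<open>x\<close>, \<open>y\<close>, which forces the quotient \<open>h\<close> onto the whole disc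
  although it is bounded by \<open>k' < 1\<close>.\<close>

lemma blaschke_extremal:
  assumes f: "f holomorphic_on ball 0 1" "\<And>t. cmod t < 1 \<Longrightarrow> cmod (f t) \<le> k" "k < 1"
    and xy: "cmod x < 1" "cmod y < 1" "x \<noteq> 0" "y \<noteq> 0" "x \<noteq> y" and \<gamma>: "cmod \<gamma> < 1"
    and v: "f 0 = 0" "f x = x * mob \<gamma> x" "f y = y * mob \<gamma> y"
  shows False
proof -
  obtain h where h: "h holomorphic_on ball 0 1" "\<And>z. cmod z < 1 \<Longrightarrow> f z = z * h z" "deriv f 0 = h 0"
    using Schwarz3[OF f(1) v(1)] by blast
  have k0: "0 \<le> k" using f(2)[of 0] v(1) by simp
  \<comment> \<open>A bound strictly between \<open>k\<close> and 1 is positive even if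
    \<open>k = 0\<close> and makes \<open>f / k'\<close> a map into the open disc.\<close>
  define k' where "k' = (k + 1) / 2"
  have k': "0 < k'" "k' < 1" "k < k'" using k0 f(3) by (auto simp: k'_def)
  have hk: "cmod (h t) \<le> k'" if t: "cmod t < 1" for t
  proof -
    define F where "F t = f t / of_real k'" for t
    have Fh: "F holomorphic_on ball 0 1" unfolding F_def using f(1) k' by (intro holomorphic_intros) auto
    have F0: "F 0 = 0" by (simp add: F_def v)
    have F1: "cmod (F t) < 1" if "cmod t < 1" for t
      using f(2)[OF that] k' by (simp add: F_def norm_divide)
    show ?thesis
    proof (cases "t = 0")
      case True
      have "f field_differentiable (at 0)" using f(1) by (simp add: holomorphic_on_imp_differentiable_at)
      then have "deriv F 0 = deriv f 0 / of_real k'"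
        unfolding F_def by (rule deriv_cdivide_right)
      moreover have "cmod (deriv F 0) \<le> 1" by (rule Schwarz_Lemma(2)[OF Fh F0 F1 t])
      moreover from calculation have "h 0 = of_real k' * deriv F 0" using h(3) k' by simp
      then have "cmod (h 0) = k' * cmod (deriv F 0)" using k' by (simp only: norm_mult norm_of_real)
      ultimately show ?thesis using True k' by (simp only: mult_left_le)
    next
      case False
      have "cmod (F t) \<le> cmod t" by (rule Schwarz_Lemma(1)[OF Fh F0 F1 t])
      then have "cmod (f t) \<le> k' * cmod t" using k' by (simp add: F_def norm_divide field_simps)
      then show ?thesis using h(2)[OF t] False by (simp add: norm_mult)
    qed
  qed
  then have h1: "cmod (h t) < 1" if "cmod t < 1" for t using that k' by fastforce
  have hx: "h x = mob \<gamma> x" "h y = mob \<gamma> y" using h(2) v xy by auto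
  define H where "H t = mob (h y) (h (mob y t))" for t
  have m1: "cmod (mob y t) < 1" if "cmod t < 1" for t using cmod_mob_less_1 xy that by blast
  have "((mob (h y) \<circ> h) \<circ> mob y) holomorphic_on ball 0 1"
    by (intro holomorphic_on_compose_gen[of _ "ball 0 1" _ "ball 0 1"] holomorphic_on_compose_gen[of h "ball 0 1" _ "ball 0 1"]
        mob_holomorphic h(1) xy h1) (auto intro: m1 h1 xy)
  then have Hh: "H holomorphic_on ball 0 1" by (simp add: H_def[abs_def] o_def)
  have H0: "H 0 = 0" by (simp add: H_def)
  have H1: "cmod (H t) < 1" if "cmod t < 1" for t
    unfolding H_def using cmod_mob_less_1[OF h1[OF xy(2)] h1[OF m1[OF that]]] .
  define t where "t = mob y x"
  have t1: "cmod t < 1" using m1 xy by (simp add: t_def)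
  have mt: "mob y t = x" using mob_mob xy by (simp add: t_def less_imp_le)
  have t0: "t \<noteq> 0" using mt xy by auto
  have Ht: "cmod (H t) = cmod t"
    unfolding H_def mt hx using cmod_mob_mob[OF \<gamma> xy(1,2)] by (simp add: t_def)
  obtain u :: real where u: "k' < u" "u < 1" using k' dense by blast
  have u1: "cmod (of_real u) < 1" using u k' by simp
  obtain s where s: "cmod s < 1" "H s = mob (h y) (of_real u)"
    using Schwarz_equality_surj[OF Hh H0 H1 t1 t0 Ht cmod_mob_less_1[OF h1[OF xy(2)] u1]] by blast
  have "h (mob y s) = of_real u"
    using arg_cong[OF s(2), of "mob (h y)"] mob_mob[OF h1[OF xy(2)]] h1[OF m1[OF s(1)]] u1
    unfolding H_def by (simp add: less_imp_le)
  then show False using hk[OF m1[OF s(1)]] u k' by simp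
qed

section \<open>Problems on the curves are extremal and non-degenerate\<close>

lemma norm_chi_aut_chi_aut:
  assumes w: "norm w < 1" and p: "norm p < 1" and q: "norm q < 1"
  shows "norm (chi_aut (chi_aut w p) (chi_aut w q)) = norm (chi_aut p q)"
proof -
  have m: "norm (chi_aut w p) < 1" "norm (chi_aut w q) < 1" using norm_chi_aut_less_1 assms by auto
  have n: "1 - cdot w p \<noteq> 0" "1 - cdot w q \<noteq> 0" "1 - cdot p w \<noteq> 0"
    using assms cmod_cdot_less_1 one_minus_neq_0 by blast+
  have e: "cmod (1 - cdot p w) = cmod (1 - cdot w p)"
    using complex_mod_cnj[of "1 - cdot p w"] by (simp add: cnj_cdot)
  have g: "cmod (1 - cdot w w) = 1 - (norm w)^2"
  proof -
    have "1 - cdot w w = of_real (1 - (norm w)^2)" by (simp add: cdot_self)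
    then have "cmod (1 - cdot w w) = \<bar>1 - (norm w)^2\<bar>" by (simp only: norm_of_real)
    then show ?thesis using w by (simp add: abs_square_le_1 less_imp_le)
  qed
  have gp: "1 - (norm w)^2 > 0" using w by (simp add: abs_square_less_1)
  have alg: "g * a / A^2 * (g * b / B^2) / (g^2 * N^2 / (A^2 * B^2)) = a * b / N^2"
    if "g \<noteq> 0" "A \<noteq> 0" "B \<noteq> 0" for g a b A B N :: real
    using that by (simp add: power2_eq_square)
  have "1 - (norm (chi_aut (chi_aut w p) (chi_aut w q)))^2 = 1 - (norm (chi_aut p q))^2"
    unfolding norm_chi_aut_sq[OF m] norm_chi_aut_sq[OF p q]
      norm_chi_aut_sq[OF w p] norm_chi_aut_sq[OF w q]
      one_minus_cdot_chi_aut[OF w p q] norm_divide norm_mult power_divide power_mult_distrib e g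
    by (rule alg) (use n gp in auto)
  then show ?thesis by (simp add: power2_eq_iff_nonneg)
qed

text \<open>Both squared distances equal 1 minus a common positive factor times \<open>R b\<close>,
  with \<open>b = \<beta>\<close> on the curve and \<open>b = 1\<close> for the squares;
  \<open>\<beta> < 1\<close> makes the squares strictly closer.\<close>

lemma curve_two_point_strict:
  assumes U: "U \<in> U2" "0 < a" "a < 1" and \<mu>: "cmod \<mu> < 1" "cmod \<nu> < 1" "\<mu> \<noteq> \<nu>"
  shows "cmod (mob (\<mu>^2) (\<nu>^2)) < norm (chi_aut (curve a U \<mu>) (curve a U \<nu>))"
proof -
  define \<beta> where "\<beta> = 1 - a^2"
  have \<beta>: "0 < \<beta>" "\<beta> < 1" using U by (auto simp: \<beta>_def abs_square_less_1)
  define \<xi> where "\<xi> = \<mu> * cnj \<nu>"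
  have \<xi>1: "cmod \<xi> < 1" using mult_cnj_less_1 \<mu> by (simp add: \<xi>_def)
  define m n where "m = cmod2 \<mu>" and "n = cmod2 \<nu>"
  have mn: "0 \<le> m" "m < 1" "0 \<le> n" "n < 1" using \<mu> by (auto simp: m_def n_def abs_square_less_1)
  have \<xi>2: "cmod2 \<xi> = m * n" by (simp add: \<xi>_def m_def n_def norm_mult power_mult_distrib)
  have mu2: "cmod (\<mu>^2) < 1" "cmod (\<nu>^2) < 1" using \<mu> by (auto simp: norm_power abs_square_less_1)
  have nz: "0 < cmod2 (1 + of_real b * \<xi>)" if "0 \<le> b" "b \<le> 1" for b
  proof -
    have "cmod (of_real b * \<xi>) < 1"
      using that \<xi>1 mult_left_le_one_le[of "cmod \<xi>" b] by (simp add: norm_mult)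
    then have "1 + of_real b * \<xi> \<noteq> 0" using one_minus_neq_0[of "- (of_real b * \<xi>)"] by simp
    then show ?thesis by simp
  qed
  have nz1: "0 < cmod2 (1 - \<xi>)" using \<xi>1 by auto
  define R where "R b = (1 + b * m) * (1 + b * n) / cmod2 (1 + of_real b * \<xi>)" for b
  have dif: "cmod2 (\<mu> - \<nu>) > 0" using \<mu> by simp
  have Rb: "R b = 1 + b * cmod2 (\<mu> - \<nu>) / cmod2 (1 + of_real b * \<xi>)" if "0 \<le> b" "b \<le> 1" for b
  proof -
    have "(1 + b * m) * (1 + b * n) = cmod2 (1 + of_real b * \<xi>) + b * cmod2 (\<mu> - \<nu>)"
      unfolding m_def n_def \<xi>_def cmod_power2 by (simp add: power2_eq_square algebra_simps)
    then show ?thesis using nz[OF that] unfolding R_def by (simp add: add_divide_distrib)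
  qed
  have "\<beta> * cmod2 (1 + \<xi>) < cmod2 (1 + of_real \<beta> * \<xi>)"
  proof -
    have "cmod2 (1 + of_real \<beta> * \<xi>) - \<beta> * cmod2 (1 + \<xi>) = (1 - \<beta>) * (1 - \<beta> * cmod2 \<xi>)"
      unfolding cmod_power2 by (simp add: power2_eq_square algebra_simps)
    moreover have "\<beta> * cmod2 \<xi> < 1"
      using \<beta> \<xi>1 mult_strict_mono'[of \<beta> 1 "cmod2 \<xi>" 1] by (simp add: abs_square_less_1)
    then have "0 < (1 - \<beta>) * (1 - \<beta> * cmod2 \<xi>)" using \<beta> by simp
    ultimately show ?thesis by linarith
  qed
  then have "\<beta> / cmod2 (1 + of_real \<beta> * \<xi>) < 1 / cmod2 (1 + \<xi>)"
    using nz[of 1] nz[of \<beta>] \<beta> by (simp add: divide_simps mult.commute)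
  then have "cmod2 (\<mu> - \<nu>) * (\<beta> / cmod2 (1 + of_real \<beta> * \<xi>)) < cmod2 (\<mu> - \<nu>) * (1 / cmod2 (1 + \<xi>))"
    using dif by (intro mult_strict_left_mono)
  then have RR: "R \<beta> < R 1"
    using Rb[of \<beta>] Rb[of 1] \<beta> by (simp add: mult.commute)
  have c1: "1 - (norm (chi_aut (curve a U \<mu>) (curve a U \<nu>)))^2 = (1 - m) * (1 - n) / cmod2 (1 - \<xi>) * R \<beta>"
    unfolding norm_chi_aut_sq[OF norm_curve_less_1[OF U \<mu>(1)] norm_curve_less_1[OF U \<mu>(2)]]
      norm_curve_sq[OF U] one_minus_cdot_curve[OF U] \<beta>_def[symmetric] norm_mult power_mult_distrib R_def
      m_def n_def \<xi>_def
    by (simp add: mult_ac)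
  have c2: "1 - cmod2 (mob (\<mu>^2) (\<nu>^2)) = (1 - m) * (1 - n) / cmod2 (1 - \<xi>) * R 1"
  proof -
    have "1 - \<mu>^2 * cnj (\<nu>^2) = (1 - \<xi>) * (1 + \<xi>)" by (simp add: \<xi>_def algebra_simps power2_eq_square)
    then have "cmod2 (1 - \<mu>^2 * cnj (\<nu>^2)) = cmod2 (1 - \<xi>) * cmod2 (1 + \<xi>)"
      by (simp add: norm_mult power_mult_distrib)
    moreover have "1 - cmod2 (\<mu>^2) = (1 - m) * (1 + m)" "1 - cmod2 (\<nu>^2) = (1 - n) * (1 + n)"
      by (simp_all add: m_def n_def norm_mult algebra_simps power2_eq_square)
    ultimately show ?thesis
      unfolding cmod_mob_sq[OF mu2(1) less_imp_le[OF mu2(2)]] R_def by (simp add: mult_ac)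
  qed
  have "(1 - m) * (1 - n) / cmod2 (1 - \<xi>) * R \<beta> < (1 - m) * (1 - n) / cmod2 (1 - \<xi>) * R 1"
    using RR mn nz1 by (intro mult_strict_left_mono) auto
  then have "cmod2 (mob (\<mu>^2) (\<nu>^2)) < (norm (chi_aut (curve a U \<mu>) (curve a U \<nu>)))^2"
    using c1 c2 by linarith
  then show ?thesis by (rule power2_less_imp_less) simp
qed

lemma curve_left_inverse:
  assumes U: "U \<in> U2" and a: "0 < a" "a < 1"
  obtains F where "holomorphic2_on F ball2" "F ` ball2 \<subseteq> unit_disc" "\<And>\<mu>. F (curve a U \<mu>) = \<mu>^2"
proof -
  define b where "b = sqrt (1 - a^2)"
  have b: "0 < b" "b^2 = 1 - a^2" using a by (auto simp: b_def abs_square_less_1 abs_square_le_1)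
  define V where "V = conj_transpose U"
  have V: "V \<in> U2" "V ** U = mat 1" using U conj_transpose_U2 by (auto simp: V_def U2_def)
  define F where "F p = ((V *v p) $ 1 * (V *v p) $ 1 + 2 * of_real b * (V *v p) $ 2) / of_real (1 + b^2)" for p
  have bp: "0 < 1 + b^2" by (simp add: add_pos_nonneg)
  then have bc: "complex_of_real (1 + b^2) \<noteq> 0" by (simp only: of_real_eq_0_iff)
  have "holomorphic2_on F ball2"
    unfolding F_def[abs_def] matrix_vector_mult_def vec_lambda_beta sum_2
    by (intro holomorphic2_divide holomorphic2_add holomorphic2_mult holomorphic2_const holomorphic2_nth bc)
  moreover have "F ` ball2 \<subseteq> unit_disc"
  proof
    fix y assume "y \<in> F ` ball2"
    then obtain p where p: "norm p < 1" "y = F p" by auto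
    define s t where "s = cmod ((V *v p) $ 1)" and "t = cmod ((V *v p) $ 2)"
    have "norm (V *v p) < 1" using p norm_unitary[OF V(1)] by simp
    then have "(norm (V *v p))^2 < 1" by (simp add: abs_square_less_1)
    then have st: "s^2 + t^2 < 1" by (simp add: norm_vec_def L2_set_def sum_2 s_def t_def)
    have "cmod ((V *v p) $ 1 * (V *v p) $ 1 + 2 * of_real b * (V *v p) $ 2) \<le> s^2 + 2 * b * t"
      using b norm_triangle_ineq[of "(V *v p) $ 1 * (V *v p) $ 1" "2 * of_real b * (V *v p) $ 2"]
      by (simp add: norm_mult s_def t_def power2_eq_square)
    \<comment> \<open>\<open>s^2 + 2 * b * t = s^2 + t^2 + b^2 - (t - b)^2\<close>; this dictates
      the constants in \<open>F\<close>.\<close>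
    also have "\<dots> < 1 + b^2"
      using st zero_le_power2[of "t - b"] by (simp add: power2_diff algebra_simps)
    finally have "cmod (F p) < 1"
      using bp unfolding F_def norm_divide norm_of_real by simp
    then show "y \<in> unit_disc" using p by simp
  qed
  moreover have "F (curve a U \<mu>) = \<mu>^2" for \<mu>
  proof -
    have Vc: "V *v curve a U \<mu> = vector [of_real a * \<mu>, of_real b * \<mu>^2]"
      by (simp add: curve_def matrix_vector_mul_assoc V b_def)
    have "a * a + 2 * b * b = 1 + b^2" using b(2) by (simp add: power2_eq_square)
    then have "complex_of_real (a * a + 2 * b * b) = of_real (1 + b^2)" by (rule arg_cong)
    then have e: "of_real a * of_real a + 2 * of_real b * of_real b = complex_of_real (1 + b^2)" by simp
    have "of_real (1 + b^2) * \<mu>^2 = (of_real a * \<mu>) * (of_real a * \<mu>) + 2 * of_real b * (of_real b * \<mu>^2)"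
      unfolding e[symmetric] by (simp add: algebra_simps power2_eq_square)
    then show ?thesis unfolding F_def Vc using bc by (simp add: divide_eq_eq mult.commute del: of_real_add)
  qed
  ultimately show thesis using that by blast
qed

lemma Phi_in_A_minus_C:
  assumes "(x, y, a, U, c) \<in> \<Omega>"
  shows "\<Phi> (x, y, a, U, c) \<in> \<A> - \<C>"
proof -
  have xy: "cmod x < 1" "cmod y < 1" "x \<noteq> 0" "y \<noteq> 0" "x \<noteq> y" and U: "U \<in> U2" "0 < a" "a < 1"
    and c: "\<bar>c\<bar> < 1" using assms by (auto simp: \<Omega>_def)
  define \<beta> where "\<beta> = 1 - a^2"
  have \<beta>: "0 < \<beta>" "\<beta> < 1" using U by (auto simp: \<beta>_def abs_square_less_1)
  define C where "C = complex_of_real c"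
  have C1: "cmod C < 1" using c by (simp add: C_def)
  have C21: "cmod (C^2) < 1" using C1 by (simp add: norm_power abs_square_less_1)
  define \<gamma> where "\<gamma> = complex_of_real (2 * c / (1 + c^2))"
  have \<gamma>1: "cmod \<gamma> < 1"
  proof -
    have c2: "1 + c^2 > 0" by (simp add: add_pos_nonneg)
    have "0 < (1 - \<bar>c\<bar>)^2" using c by simp
    then have "2 * \<bar>c\<bar> < 1 + c^2" by (simp add: power2_eq_square algebra_simps)
    then have "\<bar>2 * c / (1 + c^2)\<bar> < 1" using c2 by (simp add: abs_mult)
    then show ?thesis unfolding \<gamma>_def norm_of_real .
  qed
  define w0 where "w0 = curve a U C"
  define \<mu> \<nu> where "\<mu> = mob C x" and "\<nu> = mob C y"
  have \<mu>1: "cmod \<mu> < 1" "cmod \<nu> < 1" using cmod_mob_less_1[OF C1] xy by (auto simp: \<mu>_def \<nu>_def)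
  have mm: "mob C \<mu> = x" "mob C \<nu> = y" using mob_mob[OF C1] xy by (auto simp: \<mu>_def \<nu>_def less_imp_le)
  have ne: "\<mu> \<noteq> \<nu>" "C \<noteq> \<mu>" "C \<noteq> \<nu>" using mm xy by auto
  define p q where "p = curve a U \<mu>" and "q = curve a U \<nu>"
  have n1: "norm w0 < 1" "norm p < 1" "norm q < 1"
    using norm_curve_less_1[OF U] C1 \<mu>1 by (auto simp: w0_def p_def q_def)
  define z w where "z = phi a U c x" and "w = phi a U c y"
  have zw: "z = chi_aut w0 p" "w = chi_aut w0 q"
    by (simp_all add: z_def w_def phi_def w0_def p_def q_def \<mu>_def \<nu>_def C_def)
  have zw1: "norm z < 1" "norm w < 1" unfolding zw using norm_chi_aut_less_1 n1 by auto
  define \<sigma> \<tau> where "\<sigma> = x * mob \<gamma> x" and "\<tau> = y * mob \<gamma> y"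
  have st: "\<sigma> = mob (C^2) (\<mu>^2)" "\<tau> = mob (C^2) (\<nu>^2)"
    unfolding \<sigma>_def \<tau>_def \<gamma>_def \<mu>_def \<nu>_def C_def target_identity[OF c xy(1)] target_identity[OF c xy(2)] by simp_all
  have mu2: "cmod (\<mu>^2) < 1" "cmod (\<nu>^2) < 1" using \<mu>1 by (auto simp: norm_power abs_square_less_1)
  have st1: "cmod \<sigma> < 1" "cmod \<tau> < 1" unfolding st using cmod_mob_less_1 C21 mu2 by auto
  have st0: "(\<sigma>, \<tau>) \<noteq> (0, 0)"
  proof
    assume "(\<sigma>, \<tau>) = (0, 0)"
    then have "mob \<gamma> x = 0" "mob \<gamma> y = 0" using xy by (auto simp: \<sigma>_def \<tau>_def)
    then have "mob \<gamma> (mob \<gamma> x) = mob \<gamma> (mob \<gamma> y)" by simp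
    then show False using mob_mob[OF \<gamma>1] xy by (simp add: less_imp_le)
  qed
  have nc: "cmod2 (cdot z w) < (norm z)^2 * (norm w)^2"
  proof -
    define k where "k = sqrt \<beta> * (1 - c^2)"
    have c2: "c^2 < 1" using c by (simp add: abs_square_less_1)
    have k: "0 < k" "k^2 = \<beta> * (1 - c^2)^2" using \<beta> c2 by (auto simp: k_def power_mult_distrib)
    \<comment> \<open>The coefficients of the affine function that equals
      \<open>t / defect \<beta> c t\<close> off 0. As \<open>e^2 - f^2 - 1\<close> is a positive
      multiple of \<open>1 - \<beta>\<close>, independence of the nodes comes from
      \<open>\<beta> < 1\<close>.\<close>
    define e f where "e = (1 + \<beta> * c^2) / k" and "f = - (c * (1 + \<beta>)) / k"
    define h1 h2 where "h1 = defect \<beta> c x" and "h2 = defect \<beta> c y"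
    have de: "t = defect \<beta> c t * (of_real e + of_real f * t)" if "cmod t < 1" for t
    proof -
      have d: "of_real (1 + \<beta> * c^2) - of_real (c * (1 + \<beta>)) * t \<noteq> 0"
        using defect_denom[of \<beta> c t] \<beta> c that by simp
      have "of_real e + of_real f * t = (of_real (1 + \<beta> * c^2) - of_real (c * (1 + \<beta>)) * t) / of_real k"
        unfolding e_def f_def by (simp add: diff_divide_distrib)
      then show ?thesis unfolding defect_def k_def[symmetric] using d k(1) by simp
    qed
    note pc = phi_cdot[OF U c, folded \<beta>_def]
    have re: "cmod2 t - (norm (phi a U c t))^2 = (1 - cmod2 t) * cmod2 (defect \<beta> c t)"
      if "cmod t < 1" for t
    proof -
      have "complex_of_real (1 - (norm (phi a U c t))^2) = of_real ((1 - cmod2 t) * (1 + cmod2 (defect \<beta> c t)))"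
        using pc[OF that that] by (simp add: cdot_self of_real_cmod_sq)
      then have "1 - (norm (phi a U c t))^2 = (1 - cmod2 t) * (1 + cmod2 (defect \<beta> c t))"
        by (simp only: of_real_eq_iff)
      then show ?thesis by (simp add: algebra_simps)
    qed
    note Z = re[OF xy(1), folded z_def h1_def] and W = re[OF xy(2), folded w_def h2_def]
    have cc: "x * cnj y - cdot z w = (1 - x * cnj y) * (h1 * cnj h2)"
      using pc[OF xy(1) xy(2)] by (simp add: z_def w_def h1_def h2_def algebra_simps)
    have "(norm z)^2 * (norm w)^2 - cmod2 (cdot z w) =
        cmod2 (h1 * h2) * cmod2 (x - y) * (cmod2 (of_real e) - cmod2 (of_real f) - 1)"
      by (rule gram_det_affine[OF Z W cc]) (use de xy in \<open>auto simp: h1_def h2_def\<close>)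
    moreover have "h1 \<noteq> 0" "h2 \<noteq> 0" using de[OF xy(1)] de[OF xy(2)] xy(3,4) unfolding h1_def h2_def by auto
    moreover have "0 < e^2 - f^2 - 1"
    proof -
      have "e^2 - f^2 - 1 = ((1 + \<beta> * c^2)^2 - (c * (1 + \<beta>))^2 - k^2) / k^2"
        unfolding e_def f_def using k(1) by (simp add: power_divide diff_divide_distrib)
      also have "(1 + \<beta> * c^2)^2 - (c * (1 + \<beta>))^2 - k^2 = (1 - c^2) * ((1 - \<beta>) * (1 + \<beta> * c^2))"
        unfolding k(2) by (simp add: power2_eq_square algebra_simps)
      finally show ?thesis
        using k(1) c2 \<beta> by (simp add: add_pos_nonneg)
    qed
    ultimately have "0 < (norm z)^2 * (norm w)^2 - cmod2 (cdot z w)" using xy(5) by simp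
    then show ?thesis by simp
  qed
  have zw0: "z \<noteq> 0" "w \<noteq> 0" "z \<noteq> w"
    using nc by (auto simp: cdot_self norm_power power2_eq_square norm_mult)
  then have D2: "(z, w) \<in> D2" using zw1 by (simp add: D2_def)
  have pp: "pick_problem [(0, 0), (z, \<sigma>), (w, \<tau>)]"
    using zw0 zw1 st1 by (auto simp: pick_problem_def)
  obtain F0 where F0: "holomorphic2_on F0 ball2" "F0 ` ball2 \<subseteq> unit_disc" "\<And>\<mu>. F0 (curve a U \<mu>) = \<mu>^2"
    using curve_left_inverse[OF U] by blast
  define F where "F p = mob (C^2) (F0 (chi_aut w0 p))" for p
  have hF: "holomorphic2_on F ball2" and F1: "F ` ball2 \<subseteq> unit_disc"
    using holomorphic2_mob_chi_aut[OF F0(1,2) n1(1) C21] by (simp_all add: F_def[abs_def])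
  have Fv: "F 0 = 0" "F z = \<sigma>" "F w = \<tau>"
    using F0(3) chi_aut_chi_aut[OF n1(1)] n1 unfolding F_def zw st by (auto simp: w0_def p_def q_def)
  have sol: "pick_solution F [(0, 0), (z, \<sigma>), (w, \<tau>)]"
    using hF F1 Fv by (auto simp: pick_solution_def)
  have solv: "pick_solvable [(0, 0), (z, \<sigma>), (w, \<tau>)]" using pp sol by (auto simp: pick_solvable_def)
  have ph1: "phi a U c ` ball 0 1 \<subseteq> ball2"
    unfolding phi_def using norm_chi_aut_less_1 norm_curve_less_1[OF U] cmod_mob_less_1[OF C1] C1
    by (auto simp: C_def)
  have phh: "(\<lambda>t. phi a U c t $ i) holomorphic_on ball 0 1" for i
  proof -
    have "1 - cdot (curve a U (mob C t)) w0 \<noteq> 0" if "t \<in> ball 0 1" for t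
      using cmod_cdot_less_1[OF norm_curve_less_1[OF U] n1(1)] cmod_mob_less_1[OF C1] that one_minus_neq_0
      by (metis mem_ball_0)
    moreover have cm: "(\<lambda>t. curve a U (mob C t) $ j) holomorphic_on ball 0 1" for j
      unfolding curve_def matrix_vector_mult_def
      using mob_holomorphic[OF C1] by (simp add: sum_2) (intro holomorphic_intros)
    ultimately show ?thesis
      unfolding phi_def C_def[symmetric] w0_def[symmetric] chi_aut_nth divide_inverse[of _ "cdot w0 w0"]
      unfolding cdot_2[of _ w0]
      by (intro holomorphic_intros) (auto simp: cdot_2)
  qed
  have ph0: "phi a U c 0 = 0" by (simp add: phi_def)
  have no: False if G: "pick_solution G [(0, 0), (z, \<sigma>), (w, \<tau>)]" "relatively_compact_in (G ` ball2) unit_disc" for G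
  proof -
    obtain k where k: "k < 1" "G ` ball2 \<subseteq> cball 0 k" using G(2) relatively_compact_in_disc_iff by blast
    have hG: "holomorphic2_on G ball2" "G 0 = 0" "G z = \<sigma>" "G w = \<tau>" using G(1) by (auto simp: pick_solution_def)
    have "(\<lambda>t. G (phi a U c t)) holomorphic_on ball 0 1"
      by (rule holomorphic_on_disc[OF hG(1) phh ph1])
    moreover have "cmod (G (phi a U c t)) \<le> k" if "cmod t < 1" for t
      using k(2) ph1 that by (auto simp: image_subset_iff)
    ultimately show False
      using blaschke_extremal[of "\<lambda>t. G (phi a U c t)" k x y \<gamma>] k(1) xy \<gamma>1 hG ph0
      by (simp add: z_def w_def \<sigma>_def \<tau>_def)
  qed
  have ext: "pick_extremal [(0, 0), (z, \<sigma>), (w, \<tau>)]"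
    using solv no by (auto simp: pick_extremal_def)
  \<comment> \<open>Automorphisms preserve both pseudohyperbolic distances, so all three two-point
    problems reduce to the curve; the node 0 has parameter \<open>C\<close>.\<close>
  have sub: "cmod (mob (mob (C^2) (m^2)) (mob (C^2) (n^2))) < norm (chi_aut (chi_aut w0 (curve a U m)) (chi_aut w0 (curve a U n)))"
    if "cmod m < 1" "cmod n < 1" "m \<noteq> n" for m n
  proof -
    have "cmod (m^2) < 1" "cmod (n^2) < 1" using that by (auto simp: norm_power abs_square_less_1)
    then show ?thesis
      using curve_two_point_strict[OF U that] norm_chi_aut_chi_aut[OF n1(1)] norm_curve_less_1[OF U] that cmod_mob_mob[OF C21]
      by simp
  qed
  have w00: "chi_aut w0 (curve a U C) = 0" by (simp add: w0_def)
  have "\<not> pick_extremal [(0, 0), (z, \<sigma>)]" "\<not> pick_extremal [(0, 0), (w, \<tau>)]" "\<not> pick_extremal [(z, \<sigma>), (w, \<tau>)]"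
    using two_point_solution zw1 st1 sub[OF C1 \<mu>1(1) ne(2)] sub[OF C1 \<mu>1(2) ne(3)] sub[OF \<mu>1 ne(1)]
    unfolding st zw p_def q_def w00 by simp_all
  then have nd: "nondegenerate_extremal3 (0, 0) (z, \<sigma>) (w, \<tau>)"
    using ext by (simp add: nondegenerate_extremal3_def)
  have "extremal_scale z w \<sigma> \<tau> = 1"
    unfolding extremal_scale_def
  proof (rule the_equality)
    show "0 < (1::real) \<and> pick_extremal [(0, 0), (z, complex_of_real 1 * \<sigma>), (w, complex_of_real 1 * \<tau>)]"
      using ext by simp
    fix t assume "0 < t \<and> pick_extremal [(0, 0), (z, complex_of_real t * \<sigma>), (w, complex_of_real t * \<tau>)]"
    then show "t = 1" using extremal_scale_unique[of t z \<sigma> w \<tau> 1] ext by simp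
  qed
  then have "(z, w, proj_pt \<sigma> \<tau>) \<in> \<A>"
    unfolding \<A>_def using D2 st0 nd
    by (intro CollectI exI[of _ z] exI[of _ w] exI[of _ \<sigma>] exI[of _ \<tau>]) simp
  moreover have "(z, w, proj_pt \<sigma> \<tau>) \<notin> \<C>"
  proof
    assume "(z, w, proj_pt \<sigma> \<tau>) \<in> \<C>"
    then obtain L where L: "complex_line L" "0 \<in> L" "z \<in> L" "w \<in> L" by (auto simp: \<C>_def)
    then obtain u v where uv: "L = {u + \<zeta> *s v | \<zeta>. True}" by (auto simp: complex_line_def)
    obtain r0 where r0: "0 = u + r0 *s v" using L(2) uv by auto
    obtain r1 where r1: "z = u + r1 *s v" using L(3) uv by auto
    obtain r2 where r2: "w = u + r2 *s v" using L(4) uv by auto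
    have u: "u = - (r0 *s v)" using r0 by (simp add: eq_neg_iff_add_eq_0)
    have "z $ i = (r1 - r0) * v $ i" "w $ i = (r2 - r0) * v $ i" for i
      unfolding r1 r2 u by (simp_all add: algebra_simps)
    then have "z $ 1 * w $ 2 - z $ 2 * w $ 1 = 0" by simp
    then show False using cdot_vec_noncollinear[OF nc] by blast
  qed
  moreover have "\<Phi> (x, y, a, U, c) = (z, w, proj_pt \<sigma> \<tau>)"
    by (simp add: \<Phi>_def Let_def z_def w_def \<sigma>_def \<tau>_def \<gamma>_def)
  ultimately show ?thesis by simp
qed

section \<open>Targets passing the disc test\<close>

text \<open>The third inequality is the two-point condition for the pair of nodes other than 0, with
  denominators cleared.\<close>

definition pick_tested :: "real \<Rightarrow> real \<Rightarrow> complex \<Rightarrow> real \<Rightarrow> real \<Rightarrow> complex \<Rightarrow> bool" where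
  "pick_tested Z W c S T s \<longleftrightarrow> S \<le> Z \<and> T \<le> W \<and>
     (1 - Z) * (1 - W) * cmod2 (1 - s) \<le> (1 - S) * (1 - T) * cmod2 (1 - c) \<and>
     (\<forall>x y. cmod x < 1 \<longrightarrow> cmod y < 1 \<longrightarrow> Z < cmod2 x \<longrightarrow> W < cmod2 y \<longrightarrow>
        0 \<le> pick_det Z W c x y \<longrightarrow> 0 \<le> pick_det S T s x y)"

lemma pick_tested_swap:
  assumes "pick_tested Z W c S T s"
  shows "pick_tested W Z (cnj c) T S (cnj s)"
proof -
  have e: "cmod (1 - cnj k) = cmod (1 - k)" for k
    using complex_mod_cnj[of "1 - k"] by simp
  have "0 \<le> pick_det T S (cnj s) x y"
    if "cmod x < 1" "cmod y < 1" "W < cmod2 x" "Z < cmod2 y" "0 \<le> pick_det W Z (cnj c) x y" for x y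
    using assms that unfolding pick_tested_def pick_det_swap by blast
  then show ?thesis using assms unfolding pick_tested_def e by (simp add: mult_ac)
qed

text \<open>A positive multiple of a Schur complement in normalised Pick entries, the form in which
  the effect of a congruence is visible.\<close>

lemma pick_det_alt:
  assumes "cmod x < 1" "cmod y < 1"
  shows "pick_det Z W c x y = (1 - cmod2 x) * (1 - cmod2 y) * cmod2 (1 - x * cnj y) *
    (((1 - Z) / (1 - cmod2 x) - 1) * ((1 - W) / (1 - cmod2 y) - 1)
      - cmod2 ((1 - c) / (1 - x * cnj y) - 1))"
proof -
  have "cmod2 x < 1" "cmod2 y < 1" using assms by (simp_all add: abs_square_less_1)
  then have X1: "1 - cmod2 x \<noteq> 0" "1 - cmod2 y \<noteq> 0" by linarith+
  have n: "1 - x * cnj y \<noteq> 0" using mult_cnj_less_1[OF assms] by auto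
  have "(1 - c) / (1 - x * cnj y) - 1 = (x * cnj y - c) / (1 - x * cnj y)" using n by (simp add: field_simps)
  then have "cmod2 ((1 - c) / (1 - x * cnj y) - 1) = cmod2 (x * cnj y - c) / cmod2 (1 - x * cnj y)"
    by (simp add: norm_divide power_divide)
  moreover have "(1 - Z) / (1 - cmod2 x) - 1 = (cmod2 x - Z) / (1 - cmod2 x)"
    "(1 - W) / (1 - cmod2 y) - 1 = (cmod2 y - W) / (1 - cmod2 y)" using X1 by (simp_all add: field_simps)
  moreover have alg: "a * b * m - d * A * B = A * B * m * (a / A * (b / B) - d / m)"
    if "A \<noteq> 0" "B \<noteq> 0" "m \<noteq> 0" for a b m d A B :: real
    using that by (simp add: right_diff_distrib)
  ultimately show ?thesis
    unfolding pick_det_def using X1 n by (simp only: alg zero_eq_power2 norm_eq_zero not_False_eq_True)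
qed

text \<open>Moving the base point of the interpolation data to its first node replaces the Pick matrix
  \<open>P\<close> (normalised by a first row of ones) by a diagonal congruence of it.\<close>

lemma pick_det_base_change:
  assumes xy: "cmod x < 1" "cmod y < 1" and Z: "Z < 1" and c: "1 - c \<noteq> 0"
    and W': "1 - W' = (1 - Z) * (1 - W) / cmod2 (1 - c)" and c': "1 - c' = of_real (1 - Z) / (1 - c)"
  shows "0 \<le> pick_det Z W' c' x (mob x y) \<longleftrightarrow> 0 \<le> pick_det Z W c x y"
proof -
  define y' where "y' = mob x y"
  have y'1: "cmod y' < 1" using cmod_mob_less_1 xy by (simp add: y'_def)
  have X0: "0 < 1 - cmod2 x" "0 < 1 - cmod2 y" "0 < 1 - cmod2 y'"
    using xy y'1 by (auto simp: abs_square_less_1)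
  define N where "N = 1 - x * cnj y"
  have N0: "N \<noteq> 0" using mult_cnj_less_1[OF xy] by (auto simp: N_def)
  have Y': "1 - cmod2 y' = (1 - cmod2 x) * (1 - cmod2 y) / cmod2 N"
    unfolding y'_def N_def by (rule cmod_mob_sq) (use xy in auto)
  have N': "1 - x * cnj y' = of_real (1 - cmod2 x) / N"
    using one_minus_mob_cnj_mob[of x 0 y] xy unfolding y'_def N_def by (simp add: of_real_cmod_sq less_imp_le)
  have N'0: "1 - x * cnj y' \<noteq> 0" using mult_cnj_less_1[OF xy(1) y'1] by auto
  define P Q R where "P = (1 - Z) / (1 - cmod2 x)" and "Q = (1 - W) / (1 - cmod2 y)" and "R = (1 - c) / N"
  have P0: "0 < P" using Z X0 by (simp add: P_def)
  have R0: "R \<noteq> 0" using c N0 by (simp add: R_def)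
  have Q': "(1 - W') / (1 - cmod2 y') = P * Q / cmod2 R"
    unfolding W' Y' P_def Q_def R_def using X0 N0 c by (simp add: norm_divide power_divide)
  have R': "(1 - c') / (1 - x * cnj y') = of_real P / R"
    unfolding c' N' P_def R_def using X0 N0 c by simp
  have id: "(P - 1) * (P * Q / cmod2 R - 1) - cmod2 (of_real P / R - 1) =
      P / cmod2 R * ((P - 1) * (Q - 1) - cmod2 (R - 1))"
  proof -
    have "of_real P / R - 1 = (of_real P - R) / R" using R0 by (simp add: diff_divide_distrib)
    then have "cmod2 (of_real P / R - 1) = cmod2 (of_real P - R) / cmod2 R"
      by (simp add: norm_divide power_divide)
    moreover have "P * Q / cmod2 R - 1 = (P * Q - cmod2 R) / cmod2 R"
      using R0 by (simp add: diff_divide_distrib)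
    moreover have "(P - 1) * (P * Q - cmod2 R) - cmod2 (of_real P - R) = P * ((P - 1) * (Q - 1) - cmod2 (R - 1))"
      unfolding cmod_power2 by (simp add: power2_eq_square algebra_simps)
    ultimately show ?thesis by (simp add: diff_divide_distrib[symmetric])
  qed
  have 1: "pick_det Z W' c' x y' = (1 - cmod2 x) * (1 - cmod2 y') * cmod2 (1 - x * cnj y') *
      (P / cmod2 R * ((P - 1) * (Q - 1) - cmod2 (R - 1)))"
    unfolding pick_det_alt[OF xy(1) y'1] Q' R' P_def[symmetric] id ..
  have 2: "pick_det Z W c x y = (1 - cmod2 x) * (1 - cmod2 y) * cmod2 N *
      ((P - 1) * (Q - 1) - cmod2 (R - 1))"
    unfolding pick_det_alt[OF xy] P_def Q_def R_def N_def ..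
  have aux: "(0 \<le> k * a) = (0 \<le> a)" if "0 < k" for k a :: real
    using that by (simp add: zero_le_mult_iff)
  have k1: "0 < (1 - cmod2 x) * (1 - cmod2 y') * cmod2 (1 - x * cnj y')" using X0 N'0 by simp
  have k2: "0 < P / cmod2 R" using P0 R0 by simp
  have k3: "0 < (1 - cmod2 x) * (1 - cmod2 y) * cmod2 N" using X0 N0 by simp
  have "0 \<le> pick_det Z W' c' x y' \<longleftrightarrow> 0 \<le> (P - 1) * (Q - 1) - cmod2 (R - 1)"
    unfolding 1 aux[OF k1] aux[OF k2] ..
  moreover have "0 \<le> pick_det Z W c x y \<longleftrightarrow> 0 \<le> (P - 1) * (Q - 1) - cmod2 (R - 1)"
    unfolding 2 aux[OF k3] ..
  ultimately show ?thesis by (simp add: y'_def)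
qed

text \<open>Roles are exchanged: the two-point condition for the nodes other than 0 becomes
  \<open>T' <= W'\<close>, and \<open>T <= W\<close> becomes the third inequality. The change is an
  involution, so new admissible parameters pull back to old ones.\<close>

lemma pick_tested_base_change:
  assumes ZW: "0 < Z" "Z < 1" "0 < W" "W < 1" "cmod2 c < Z * W"
    and S: "S < 1" "1 - s \<noteq> 0"
    and W': "1 - W' = (1 - Z) * (1 - W) / cmod2 (1 - c)" and c': "1 - c' = of_real (1 - Z) / (1 - c)"
    and T': "1 - T' = (1 - S) * (1 - T) / cmod2 (1 - s)" and s': "1 - s' = of_real (1 - S) / (1 - s)"
    and t: "pick_tested Z W c S T s"
  shows "pick_tested Z W' c' S T' s'"
proof -
  have "(1 - Z) * (1 - W) < cmod2 (1 - c)" using gram_gap[OF ZW] .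
  then have c0: "1 - c \<noteq> 0" using ZW by (auto simp: mult_less_0_iff)
  have cp: "0 < cmod2 (1 - c)" "0 < cmod2 (1 - s)" using c0 S by auto
  have tt: "S \<le> Z" "T \<le> W" "(1 - Z) * (1 - W) * cmod2 (1 - s) \<le> (1 - S) * (1 - T) * cmod2 (1 - c)"
    using t by (auto simp: pick_tested_def)
  have "(1 - Z) * (1 - W) / cmod2 (1 - c) \<le> (1 - S) * (1 - T) / cmod2 (1 - s)"
    using tt(3) cp by (simp add: divide_simps mult_ac)
  then have TW: "T' \<le> W'" unfolding W'[symmetric] T'[symmetric] by simp
  have nc: "cmod (1 - c') = (1 - Z) / cmod (1 - c)" "cmod (1 - s') = (1 - S) / cmod (1 - s)"
    unfolding c' s' norm_divide norm_of_real using ZW S by auto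
  have third: "(1 - Z) * (1 - W') * cmod2 (1 - s') \<le> (1 - S) * (1 - T') * cmod2 (1 - c')"
  proof -
    define K where "K = (1 - Z)^2 * (1 - S)^2 / (cmod2 (1 - c) * cmod2 (1 - s))"
    have "0 \<le> K" by (simp add: K_def)
    then have "K * (1 - W) \<le> K * (1 - T)" using tt(2) by (intro mult_left_mono) auto
    moreover have "(1 - Z) * (1 - W') * cmod2 (1 - s') = K * (1 - W)"
      unfolding W' nc K_def power_divide by (simp add: power2_eq_square mult_ac)
    moreover have "(1 - S) * (1 - T') * cmod2 (1 - c') = K * (1 - T)"
      unfolding T' nc K_def power_divide by (simp add: power2_eq_square mult_ac)
    ultimately show ?thesis by simp
  qed
  have c'0: "1 - c' \<noteq> 0" using c' ZW c0 by (auto simp del: of_real_diff)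
  have s'0: "1 - s' \<noteq> 0" using s' S by (auto simp del: of_real_diff)
  have W1: "W' < 1"
  proof -
    have "0 < 1 - W'" unfolding W' using ZW cp by simp
    then show ?thesis by simp
  qed
  have ZW': "cmod2 c' < Z * W'"
  proof -
    have "c' = 1 - of_real (1 - Z) / (1 - c)" unfolding c'[symmetric] by simp
    also have "\<dots> = (of_real Z - c) / (1 - c)" using c0 by (simp add: field_simps)
    finally have e1: "cmod2 c' = cmod2 (of_real Z - c) / cmod2 (1 - c)" by (simp add: norm_divide power_divide)
    have e2: "W' = (cmod2 (1 - c) - (1 - Z) * (1 - W)) / cmod2 (1 - c)"
      using W' cp by (simp add: field_simps)
    have "Z * W' - cmod2 c' =
        (Z * (cmod2 (1 - c) - (1 - Z) * (1 - W)) - cmod2 (of_real Z - c)) / cmod2 (1 - c)"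
      unfolding e1 unfolding e2 times_divide_eq_right diff_divide_distrib[symmetric] ..
    also have "Z * (cmod2 (1 - c) - (1 - Z) * (1 - W)) - cmod2 (of_real Z - c) = (1 - Z) * (Z * W - cmod2 c)"
      unfolding cmod_power2 by (simp add: power2_eq_square algebra_simps)
    also have "0 < (1 - Z) * (Z * W - cmod2 c) / cmod2 (1 - c)" using ZW cp by simp
    finally show ?thesis by simp
  qed
  have W'0: "0 < W'"
  proof -
    have "0 < Z * W'" using ZW' by (smt (verit) zero_le_power2)
    then show ?thesis using ZW(1) by (simp add: zero_less_mult_iff)
  qed
  have bW: "1 - W = (1 - Z) * (1 - W') / cmod2 (1 - c')" "1 - c = of_real (1 - Z) / (1 - c')"
    "1 - T = (1 - S) * (1 - T') / cmod2 (1 - s')" "1 - s = of_real (1 - S) / (1 - s')"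
    unfolding W' T' nc unfolding c' s' using ZW S c0 by (simp_all add: power2_eq_square del: of_real_diff)
  have "0 \<le> pick_det S T' s' x y"
    if xy: "cmod x < 1" "cmod y < 1" "Z < cmod2 x" "W' < cmod2 y" and d: "0 \<le> pick_det Z W' c' x y" for x y
  proof -
    define y' where "y' = mob x y"
    have y'1: "cmod y' < 1" using cmod_mob_less_1 xy by (simp add: y'_def)
    \<comment> \<open>The strict inequality yields \<open>W < cmod2 y'\<close>, required before
      \<open>t\<close> can be applied at \<open>x\<close>, \<open>y'\<close>.\<close>
    have st: "(1 - cmod2 x) * (1 - cmod2 y) * cmod2 (1 - c')
      < (1 - Z) * (1 - W') * cmod2 (1 - x * cnj y)"
      using pick_det_nonneg_strict(4)[OF ZW(1,2) W'0 W1 ZW' xy(1,2) _ _ d] xy by simp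
    have N: "0 < cmod2 (1 - x * cnj y)" using mult_cnj_less_1[OF xy(1,2)] by auto
    have "1 - cmod2 y' = (1 - cmod2 x) * (1 - cmod2 y) / cmod2 (1 - x * cnj y)"
      unfolding y'_def by (rule cmod_mob_sq) (use xy in auto)
    also have "\<dots> < (1 - Z) * (1 - W') / cmod2 (1 - c')"
      using st N c'0 by (simp add: divide_simps mult_ac)
    finally have Wy: "W < cmod2 y'" unfolding bW(1)[symmetric] by simp
    have "0 \<le> pick_det Z W c x y'"
      unfolding y'_def using pick_det_base_change[OF xy(1,2) ZW(2) c'0 bW(1,2)] d by simp
    then have "0 \<le> pick_det S T s x y'"
      using t xy y'1 Wy unfolding pick_tested_def by blast
    then show ?thesis
      unfolding y'_def using pick_det_base_change[OF xy(1,2) S(1) s'0 bW(3,4)] by simp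
  qed
  then show ?thesis unfolding pick_tested_def using tt(1) TW third by blast
qed

text \<open>The case of equality in the first two-point inequality, normalised so that the first
  target is \<open>r\<close>. Letting \<open>cmod2 x\<close> tend to \<open>r^2\<close> and
  \<open>y\<close> to \<open>\<zeta>\<close> makes both determinants vanish to first order;
  comparing leading coefficients gives a horodisc inequality at \<open>\<zeta>\<close>.\<close>

lemma pick_tested_julia:
  fixes \<omega> \<tau> \<zeta> :: complex
  assumes r: "0 < r" "r < 1" and W: "0 < W" "W < 1" and T: "T < 1" and \<zeta>: "cmod \<zeta> = 1"
    and t: "pick_tested (r^2) W (of_real r * cnj \<omega>) (r^2) T (of_real r * cnj \<tau>)"
  shows "cmod2 (\<zeta> - \<tau>) * (1 - W) \<le> cmod2 (\<zeta> - \<omega>) * (1 - T)"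
proof (rule ccontr)
  assume "\<not> ?thesis"
  then have lt: "cmod2 (\<zeta> - \<omega>) * (1 - T) < cmod2 (\<zeta> - \<tau>) * (1 - W)" by simp
  have r2: "0 < r^2" "r^2 < 1" using r by (auto simp: abs_square_less_1)
  define Q where "Q = cmod2 (1 - of_real r * cnj \<zeta>)"
  have "cmod (of_real r * cnj \<zeta>) < 1" using r \<zeta> by (simp add: norm_mult)
  then have Q: "0 < Q" by (auto simp: Q_def)
  define K where "K = r^2 * (1 - r^2)"
  have K: "0 < K" using r2 by (simp add: K_def)
  have "K * (cmod2 (\<zeta> - \<omega>) * (1 - T)) < K * (cmod2 (\<zeta> - \<tau>) * (1 - W))" using lt K by simp
  then have "K * cmod2 (\<zeta> - \<omega>) / ((1 - W) * Q) < K * cmod2 (\<zeta> - \<tau>) / ((1 - T) * Q)"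
    using W T Q by (simp add: divide_simps mult_ac)
  \<comment> \<open>If the claim failed, some rate \<open>p\<close> would give the nodes a positive
    and the targets a negative leading coefficient.\<close>
  then obtain p where p: "K * cmod2 (\<zeta> - \<omega>) / ((1 - W) * Q) < p" "p < K * cmod2 (\<zeta> - \<tau>) / ((1 - T) * Q)"
    using dense by blast
  have p0: "0 < p" using p(1) K W Q by (smt (verit) divide_nonneg_nonneg mult_nonneg_nonneg zero_le_power2)
  \<comment> \<open>With \<open>cmod2 x - r^2 = \<epsilon> * p\<close> and
    \<open>1 - cmod2 y = \<epsilon>\<close> every term of the determinant carries the factor
    \<open>\<epsilon>\<close>; \<open>f\<close> is the cofactor.\<close>
  define X where "X \<epsilon> = r^2 + \<epsilon> * p" for \<epsilon>
  define \<xi> where "\<xi> \<epsilon> = complex_of_real (sqrt (X \<epsilon>) * sqrt (1 - \<epsilon>)) * cnj \<zeta>" for \<epsilon>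
  define f where "f V c \<epsilon> = p * (1 - \<epsilon> - V) * cmod2 (1 - \<xi> \<epsilon>) - cmod2 (\<xi> \<epsilon> - of_real r * cnj c) * (1 - X \<epsilon>)"
    for V c \<epsilon>
  have lim: "(f V c \<longlongrightarrow> p * (1 - V) * Q - K * cmod2 (\<zeta> - c)) (at_right 0)" for V c
  proof -
    have "(f V c \<longlongrightarrow> f V c 0) (at_right 0)"
      unfolding f_def[abs_def] \<xi>_def X_def by (intro tendsto_intros)
    moreover have "\<xi> 0 = of_real r * cnj \<zeta>" using r by (simp add: \<xi>_def X_def)
    moreover have "cmod2 (of_real r * cnj \<zeta> - of_real r * cnj c) = r^2 * cmod2 (\<zeta> - c)"
    proof -
      have "of_real r * cnj \<zeta> - of_real r * cnj c = of_real r * cnj (\<zeta> - c)" by (simp add: algebra_simps)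
      then show ?thesis by (simp only: norm_mult complex_mod_cnj norm_of_real power_mult_distrib power2_abs)
    qed
    ultimately show ?thesis by (simp add: f_def X_def Q_def K_def mult_ac)
  qed
  have "0 < p * (1 - W) * Q - K * cmod2 (\<zeta> - \<omega>)"
    using p(1) W Q by (simp add: divide_less_eq mult_ac)
  then have e1: "\<forall>\<^sub>F \<epsilon> in at_right 0. 0 < f W \<omega> \<epsilon>" using order_tendstoD(1)[OF lim] by blast
  have "p * (1 - T) * Q - K * cmod2 (\<zeta> - \<tau>) < 0"
    using p(2) T Q by (simp add: less_divide_eq mult_ac)
  then have e2: "\<forall>\<^sub>F \<epsilon> in at_right 0. f T \<tau> \<epsilon> < 0" using order_tendstoD(2)[OF lim] by blast
  have "(X \<longlongrightarrow> X 0) (at_right 0)" unfolding X_def by (intro tendsto_intros)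
  then have e3: "\<forall>\<^sub>F \<epsilon> in at_right 0. X \<epsilon> < 1" by (rule order_tendstoD(2)) (simp add: X_def r2)
  have e4: "\<forall>\<^sub>F \<epsilon> in at_right 0. \<epsilon> < 1 - W"
    using W eventually_at_right_less[of "0::real"] by (auto intro: order_tendstoD(2)[OF tendsto_ident_at])
  have e5: "\<forall>\<^sub>F \<epsilon> in at_right 0. (0::real) < \<epsilon>" by (rule eventually_at_right_less)
  have "\<forall>\<^sub>F \<epsilon> :: real in at_right 0. False"
    using e1 e2 e3 e4 e5
  proof eventually_elim
    case (elim \<epsilon>)
    have X0: "0 < X \<epsilon>" "r^2 < X \<epsilon>" using elim p0 r2 by (auto simp: X_def add_pos_pos)
    have e1: "\<epsilon> < 1" using elim W by simp
    define x where "x = complex_of_real (sqrt (X \<epsilon>))"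
    define y where "y = complex_of_real (sqrt (1 - \<epsilon>)) * \<zeta>"
    have x2: "cmod2 x = X \<epsilon>" using X0 by (simp add: x_def)
    have y2: "cmod2 y = 1 - \<epsilon>" using e1 \<zeta> by (simp add: y_def norm_mult)
    have xy1: "cmod x < 1" "cmod y < 1"
      using x2 y2 elim by (metis abs_norm_cancel abs_square_less_1, metis abs_norm_cancel abs_square_less_1 diff_less_eq less_add_same_cancel1)
    have xy: "x * cnj y = \<xi> \<epsilon>" by (simp add: x_def y_def \<xi>_def)
    have pd: "pick_det (r^2) V (of_real r * cnj c) x y = \<epsilon> * f V c \<epsilon>" for V c
      unfolding pick_det_def x2 y2 xy f_def by (simp add: X_def algebra_simps)
    have "0 \<le> pick_det (r^2) T (of_real r * cnj \<tau>) x y"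
      using t xy1 x2 y2 X0 elim pd[of W \<omega>] unfolding pick_tested_def by (simp add: zero_le_mult_iff)
    then have "0 \<le> \<epsilon> * f T \<tau> \<epsilon>" unfolding pd .
    then show False using elim by (simp add: zero_le_mult_iff)
  qed
  then show False by (simp add: eventually_False)
qed

section \<open>Degenerate problems\<close>

lemma half_plane_to_disc:
  assumes "0 < Re P"
  shows "cmod ((P - 1) / (P + 1)) < 1" "P + 1 \<noteq> 0"
proof -
  have "Re (P + 1) \<noteq> 0" using assms by simp
  then show n: "P + 1 \<noteq> 0" by (metis zero_complex.sel(1))
  have "cmod2 (P - 1) < cmod2 (P + 1)"
    using assms unfolding cmod_power2 by (simp add: power2_eq_square algebra_simps)
  then have "cmod (P - 1) < cmod (P + 1)" by (rule power2_less_imp_less) simp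
  then show "cmod ((P - 1) / (P + 1)) < 1" using n by (simp add: norm_divide)
qed

text \<open>In unitary coordinates with \<open>z = (r, 0)\<close> the function
  \<open>u * \<zeta>1\<close> meets the conditions at 0 and \<open>z\<close>. On the half-plane
  side, a multiple \<open>K\<close> of \<open>\<zeta>2^2 / (\<zeta>0 - \<zeta>1)^2\<close> leaves
  them intact and corrects the value at \<open>w\<close>. The real part stays positive if
  \<open>cmod K <= 1\<close>, which is the Julia inequality at \<open>\<zeta>0\<close>.\<close>

lemma degenerate_solution:
  fixes z w :: "complex^2"
  assumes z1: "norm z < 1" "norm w < 1" and nc: "cmod2 (cdot z w) < (norm z)^2 * (norm w)^2"
    and \<sigma>: "cmod \<sigma> = norm z" and \<tau>: "cmod \<tau> < 1"
    and t: "pick_tested ((norm z)^2) ((norm w)^2) (cdot z w) (cmod2 \<sigma>) (cmod2 \<tau>) (\<sigma> * cnj \<tau>)"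
  shows "\<exists>F. pick_solution F [(0, 0), (z, \<sigma>), (w, \<tau>)]"
proof -
  define r where "r = norm z"
  have "z \<noteq> 0" "w \<noteq> 0" using nc by (auto simp: cdot_2)
  then have r: "0 < r" "r < 1" using z1 by (auto simp: r_def)
  define W where "W = (norm w)^2"
  have W: "0 < W" "W < 1" using \<open>w \<noteq> 0\<close> z1 by (auto simp: W_def abs_square_less_1)
  define u where "u = \<sigma> / of_real r"
  have u1: "cmod u = 1" using \<sigma> r by (simp add: u_def norm_divide r_def)
  then have uu: "u * cnj u = 1" using of_real_cmod_sq[of u] by simp
  have \<sigma>u: "\<sigma> = u * of_real r" using r by (simp add: u_def)
  define t' where "t' = cnj u * \<tau>"
  have \<tau>t: "\<tau> = u * t'" unfolding t'_def using uu by (simp add: mult.assoc[symmetric])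
  have t'T: "cmod t' = cmod \<tau>" unfolding t'_def using u1 by (simp add: norm_mult)
  define \<zeta>1 where "\<zeta>1 v = cdot v z / of_real r" for v
  define \<zeta>2 :: "complex^2 \<Rightarrow> complex" where "\<zeta>2 v = (z $ 1 * v $ 2 - z $ 2 * v $ 1) / of_real r" for v
  have coord: "cmod2 (\<zeta>1 v) + cmod2 (\<zeta>2 v) = (norm v)^2" for v
  proof -
    have "cmod (cdot v z) = cmod (cdot z v)" by (metis cnj_cdot complex_mod_cnj)
    then have "cmod2 (cdot v z) + cmod2 (z $ 1 * v $ 2 - z $ 2 * v $ 1) = r^2 * (norm v)^2"
      using cauchy_schwarz_2[of z v] by (simp add: r_def)
    moreover have "cmod2 (\<zeta>1 v) + cmod2 (\<zeta>2 v) = (cmod2 (cdot v z) + cmod2 (z $ 1 * v $ 2 - z $ 2 * v $ 1)) / r^2"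
      by (simp add: \<zeta>1_def \<zeta>2_def norm_divide power_divide add_divide_distrib)
    ultimately show ?thesis using r by simp
  qed
  have \<zeta>z: "\<zeta>1 z = of_real r" "\<zeta>2 z = 0" "\<zeta>1 0 = 0" "\<zeta>2 0 = 0"
    using r by (simp_all add: \<zeta>1_def \<zeta>2_def cdot_self r_def[symmetric] power2_eq_square)
  have h1: "holomorphic2_on \<zeta>1 ball2" unfolding \<zeta>1_def[abs_def] using r
    by (intro holomorphic2_divide holomorphic2_cdot holomorphic2_const) auto
  have h2: "holomorphic2_on \<zeta>2 ball2" unfolding \<zeta>2_def[abs_def] using r
    by (intro holomorphic2_divide holomorphic2_diff holomorphic2_mult holomorphic2_nth holomorphic2_const) auto
  have \<zeta>11: "cmod (\<zeta>1 v) < 1" if "norm v < 1" for v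
  proof -
    have "cmod2 (\<zeta>1 v) \<le> (norm v)^2" using coord[of v] zero_le_power2[of "cmod (\<zeta>2 v)"] by linarith
    then have "cmod (\<zeta>1 v) \<le> norm v" by (rule power2_le_imp_le) simp
    then show ?thesis using that by simp
  qed
  define \<omega> where "\<omega> = \<zeta>1 w"
  have \<omega>1: "cmod \<omega> < 1" using \<zeta>11 z1 by (simp add: \<omega>_def)
  have c: "cdot z w = of_real r * cnj \<omega>" using r by (simp add: \<omega>_def \<zeta>1_def cnj_cdot)
  have \<nu>2: "cmod2 (\<zeta>2 w) = W - cmod2 \<omega>" using coord[of w] by (simp add: \<omega>_def W_def)
  show ?thesis
  proof (cases "t' = \<omega>")
    case True
    define F where "F v = u * \<zeta>1 v" for v
    have "holomorphic2_on F ball2" unfolding F_def by (intro holomorphic2_mult holomorphic2_const h1)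
    moreover have "F ` ball2 \<subseteq> unit_disc" using \<zeta>11 u1 by (auto simp: F_def norm_mult)
    moreover have "F 0 = 0" "F z = \<sigma>" "F w = \<tau>" using True by (simp_all add: F_def \<zeta>z \<sigma>u \<tau>t \<omega>_def)
    ultimately show ?thesis by (intro exI[of _ F]) (simp add: pick_solution_def)
  next
    case False
    define tt where "tt = mob \<omega> t'"
    have tt1: "cmod tt < 1" using cmod_mob_less_1 \<omega>1 \<tau> t'T by (simp add: tt_def)
    have t'tt: "t' = mob \<omega> tt" using mob_mob[OF \<omega>1] \<tau> t'T by (simp add: tt_def less_imp_le)
    have tt0: "tt \<noteq> 0" using t'tt False by auto
    define \<rho> where "\<rho> = cmod tt"
    have \<rho>: "0 < \<rho>" "\<rho> < 1" using tt0 tt1 by (auto simp: \<rho>_def)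
    \<comment> \<open>\<open>mob \<omega>\<close> sends \<open>\<omega>\<close> to 0 and
      \<open>t'\<close> to \<open>tt\<close>, and \<open>\<eta>\<close> is opposite to
      \<open>tt\<close>. So \<open>\<zeta>0\<close> is the end of the geodesic from
      \<open>t'\<close> through \<open>\<omega>\<close>, the boundary point at which the Julia
      inequality is strongest.\<close>
    define \<eta> where "\<eta> = - tt / of_real \<rho>"
    have \<eta>1: "cmod \<eta> = 1" using \<rho> by (simp add: \<eta>_def norm_divide) (simp add: \<rho>_def tt0)
    define \<zeta>0 where "\<zeta>0 = mob \<omega> \<eta>"
    define m N where "m = 1 - cnj \<omega> * \<eta>" and "N = 1 - cnj \<omega> * tt"
    have mN: "m \<noteq> 0" "N \<noteq> 0" using one_minus_cnj_neq_0(1)[OF \<omega>1] \<eta>1 tt1 by (auto simp: m_def N_def less_imp_le)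
    have "1 - cmod2 \<zeta>0 = 0" unfolding \<zeta>0_def using cmod_mob_sq[OF \<omega>1, of \<eta>] \<eta>1 by simp
    then have \<zeta>01: "cmod \<zeta>0 = 1" by (simp add: power2_eq_1_iff) (smt (verit) norm_ge_zero)
    define dd where "dd = 1 - cmod2 \<omega>"
    have o0: "0 < dd" using \<omega>1 by (simp add: dd_def abs_square_less_1)
    have oc: "of_real dd = 1 - \<omega> * cnj \<omega>" by (simp add: dd_def of_real_cmod_sq)
    have oabs: "cmod (of_real dd) = dd" using o0 by simp
    have d1: "cmod (\<zeta>0 - \<omega>) = dd / cmod m"
    proof -
      have "\<zeta>0 - \<omega> = - (\<eta> * of_real dd) / m"
        unfolding \<zeta>0_def mob_def oc m_def[symmetric] using mN by (simp add: field_simps) (simp add: m_def algebra_simps)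
      then show ?thesis using \<eta>1 oabs by (simp add: norm_divide norm_mult)
    qed
    have d2: "cmod (t' - \<omega>) = dd * \<rho> / cmod N"
    proof -
      have "t' - \<omega> = - (tt * of_real dd) / N"
        unfolding t'tt mob_def[of \<omega> tt] oc N_def[symmetric] using mN by (simp add: field_simps) (simp add: N_def algebra_simps)
      then show ?thesis using oabs by (simp add: norm_divide norm_mult \<rho>_def)
    qed
    have d3: "cmod (\<zeta>0 - t') = dd * (1 + \<rho>) / (cmod m * cmod N)"
    proof -
      have "\<zeta>0 - t' = of_real dd * (tt - \<eta>) / (m * N)"
        unfolding \<zeta>0_def mob_def[of \<omega> \<eta>] t'tt mob_def[of \<omega> tt] oc m_def[symmetric] N_def[symmetric]
        using mN by (simp add: diff_frac_eq) (simp add: m_def N_def algebra_simps)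
      moreover have "tt - \<eta> = - (\<eta> * of_real (1 + \<rho>))"
      proof -
        have "tt = - (\<eta> * of_real \<rho>)" using \<rho> by (simp add: \<eta>_def)
        then show ?thesis by (simp add: algebra_simps)
      qed
      then have "cmod (tt - \<eta>) = 1 + \<rho>" using \<eta>1 \<rho> by (simp only: norm_minus_cancel norm_mult norm_of_real) simp
      ultimately show ?thesis using oabs by (simp add: norm_divide norm_mult)
    qed
    have T1: "1 - cmod2 t' = dd * (1 - \<rho>^2) / cmod2 N"
    proof -
      have "cmod (1 - \<omega> * cnj tt) = cmod N"
        using complex_mod_cnj[of N] by (simp add: N_def)
      then show ?thesis unfolding t'tt using cmod_mob_sq[OF \<omega>1, of tt] tt1 by (simp add: dd_def \<rho>_def)
    qed
    have s: "\<sigma> * cnj \<tau> = of_real r * cnj t'"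
      unfolding \<sigma>u \<tau>t using uu by (simp add: mult_ac)
    have "pick_tested (r^2) W (of_real r * cnj \<omega>) (r^2) (cmod2 t') (of_real r * cnj t')"
      using t unfolding c s \<sigma> r_def[symmetric] W_def[symmetric] t'T .
    moreover have "cmod2 t' < 1" using \<tau> t'T by (simp add: abs_square_less_1)
    ultimately have J: "cmod2 (\<zeta>0 - t') * (1 - W) \<le> cmod2 (\<zeta>0 - \<omega>) * (1 - cmod2 t')"
      using pick_tested_julia[OF r W _ \<zeta>01] by blast
    have J': "(1 + \<rho>) * (1 - W) \<le> dd * (1 - \<rho>)"
    proof -
      define k where "k = dd^2 * (1 + \<rho>) / (cmod2 m * cmod2 N)"
      have k: "0 < k" using o0 \<rho> mN by (simp add: k_def)
      have "k * ((1 + \<rho>) * (1 - W)) = cmod2 (\<zeta>0 - t') * (1 - W)"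
        unfolding d3 k_def power_divide power_mult_distrib by (simp add: power2_eq_square)
      also note J
      also have "cmod2 (\<zeta>0 - \<omega>) * (1 - cmod2 t') = k * (dd * (1 - \<rho>))"
        unfolding d1 T1 k_def power_divide by (simp add: power2_eq_square algebra_simps)
      finally show ?thesis using k by simp
    qed
    have n0: "\<zeta>0 \<noteq> t'" "\<zeta>0 \<noteq> \<omega>" using \<zeta>01 \<omega>1 \<tau> t'T by auto
    have \<nu>0: "\<zeta>2 w \<noteq> 0"
    proof -
      have "(1 + \<rho>) * (1 - W) < (1 + \<rho>) * dd"
        using J' o0 \<rho> by (smt (verit) mult.commute mult_strict_left_mono)
      then have "0 < cmod2 (\<zeta>2 w)" using \<nu>2 \<rho> by (simp add: dd_def)
      then show ?thesis by auto
    qed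
    \<comment> \<open>Forced by \<open>P w = (\<zeta>0 + t') / (\<zeta>0 - t')\<close>, the
      half-plane value belonging to \<open>t'\<close>.\<close>
    define K where "K = 2 * \<zeta>0 * (t' - \<omega>) * (\<zeta>0 - \<omega>) / ((\<zeta>0 - t') * (\<zeta>2 w)^2)"
    have K1: "cmod K \<le> 1"
    proof -
      have "cmod K = 2 * (dd * \<rho> / cmod N) * (dd / cmod m) / ((dd * (1 + \<rho>) / (cmod m * cmod N)) * cmod2 (\<zeta>2 w))"
        unfolding K_def norm_divide norm_mult norm_power d1 d2 d3 \<zeta>01 by simp
      also have "\<dots> = 2 * dd * \<rho> / ((1 + \<rho>) * cmod2 (\<zeta>2 w))"
        using mN o0 by simp
      also have "\<dots> \<le> 1"
      proof -
        have "2 * dd * \<rho> \<le> (1 + \<rho>) * cmod2 (\<zeta>2 w)"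
          using J' unfolding \<nu>2 by (simp add: dd_def algebra_simps)
        then show ?thesis using \<rho> \<nu>0 by (simp add: divide_le_eq)
      qed
      finally show ?thesis .
    qed
    define P where "P v = (\<zeta>0 + \<zeta>1 v) / (\<zeta>0 - \<zeta>1 v) + K * (\<zeta>2 v)^2 / (\<zeta>0 - \<zeta>1 v)^2" for v
    have n1: "\<zeta>0 - \<zeta>1 v \<noteq> 0" if "norm v < 1" for v using \<zeta>11[OF that] \<zeta>01 by auto
    have ReP: "0 < Re (P v)" if v: "norm v < 1" for v
    proof -
      define a where "a = \<zeta>0 - \<zeta>1 v"
      have a0: "0 < cmod2 a" using n1[OF v] by (simp add: a_def)
      have "Re ((\<zeta>0 + \<zeta>1 v) / a) = (1 - cmod2 (\<zeta>1 v)) / cmod2 a"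
      proof -
        have "(\<zeta>0 + \<zeta>1 v) / a = (\<zeta>0 + \<zeta>1 v) * cnj a / of_real (cmod2 a)"
          using n1[OF v] by (simp add: of_real_cmod_sq a_def)
        then have "Re ((\<zeta>0 + \<zeta>1 v) / a) = Re ((\<zeta>0 + \<zeta>1 v) * cnj a) / cmod2 a" by (simp only: Re_divide_of_real)
        also have "Re ((\<zeta>0 + \<zeta>1 v) * cnj a) = cmod2 \<zeta>0 - cmod2 (\<zeta>1 v)"
          unfolding a_def cmod_power2 by (simp add: power2_eq_square algebra_simps)
        finally show ?thesis using \<zeta>01 by simp
      qed
      moreover have "- Re (K * (\<zeta>2 v)^2 / a^2) \<le> cmod2 (\<zeta>2 v) / cmod2 a"
      proof -
        have "- Re (K * (\<zeta>2 v)^2 / a^2) \<le> cmod (K * (\<zeta>2 v)^2 / a^2)"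
          using abs_Re_le_cmod[of "K * (\<zeta>2 v)^2 / a^2"] by linarith
        also have "\<dots> = cmod K * (cmod2 (\<zeta>2 v) / cmod2 a)" by (simp add: norm_mult norm_divide norm_power)
        also have "\<dots> \<le> cmod2 (\<zeta>2 v) / cmod2 a" using K1 by (intro mult_left_le_one_le) auto
        finally show ?thesis .
      qed
      moreover have "cmod2 (\<zeta>2 v) / cmod2 a < (1 - cmod2 (\<zeta>1 v)) / cmod2 a"
      proof -
        have "(norm v)^2 < 1" using v by (simp add: abs_square_less_1)
        then show ?thesis using coord[of v] a0 by (intro divide_strict_right_mono) linarith+
      qed
      ultimately show ?thesis unfolding P_def a_def[symmetric] by simp
    qed
    define F where "F v = u * \<zeta>0 * ((P v - 1) / (P v + 1))" for v
    have hP: "holomorphic2_on P ball2" unfolding P_def[abs_def] power2_eq_square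
      by (intro holomorphic2_add holomorphic2_divide holomorphic2_diff holomorphic2_mult holomorphic2_const h1 h2) (auto simp: n1 simp del: right_minus_eq)
    then have hF: "holomorphic2_on F ball2" unfolding F_def[abs_def]
      by (intro holomorphic2_add holomorphic2_divide holomorphic2_diff holomorphic2_mult holomorphic2_const)
         (auto simp: half_plane_to_disc(2)[OF ReP])
    have F1: "F ` ball2 \<subseteq> unit_disc"
      using half_plane_to_disc(1)[OF ReP] u1 \<zeta>01 by (auto simp: F_def norm_mult norm_divide)
    have \<zeta>00: "\<zeta>0 \<noteq> 0" using \<zeta>01 by auto
    have cay: "((\<zeta>0 + q) / (\<zeta>0 - q) - 1) / ((\<zeta>0 + q) / (\<zeta>0 - q) + 1) = q / \<zeta>0" if "\<zeta>0 - q \<noteq> 0" for q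
    proof -
      have "(\<zeta>0 + q) / (\<zeta>0 - q) - 1 = 2 * q / (\<zeta>0 - q)" "(\<zeta>0 + q) / (\<zeta>0 - q) + 1 = 2 * \<zeta>0 / (\<zeta>0 - q)"
        using that by (simp_all add: field_simps)
      then show ?thesis using that \<zeta>00 by simp
    qed
    have P0: "P 0 = 1" using \<zeta>00 by (simp add: P_def \<zeta>z)
    have Pz: "P z = (\<zeta>0 + of_real r) / (\<zeta>0 - of_real r)" by (simp add: P_def \<zeta>z)
    have Pw: "P w = (\<zeta>0 + t') / (\<zeta>0 - t')"
    proof -
      have n: "\<zeta>0 - t' \<noteq> 0" "\<zeta>0 - \<omega> \<noteq> 0" using n0 by auto
      have "K * (\<zeta>2 w)^2 / (\<zeta>0 - \<omega>)^2 = 2 * \<zeta>0 * (t' - \<omega>) / ((\<zeta>0 - t') * (\<zeta>0 - \<omega>))"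
        unfolding K_def using n \<nu>0 by (simp add: power2_eq_square)
      also have "\<dots> = (\<zeta>0 + t') / (\<zeta>0 - t') - (\<zeta>0 + \<omega>) / (\<zeta>0 - \<omega>)"
        using n by (simp add: diff_frac_eq) (simp add: algebra_simps)
      finally show ?thesis unfolding P_def \<omega>_def[symmetric] by simp
    qed
    have "F 0 = 0" by (simp add: F_def P0)
    moreover have "F z = \<sigma>"
      unfolding F_def Pz using cay[of "of_real r"] n1[OF z1(1)] \<zeta>z \<zeta>00 by (simp add: \<sigma>u)
    moreover have "F w = \<tau>"
      unfolding F_def Pw using cay[of t'] n0 \<zeta>00 by (simp add: \<tau>t)
    ultimately show ?thesis using hF F1 by (intro exI[of _ F]) (simp add: pick_solution_def)
  qed
qed

lemma degenerate_solution_swap: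
  fixes z w :: "complex^2"
  assumes z1: "norm z < 1" "norm w < 1" and nc: "cmod2 (cdot z w) < (norm z)^2 * (norm w)^2"
    and \<tau>: "cmod \<tau> = norm w" and \<sigma>: "cmod \<sigma> < 1"
    and t: "pick_tested ((norm z)^2) ((norm w)^2) (cdot z w) (cmod2 \<sigma>) (cmod2 \<tau>) (\<sigma> * cnj \<tau>)"
  shows "\<exists>F. pick_solution F [(0, 0), (z, \<sigma>), (w, \<tau>)]"
proof -
  have "cmod (cdot w z) = cmod (cdot z w)" by (metis cnj_cdot complex_mod_cnj)
  then have nc': "cmod2 (cdot w z) < (norm w)^2 * (norm z)^2" using nc by (simp add: mult.commute)
  have "pick_tested ((norm w)^2) ((norm z)^2) (cdot w z) (cmod2 \<tau>) (cmod2 \<sigma>) (\<tau> * cnj \<sigma>)"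
    using pick_tested_swap[OF t] by (simp add: cnj_cdot mult.commute)
  from degenerate_solution[OF z1(2,1) nc' \<tau> \<sigma> this] show ?thesis
    by (auto simp: pick_solution_def)
qed

text \<open>Moving the base point to \<open>z\<close> turns the equality into
  \<open>cmod \<tau>' = norm w'\<close>, a case already solved; the solution is carried back by the
  same involutions.\<close>

lemma degenerate_solution_base_change:
  fixes z w :: "complex^2"
  assumes z1: "norm z < 1" "norm w < 1" and nc: "cmod2 (cdot z w) < (norm z)^2 * (norm w)^2"
    and st: "cmod \<sigma> < 1" "cmod \<tau> < 1"
    and eq: "(1 - (norm z)^2) * (1 - (norm w)^2) * cmod2 (1 - \<sigma> * cnj \<tau>)
      = (1 - cmod2 \<sigma>) * (1 - cmod2 \<tau>) * cmod2 (1 - cdot z w)"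
    and t: "pick_tested ((norm z)^2) ((norm w)^2) (cdot z w) (cmod2 \<sigma>) (cmod2 \<tau>) (\<sigma> * cnj \<tau>)"
  shows "\<exists>F. pick_solution F [(0, 0), (z, \<sigma>), (w, \<tau>)]"
proof -
  define w' where "w' = chi_aut z w"
  define \<tau>' where "\<tau>' = mob \<sigma> \<tau>"
  have "z \<noteq> 0" "w \<noteq> 0" using nc by (auto simp: cdot_2)
  then have ZW: "0 < (norm z)^2" "(norm z)^2 < 1" "0 < (norm w)^2" "(norm w)^2 < 1"
    using z1 by (auto simp: abs_square_less_1)
  have S1: "cmod2 \<sigma> < 1" "1 - \<sigma> * cnj \<tau> \<noteq> 0"
    using st mult_cnj_less_1[OF st] by (auto simp: abs_square_less_1)
  have c0: "1 - cdot z w \<noteq> 0" using cmod_cdot_less_1[OF z1] by auto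
  have w'1: "norm w' < 1" using norm_chi_aut_less_1 z1 by (simp add: w'_def)
  have \<tau>'1: "cmod \<tau>' < 1" using cmod_mob_less_1 st by (simp add: \<tau>'_def)
  have W': "1 - (norm w')^2 = (1 - (norm z)^2) * (1 - (norm w)^2) / cmod2 (1 - cdot z w)"
    unfolding w'_def by (rule norm_chi_aut_sq[OF z1])
  have T': "1 - cmod2 \<tau>' = (1 - cmod2 \<sigma>) * (1 - cmod2 \<tau>) / cmod2 (1 - \<sigma> * cnj \<tau>)"
    unfolding \<tau>'_def by (rule cmod_mob_sq) (use st in auto)
  have c': "1 - cdot z w' = of_real (1 - (norm z)^2) / (1 - cdot z w)"
    using one_minus_cdot_chi_aut[of z 0 w] z1 by (simp add: w'_def cdot_self)
  have s': "1 - \<sigma> * cnj \<tau>' = of_real (1 - cmod2 \<sigma>) / (1 - \<sigma> * cnj \<tau>)"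
    using one_minus_mob_cnj_mob[of \<sigma> 0 \<tau>] st by (simp add: \<tau>'_def of_real_cmod_sq less_imp_le)
  have t': "pick_tested ((norm z)^2) ((norm w')^2) (cdot z w') (cmod2 \<sigma>) (cmod2 \<tau>') (\<sigma> * cnj \<tau>')"
    by (rule pick_tested_base_change[OF ZW nc S1 W' c' T' s' t])
  have "1 - (norm w')^2 = 1 - cmod2 \<tau>'"
    unfolding W' T' using eq c0 S1 by (simp add: frac_eq_eq mult_ac)
  then have e: "cmod \<tau>' = norm w'" by (simp add: power2_eq_iff_nonneg)
  have nc': "cmod2 (cdot z w') < (norm z)^2 * (norm w')^2"
  proof -
    have "0 < (norm z)^2 * (norm w')^2 - cmod2 (cdot z w')"
    proof -
      have "z $ 1 * w' $ 2 - z $ 2 * w' $ 1 =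
          - complex_of_real (sqrt (1 - (norm z)^2)) * (z $ 1 * w $ 2 - z $ 2 * w $ 1) / (1 - cdot w z)"
        unfolding w'_def chi_aut_nth by (simp add: diff_divide_distrib[symmetric] algebra_simps)
      moreover have "1 - cdot w z \<noteq> 0" using cmod_cdot_less_1[OF z1(2,1)] by auto
      moreover have "sqrt (1 - (norm z)^2) \<noteq> 0" using ZW by simp
      ultimately have "z $ 1 * w' $ 2 - z $ 2 * w' $ 1 \<noteq> 0" using cdot_vec_noncollinear[OF nc] by simp
      then show ?thesis unfolding cauchy_schwarz_2 by simp
    qed
    then show ?thesis by simp
  qed
  obtain F' where F': "pick_solution F' [(0, 0), (z, \<sigma>), (w', \<tau>')]"
    using degenerate_solution_swap[OF z1(1) w'1 nc' e st(1) t'] by blast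
  define F where "F p = mob \<sigma> (F' (chi_aut z p))" for p
  have F'h: "holomorphic2_on F' ball2" "F' ` ball2 \<subseteq> unit_disc" "F' 0 = 0" "F' z = \<sigma>" "F' w' = \<tau>'"
    using F' by (auto simp: pick_solution_def)
  have "holomorphic2_on F ball2" "F ` ball2 \<subseteq> unit_disc"
    using holomorphic2_mob_chi_aut[OF F'h(1,2) z1(1) st(1)] by (simp_all add: F_def[abs_def])
  moreover have "F 0 = 0" "F z = \<sigma>" "F w = \<tau>"
    using F'h mob_mob[OF st(1)] st(2) by (simp_all add: F_def w'_def \<tau>'_def less_imp_le)
  ultimately show ?thesis by (intro exI[of _ F]) (simp add: pick_solution_def)
qed

section \<open>The largest scale that passes the test\<close>

definition pick_strict :: "real \<Rightarrow> real \<Rightarrow> complex \<Rightarrow> real \<Rightarrow> real \<Rightarrow> complex \<Rightarrow> bool" where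
  "pick_strict Z W c S T s \<longleftrightarrow> S < Z \<and> T < W \<and>
     (1 - Z) * (1 - W) * cmod2 (1 - s) < (1 - S) * (1 - T) * cmod2 (1 - c)"

text \<open>By continuity the two-point inequalities hold near \<open>t'\<close>, so the test
  eventually fails only through a determinant, and the offending parameters accumulate at interior
  ones. Squares of \<open>t\<close> appear because Gram numbers are quadratic in the
  targets.\<close>

lemma pick_tested_fails_near:
  fixes t :: "nat \<Rightarrow> real"
  assumes ZW: "0 < Z" "Z < 1" "0 < W" "W < 1" "cmod2 c < Z * W"
    and t: "t \<longlonglongrightarrow> t'" and nt: "\<And>n. \<not> pick_tested Z W c ((t n)^2 * S) ((t n)^2 * T) (of_real ((t n)^2) * s)"
    and nd: "pick_strict Z W c (t'^2 * S) (t'^2 * T) (of_real (t'^2) * s)"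
  obtains x y where "cmod x < 1" "cmod y < 1" "Z < cmod2 x" "W < cmod2 y"
    "0 \<le> pick_det Z W c x y" "pick_det (t'^2 * S) (t'^2 * T) (of_real (t'^2) * s) x y \<le> 0"
proof -
  let ?bad = "\<lambda>n x y. cmod x < 1 \<and> cmod y < 1 \<and> Z < cmod2 x \<and> W < cmod2 y \<and>
      0 \<le> pick_det Z W c x y \<and> pick_det ((t n)^2 * S) ((t n)^2 * T) (of_real ((t n)^2) * s) x y \<le> 0"
  have l: "(\<lambda>n. (t n)^2 * S) \<longlonglongrightarrow> t'^2 * S" "(\<lambda>n. (t n)^2 * T) \<longlonglongrightarrow> t'^2 * T"
    "(\<lambda>n. complex_of_real ((t n)^2) * s) \<longlonglongrightarrow> of_real (t'^2) * s"
    by (intro tendsto_intros t)+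
  have nd': "t'^2 * S < Z" "t'^2 * T < W"
    "(1 - Z) * (1 - W) * cmod2 (1 - of_real (t'^2) * s) < (1 - t'^2 * S) * (1 - t'^2 * T) * cmod2 (1 - c)"
    using nd by (simp_all add: pick_strict_def)
  have l3: "(\<lambda>n. (1 - (t n)^2 * S) * (1 - (t n)^2 * T) * cmod2 (1 - c)
      - (1 - Z) * (1 - W) * cmod2 (1 - of_real ((t n)^2) * s))
    \<longlonglongrightarrow> (1 - t'^2 * S) * (1 - t'^2 * T) * cmod2 (1 - c)
      - (1 - Z) * (1 - W) * cmod2 (1 - of_real (t'^2) * s)"
    by (intro tendsto_intros t)
  have "\<forall>\<^sub>F n in sequentially. (t n)^2 * S < Z" using order_tendstoD(2)[OF l(1) nd'(1)] .
  moreover have "\<forall>\<^sub>F n in sequentially. (t n)^2 * T < W" using order_tendstoD(2)[OF l(2) nd'(2)] .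
  moreover have "\<forall>\<^sub>F n in sequentially. 0 < (1 - (t n)^2 * S) * (1 - (t n)^2 * T) * cmod2 (1 - c)
      - (1 - Z) * (1 - W) * cmod2 (1 - of_real ((t n)^2) * s)"
    by (rule order_tendstoD(1)[OF l3]) (use nd'(3) in linarith)
  ultimately have "\<forall>\<^sub>F n in sequentially. \<exists>x y. ?bad n x y"
  proof eventually_elim
    case (elim n)
    then show ?case using nt[of n] unfolding pick_tested_def by (smt (verit))
  qed
  then obtain N where "\<forall>n. \<exists>x y. N \<le> n \<longrightarrow> ?bad n x y"
    unfolding eventually_sequentially by blast
  then obtain x y where xy: "\<And>n. N \<le> n \<Longrightarrow> ?bad n (x n) (y n)"
    by metis
  show thesis
    by (rule pick_det_limit[OF ZW LIMSEQ_ignore_initial_segment[OF l(1), of N] LIMSEQ_ignore_initial_segment[OF l(2), of N]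
          LIMSEQ_ignore_initial_segment[OF l(3), of N] nd', where x = "\<lambda>n. x (n + N)" and y = "\<lambda>n. y (n + N)"])
       (use xy that in auto)
qed

lemma pick_tested_closed:
  "closed {t. 0 \<le> t \<and> pick_tested Z W c (t^2 * S) (t^2 * T) (of_real (t^2) * s)}" (is "closed ?I")
  unfolding closed_sequential_limits
proof (intro allI impI, elim conjE)
  fix t :: "nat \<Rightarrow> real" and l
  assume t: "\<forall>n. t n \<in> ?I" and l: "t \<longlonglongrightarrow> l"
  then have t': "0 \<le> t n" "pick_tested Z W c ((t n)^2 * S) ((t n)^2 * T) (of_real ((t n)^2) * s)" for n by auto
  have "0 \<le> l" by (rule LIMSEQ_le_const[OF l]) (use t' in auto)
  moreover have "l^2 * S \<le> Z"
    by (rule LIMSEQ_le_const2[of "\<lambda>n. (t n)^2 * S"]) (use t' in \<open>auto simp: pick_tested_def intro!: tendsto_intros l\<close>)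
  moreover have "l^2 * T \<le> W"
    by (rule LIMSEQ_le_const2[of "\<lambda>n. (t n)^2 * T"]) (use t' in \<open>auto simp: pick_tested_def intro!: tendsto_intros l\<close>)
  moreover have "(1 - Z) * (1 - W) * cmod2 (1 - of_real (l^2) * s) \<le> (1 - l^2 * S) * (1 - l^2 * T) * cmod2 (1 - c)"
  proof (rule LIMSEQ_le)
    show "(\<lambda>n. (1 - Z) * (1 - W) * cmod2 (1 - of_real ((t n)^2) * s)) \<longlonglongrightarrow> (1 - Z) * (1 - W) * cmod2 (1 - of_real (l^2) * s)"
      by (intro tendsto_intros l)
    show "(\<lambda>n. (1 - (t n)^2 * S) * (1 - (t n)^2 * T) * cmod2 (1 - c)) \<longlonglongrightarrow> (1 - l^2 * S) * (1 - l^2 * T) * cmod2 (1 - c)"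
      by (intro tendsto_intros l)
  qed (use t' in \<open>auto simp: pick_tested_def\<close>)
  moreover have "0 \<le> pick_det (l^2 * S) (l^2 * T) (of_real (l^2) * s) x y"
    if "cmod x < 1" "cmod y < 1" "Z < cmod2 x" "W < cmod2 y" "0 \<le> pick_det Z W c x y" for x y
  proof (rule LIMSEQ_le_const)
    show "(\<lambda>n. pick_det ((t n)^2 * S) ((t n)^2 * T) (of_real ((t n)^2) * s) x y)
        \<longlonglongrightarrow> pick_det (l^2 * S) (l^2 * T) (of_real (l^2) * s) x y"
      unfolding pick_det_def by (intro tendsto_intros l)
  qed (use t' that in \<open>auto simp: pick_tested_def\<close>)
  ultimately show "l \<in> ?I"
    unfolding pick_tested_def by blast
qed

text \<open>Multiplication by \<open>t\<close> contracts the pseudohyperbolic distance of the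
  targets: its square is \<open>t^2 * d / q t\<close>, and \<open>t^2 * q 1 <= q t\<close>.\<close>

lemma pick_strict_scale_down:
  fixes \<sigma> \<tau> :: complex
  assumes nd: "pick_strict Z W c (cmod2 \<sigma>) (cmod2 \<tau>) (\<sigma> * cnj \<tau>)"
    and ZW: "Z < 1" "W < 1" and t: "0 < t" "t \<le> 1"
  shows "pick_strict Z W c (t^2 * cmod2 \<sigma>) (t^2 * cmod2 \<tau>) (of_real (t^2) * (\<sigma> * cnj \<tau>))"
proof -
  define S T s where "S = cmod2 \<sigma>" and "T = cmod2 \<tau>" and "s = \<sigma> * cnj \<tau>"
  have nd': "S < Z" "T < W" "(1 - Z) * (1 - W) * cmod2 (1 - s) < (1 - S) * (1 - T) * cmod2 (1 - c)"
    using nd by (auto simp: pick_strict_def S_def T_def s_def)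
  have t2: "0 < t^2" "t^2 \<le> 1" using t by (auto simp: power_le_one)
  have ST: "t^2 * S \<le> S" "t^2 * T \<le> T" using t2 by (auto simp: S_def T_def mult_left_le_one_le)
  define d where "d = cmod2 (\<sigma> - \<tau>)"
  have st1: "cmod \<sigma> < 1" "cmod \<tau> < 1"
  proof -
    have "cmod2 \<sigma> < 1" "cmod2 \<tau> < 1" using nd' ZW by (simp_all add: S_def T_def)
    then show "cmod \<sigma> < 1" "cmod \<tau> < 1" by (simp_all add: abs_square_less_1)
  qed
  define q where "q t = cmod2 (1 - of_real (t^2) * s)" for t :: real
  have sc: "(1 - t^2 * S) * (1 - t^2 * T) = q t - t^2 * d" for t
  proof -
    have "cmod2 (of_real t * \<sigma> - of_real t * \<tau>) = t^2 * d"
      by (simp only: right_diff_distrib[symmetric] norm_mult norm_of_real power_mult_distrib power2_abs d_def)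
    moreover have "of_real t * \<sigma> * cnj (of_real t * \<tau>) = of_real (t^2) * s"
      by (simp add: s_def power2_eq_square mult_ac)
    moreover have "cmod2 (of_real t * \<sigma>) = t^2 * S" "cmod2 (of_real t * \<tau>) = t^2 * T"
      by (simp_all add: norm_mult power_mult_distrib S_def T_def)
    ultimately show ?thesis
      using cmod_one_minus_sq[of "of_real t * \<sigma>" "of_real t * \<tau>"] unfolding q_def by simp
  qed
  have s1: "cmod s < 1" using mult_cnj_less_1[OF st1] by (simp add: s_def)
  have q1: "0 < q 1" using s1 by (auto simp: q_def)
  have qt: "0 < q t"
  proof -
    have "cmod (of_real (t^2) * s) < 1" using s1 t2 mult_left_le_one_le[of "cmod s" "t^2"] by (simp add: norm_mult norm_power)
    then show ?thesis by (auto simp: q_def)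
  qed
  have qq: "t^2 * q 1 \<le> q t"
  proof -
    have "q t - t^2 * q 1 = (1 - t^2) * (1 - t^2 * cmod2 s)"
      unfolding q_def cmod_power2 by (simp add: power2_eq_square algebra_simps)
    moreover have "t^2 * cmod2 s \<le> 1" using t2 s1 by (intro mult_le_one) (auto simp: abs_square_le_1)
    ultimately show ?thesis using t2 by (smt (verit) mult_nonneg_nonneg)
  qed
  define e where "e = (1 - Z) * (1 - W)"
  define g where "g = cmod2 (1 - c)"
  have "e * q 1 < (q 1 - d) * g"
    using nd'(3) sc[of 1] by (simp add: e_def g_def q_def)
  have "e * q t * q 1 < (q t - t^2 * d) * g * q 1"
  proof -
    have "e * q t * q 1 = q t * (e * q 1)" by simp
    also have "\<dots> < q t * ((q 1 - d) * g)" using \<open>e * q 1 < (q 1 - d) * g\<close> qt by simp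
    also have "\<dots> = (q t * q 1 - q t * d) * g" by (simp add: algebra_simps)
    also have "\<dots> \<le> (q t * q 1 - t^2 * q 1 * d) * g"
      using qq by (intro mult_right_mono diff_left_mono mult_right_mono) (auto simp: d_def g_def)
    also have "\<dots> = (q t - t^2 * d) * g * q 1" by (simp add: algebra_simps)
    finally show ?thesis .
  qed
  then have "e * q t < (q t - t^2 * d) * g" using q1 by simp
  then show ?thesis
    unfolding pick_strict_def using ST nd' sc[of t] by (simp add: e_def g_def q_def S_def T_def s_def)
qed

lemma collinear_in_C:
  assumes "(z, w) \<in> D2" "l \<in> P1" "z $ 1 * w $ 2 - z $ 2 * w $ 1 = 0"
  shows "(z, w, l) \<in> \<C>"
proof -
  have z0: "z \<noteq> 0" using assms by (simp add: D2_def)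
  have "\<exists>k. w = k *s z"
  proof (cases "z $ 1 = 0")
    case True
    then have "z $ 2 \<noteq> 0" using z0 by (auto simp: vec_eq_iff forall_2)
    then have "w = (w $ 2 / z $ 2) *s z" using assms(3) True by (auto simp: vec_eq_iff forall_2)
    then show ?thesis ..
  next
    case False
    then have "w = (w $ 1 / z $ 1) *s z" using assms(3) by (auto simp: vec_eq_iff forall_2 field_simps)
    then show ?thesis ..
  qed
  then obtain k where k: "w = k *s z" ..
  define L where "L = {0 + \<zeta> *s z | \<zeta>. True}"
  have "complex_line L" unfolding complex_line_def L_def using z0 by blast
  moreover have "0 + 0 *s z \<in> L" "0 + 1 *s z \<in> L" "0 + k *s z \<in> L" unfolding L_def by blast+
  then have "{0, z, w} \<subseteq> L" using k by simp
  ultimately show ?thesis using assms(1,2) unfolding \<C>_def by blast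
qed

lemma nondegenerate_in_Phi_image:
  fixes z w :: "complex^2" and \<sigma> \<tau> :: complex
  assumes D: "(z, w) \<in> D2" and st0: "(\<sigma>, \<tau>) \<noteq> (0, 0)"
    and nd: "nondegenerate_extremal3 (0, 0) (z, \<sigma>) (w, \<tau>)"
    and ncl: "z $ 1 * w $ 2 - z $ 2 * w $ 1 \<noteq> 0"
  shows "(z, w, proj_pt \<sigma> \<tau>) \<in> \<Phi> ` \<Omega>"
proof -
  define Z W c S T s where "Z = (norm z)^2" and "W = (norm w)^2" and "c = cdot z w"
    and "S = cmod2 \<sigma>" and "T = cmod2 \<tau>" and "s = \<sigma> * cnj \<tau>"
  note defs = Z_def W_def c_def S_def T_def s_def
  have z1: "norm z < 1" "norm w < 1" and z0: "z \<noteq> 0" "w \<noteq> 0" "z \<noteq> w" using D by (auto simp: D2_def)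
  have "0 < (norm z)^2 * (norm w)^2 - cmod2 (cdot z w)" unfolding cauchy_schwarz_2 using ncl by simp
  then have nc: "cmod2 (cdot z w) < (norm z)^2 * (norm w)^2" by simp
  have ZW: "0 < Z" "Z < 1" "0 < W" "W < 1" "cmod2 c < Z * W"
    using z1 z0 nc by (auto simp: defs abs_square_less_1)
  have ext: "pick_extremal [(0, 0), (z, \<sigma>), (w, \<tau>)]" using nd by (simp add: nondegenerate_extremal3_def)
  then obtain F0 where F0: "pick_solution F0 [(0, 0), (z, \<sigma>), (w, \<tau>)]" "pick_problem [(0, 0), (z, \<sigma>), (w, \<tau>)]"
    by (auto simp: pick_extremal_def pick_solvable_def)
  have st1: "cmod \<sigma> < 1" "cmod \<tau> < 1" using F0(2) by (auto simp: pick_problem_def)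
  have sv: "pick_solvable [(0, 0), (z, \<sigma>)]" "pick_solvable [(0, 0), (w, \<tau>)]" "pick_solvable [(z, \<sigma>), (w, \<tau>)]"
    using F0 by (auto simp: pick_solvable_def pick_solution_def pick_problem_def)
  have chi0: "norm (chi_aut 0 v) = norm v" for v by (simp add: chi_aut_def proj_onto_def norm_minus_cancel)
  have "cmod \<sigma> < norm z" "cmod \<tau> < norm w" "cmod (mob \<sigma> \<tau>) < norm (chi_aut z w)"
    using not_extremal_two_point_strict[OF sv(1)] not_extremal_two_point_strict[OF sv(2)]
      not_extremal_two_point_strict[OF sv(3)] nd
    by (simp_all add: nondegenerate_extremal3_def mob_0_left chi0)
  then have lt: "S < Z" "T < W" "1 - (norm (chi_aut z w))^2 < 1 - cmod2 (mob \<sigma> \<tau>)"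
    by (simp_all add: defs power_strict_mono)
  have "0 < cmod2 (1 - c)" "0 < cmod2 (1 - s)"
    using cmod_cdot_less_1[OF z1] mult_cnj_less_1[OF st1] by (auto simp: defs)
  then have "(1 - Z) * (1 - W) * cmod2 (1 - s) < (1 - S) * (1 - T) * cmod2 (1 - c)"
    using lt(3) unfolding norm_chi_aut_sq[OF z1] cmod_mob_sq[OF st1(1) less_imp_le[OF st1(2)]]
    by (simp add: defs[symmetric] divide_simps mult_ac)
  then have nd1: "pick_strict Z W c S T s" using lt by (simp add: pick_strict_def)
  define tst where "tst t \<longleftrightarrow> pick_tested Z W c (t^2 * S) (t^2 * T) (of_real (t^2) * s)" for t
  define nnd where "nnd t \<longleftrightarrow> pick_strict Z W c (t^2 * S) (t^2 * T) (of_real (t^2) * s)" for t :: real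
  define I where "I = {t. 0 \<le> t \<and> tst t}"
  \<comment> \<open>Otherwise scales tending to 0 fail, and the limit gives parameters with
    nonpositive determinant for zero targets, although it equals
    \<open>cmod2 x * cmod2 y * cmod2 (x - y)\<close>.\<close>
  have "\<exists>t0>0. tst t0"
  proof (rule ccontr)
    assume "\<not> ?thesis"
    then have 1: "\<not> tst (inverse (real (Suc n)))" for n by simp
    have 2: "pick_strict Z W c (0^2 * S) (0^2 * T) (of_real (0^2) * s)"
      using ZW gram_gap[OF ZW] by (simp add: pick_strict_def)
    obtain x y where xy: "cmod x < 1" "cmod y < 1" "Z < cmod2 x" "W < cmod2 y"
      "0 \<le> pick_det Z W c x y" "pick_det (0^2 * S) (0^2 * T) (of_real (0^2) * s) x y \<le> 0"
      using pick_tested_fails_near[OF ZW LIMSEQ_inverse_real_of_nat 1[unfolded tst_def] 2] by blast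
    have "x \<noteq> y" using pick_det_nonneg_strict(3)[OF ZW xy(1,2) _ _ xy(5)] xy by simp
    moreover have "pick_det 0 0 0 x y = cmod2 x * cmod2 y * cmod2 (x - y)"
      unfolding pick_det_def cmod_one_minus_sq by (simp add: norm_mult power_mult_distrib algebra_simps)
    moreover have "x \<noteq> 0" "y \<noteq> 0" using xy ZW by auto
    ultimately have "0 < pick_det 0 0 0 x y" by simp
    then show False using xy(6) by simp
  qed
  then obtain t0 where t0: "0 < t0" "tst t0" by blast
  have bdd: "bdd_above I"
  proof -
    have S0: "0 \<le> S" "0 \<le> T" "0 < S + T" using st0 by (auto simp: S_def T_def add_pos_nonneg add_nonneg_pos)
    have "t \<le> 1 + 2 / (S + T)" if "t \<in> I" for t
    proof -
      have "t^2 * S \<le> 1" "t^2 * T \<le> 1" "0 \<le> t" using that ZW by (auto simp: I_def tst_def pick_tested_def)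
      then have "t^2 * (S + T) \<le> 2" by (simp add: distrib_left)
      then have t2: "t^2 \<le> 2 / (S + T)" using S0 by (simp add: pos_le_divide_eq)
      have "t \<le> 1 + t^2" using zero_le_power2[of "t - 1"] \<open>0 \<le> t\<close> by (simp add: power2_diff)
      then show ?thesis using t2 by linarith
    qed
    then show ?thesis unfolding bdd_above_def by blast
  qed
  define ts where "ts = Sup I"
  have t0I: "t0 \<in> I" using t0 by (simp add: I_def)
  have tsI: "ts \<in> I"
    unfolding ts_def by (rule closed_contains_Sup) (use t0I bdd pick_tested_closed[of Z W c S T s] in \<open>auto simp: I_def tst_def\<close>)
  have tst: "tst ts" using tsI by (simp add: I_def)
  have ts0: "0 < ts" using cSup_upper[OF t0I bdd] t0 by (simp add: ts_def)
  have above: "\<not> tst t" if "ts < t" for t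
    using cSup_upper[OF _ bdd, of t] that ts0 by (auto simp: ts_def I_def)
  define \<sigma>' \<tau>' where "\<sigma>' = of_real ts * \<sigma>" and "\<tau>' = of_real ts * \<tau>"
  have st': "cmod2 \<sigma>' = ts^2 * S" "cmod2 \<tau>' = ts^2 * T" "\<sigma>' * cnj \<tau>' = of_real (ts^2) * s"
    using ts0 by (simp_all add: \<sigma>'_def \<tau>'_def defs norm_mult power_mult_distrib power2_eq_square mult_ac)
  have tt: "pick_tested Z W c (cmod2 \<sigma>') (cmod2 \<tau>') (\<sigma>' * cnj \<tau>')"
    using tst unfolding tst_def st' .
  show ?thesis
  proof (cases "nnd ts")
    case True
    \<comment> \<open>Scales above \<open>ts\<close> fail, so in the limit the target determinant is
      nonpositive at some admissible parameter; \<open>ts\<close> itself passes, so it is 0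
      there.\<close>
    have lim: "(\<lambda>n. ts + inverse (real (Suc n))) \<longlonglongrightarrow> ts"
      using tendsto_add[OF tendsto_const LIMSEQ_inverse_real_of_nat, of ts] by simp
    have nt: "\<not> tst (ts + inverse (real (Suc n)))" for n by (rule above) simp
    obtain x y where xy: "cmod x < 1" "cmod y < 1" "Z < cmod2 x" "W < cmod2 y"
      "0 \<le> pick_det Z W c x y" "pick_det (ts^2 * S) (ts^2 * T) (of_real (ts^2) * s) x y \<le> 0"
      using pick_tested_fails_near[OF ZW lim nt[unfolded tst_def] True[unfolded nnd_def]] by blast
    have crit: "0 \<le> pick_det (cmod2 \<sigma>') (cmod2 \<tau>') (\<sigma>' * cnj \<tau>') x y"
      if "cmod x < 1" "cmod y < 1" "Z < cmod2 x" "W < cmod2 y" "0 \<le> pick_det Z W c x y" for x y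
      using tt that unfolding pick_tested_def by blast
    have zero: "pick_det (cmod2 \<sigma>') (cmod2 \<tau>') (\<sigma>' * cnj \<tau>') x y = 0"
      using crit[OF xy(1-5)] xy(6) unfolding st' by simp
    have lt': "cmod2 \<sigma>' < cmod2 x" "cmod2 \<tau>' < cmod2 y"
      using True xy(3,4) unfolding nnd_def pick_strict_def st' by auto
    have n0: "(\<sigma>', \<tau>') \<noteq> (0, 0)" using st0 ts0 by (auto simp: \<sigma>'_def \<tau>'_def)
    have "(z, w, proj_pt \<sigma>' \<tau>') \<in> \<Phi> ` \<Omega>"
      by (rule critical_point_in_image[OF z1 nc n0 xy(1,2) _ _ lt' _ zero])
         (use xy crit in \<open>auto simp: defs\<close>)
    moreover have "proj_pt \<sigma>' \<tau>' = proj_pt \<sigma> \<tau>"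
      by (rule proj_pt_scale[OF st0, of "of_real ts"]) (use ts0 in \<open>auto simp: \<sigma>'_def \<tau>'_def\<close>)
    ultimately show ?thesis by simp
  next
    case False
    \<comment> \<open>Up to scale 1 the two-point inequalities stay strict, so they can become
      equalities only beyond it.\<close>
    have "1 < ts"
    proof (rule ccontr)
      assume "\<not> 1 < ts"
      then have "nnd ts"
        unfolding nnd_def using pick_strict_scale_down[of Z W c \<sigma> \<tau> ts] nd1 ZW ts0 by (simp add: defs)
      then show False using False by simp
    qed
    have tt': "cmod2 \<sigma>' \<le> Z" "cmod2 \<tau>' \<le> W"
      "(1 - Z) * (1 - W) * cmod2 (1 - \<sigma>' * cnj \<tau>') \<le> (1 - cmod2 \<sigma>') * (1 - cmod2 \<tau>') * cmod2 (1 - c)"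
      using tt by (auto simp: pick_tested_def)
    have "cmod2 \<sigma>' < 1" "cmod2 \<tau>' < 1" using tt' ZW by linarith+
    then have st'1: "cmod \<sigma>' < 1" "cmod \<tau>' < 1" by (simp_all add: abs_square_less_1)
    note tt2 = tt[unfolded Z_def W_def c_def]
    have "cmod2 \<sigma>' = Z \<or> cmod2 \<tau>' = W \<or>
      (1 - Z) * (1 - W) * cmod2 (1 - \<sigma>' * cnj \<tau>') = (1 - cmod2 \<sigma>') * (1 - cmod2 \<tau>') * cmod2 (1 - c)"
      using False tt' unfolding nnd_def pick_strict_def st' by linarith
    then have "\<exists>F. pick_solution F [(0, 0), (z, \<sigma>'), (w, \<tau>')]"
    proof (elim disjE)
      assume "cmod2 \<sigma>' = Z"
      then have "cmod \<sigma>' = norm z" by (simp add: Z_def power2_eq_iff_nonneg)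
      then show ?thesis using degenerate_solution[OF z1 nc _ st'1(2) tt2] by blast
    next
      assume "cmod2 \<tau>' = W"
      then have "cmod \<tau>' = norm w" by (simp add: W_def power2_eq_iff_nonneg)
      then show ?thesis using degenerate_solution_swap[OF z1 nc _ st'1(1) tt2] by blast
    next
      assume "(1 - Z) * (1 - W) * cmod2 (1 - \<sigma>' * cnj \<tau>') = (1 - cmod2 \<sigma>') * (1 - cmod2 \<tau>') * cmod2 (1 - c)"
      then show ?thesis using degenerate_solution_base_change[OF z1 nc st'1 _ tt2] by (simp add: defs)
    qed
    then obtain F where F: "holomorphic2_on F ball2" "F ` ball2 \<subseteq> unit_disc" "F 0 = 0" "F z = \<sigma>'" "F w = \<tau>'"
      by (auto simp: pick_solution_def)
    define G where "G p = of_real (1 / ts) * F p" for p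
    have "holomorphic2_on G ball2" unfolding G_def by (intro holomorphic2_mult holomorphic2_const F)
    moreover have sub: "G ` ball2 \<subseteq> cball 0 (1 / ts)"
    proof
      fix v assume "v \<in> G ` ball2"
      then obtain p where p: "p \<in> ball2" "v = G p" by auto
      then have "cmod (F p) < 1" using F(2) by (auto simp: image_subset_iff)
      then show "v \<in> cball 0 (1 / ts)" using p ts0 by (simp add: G_def norm_mult norm_divide divide_right_mono)
    qed
    moreover have "1 / ts < 1" using \<open>1 < ts\<close> by simp
    moreover then have "cball 0 (1 / ts) \<subseteq> ball (0::complex) 1" by auto
    moreover have "G 0 = 0" "G z = \<sigma>" "G w = \<tau>" using F ts0 by (simp_all add: G_def \<sigma>'_def \<tau>'_def)
    ultimately have "pick_solution G [(0, 0), (z, \<sigma>), (w, \<tau>)]" "relatively_compact_in (G ` ball2) unit_disc"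
      unfolding pick_solution_def relatively_compact_in_disc_iff by auto
    then show ?thesis using ext by (auto simp: pick_extremal_def)
  qed
qed

theorem theorem4: "\<Phi> ` \<Omega> = \<A> - \<C>"
proof
  show "\<Phi> ` \<Omega> \<subseteq> \<A> - \<C>"
  proof (rule image_subsetI)
    fix p assume "p \<in> \<Omega>"
    then show "\<Phi> p \<in> \<A> - \<C>" by (cases p) (use Phi_in_A_minus_C in blast)
  qed
  show "\<A> - \<C> \<subseteq> \<Phi> ` \<Omega>"
  proof
    fix q assume q: "q \<in> \<A> - \<C>"
    then obtain z w \<sigma> \<tau> where q': "q = (z, w, proj_pt \<sigma> \<tau>)" "(z, w) \<in> D2" "(\<sigma>, \<tau>) \<noteq> (0, 0)"
      and nd: "nondegenerate_extremal3 (0, 0) (z, complex_of_real (extremal_scale z w \<sigma> \<tau>) * \<sigma>)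
            (w, complex_of_real (extremal_scale z w \<sigma> \<tau>) * \<tau>)"
      unfolding \<A>_def by blast
    define t where "t = complex_of_real (extremal_scale z w \<sigma> \<tau>)"
    \<comment> \<open>Positivity of a \<open>THE\<close> value would presuppose existence of a
      scale. Extremality suffices instead: zero targets are solved by the zero function.\<close>
    have "t \<noteq> 0"
    proof
      assume "t = 0"
      then have "pick_extremal [(0, 0), (z, 0), (w, 0)]"
        using nd by (simp add: nondegenerate_extremal3_def t_def)
      moreover have "pick_solution (\<lambda>p. 0) [(0, 0), (z, 0), (w, 0)]"
        by (auto simp: pick_solution_def)
      moreover have "relatively_compact_in ((\<lambda>p. 0) ` ball2) unit_disc"
        unfolding relatively_compact_in_disc_iff by (intro exI[of _ 0]) auto
      ultimately show False by (auto simp: pick_extremal_def)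
    qed
    then have pt: "proj_pt (t * \<sigma>) (t * \<tau>) = proj_pt \<sigma> \<tau>" "(t * \<sigma>, t * \<tau>) \<noteq> (0, 0)"
      using proj_pt_scale[OF q'(3)] q'(3) by auto
    have "proj_pt \<sigma> \<tau> \<in> P1" using q'(3) by (auto simp: P1_def proj_pt_def quotient_def)
    then have "z $ 1 * w $ 2 - z $ 2 * w $ 1 \<noteq> 0"
      using collinear_in_C q q' by blast
    then show "q \<in> \<Phi> ` \<Omega>"
      using nondegenerate_in_Phi_image[OF q'(2) pt(2)] nd unfolding q'(1) t_def[symmetric] pt(1) by blast
  qed
qed

end
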